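(* Let $s\geq 4$ and $t\geq 3$ be integers. Then, as $n\to\infty$, \[ \mathrm{ex}(n,C_s,\textnormal{rainbow-}C_t)= \begin{cases} \Theta(n^{s/2}) & \text{if } t=4,\\ \Theta(n^{s/2}) & \text{if } s,t \text{ are even with } s\neq t,\\ \Theta(n^{s/2-1}) & \text{if } s=t\geq 6 \text{ and } t \text{ is even},\\ \Theta(n^{(s-1)/2}) & \text{if } t\geq 6 \text{ is even and } s \text{ is odd},\\ \Theta(n^{s-2}) & \text{if } s,t \text{ are odd with } s\leq t,\\ \Theta(n^{s}) & \text{if } t \text{ is odd, and } s>t \text{ or } s \text{ is even}. \end{cases} \]
   Context: A proper edge-colouring of a graph assigns colours to edges so that any two edges sharing a vertex receive different colours. A subgraph of an edge-coloured graph is rainbow if all its edges have distinct colours. For graphs $H,F$, $\mathrm{ex}(n,H,\textnormal{rainbow-}F)$ denotes the maximum number of subgraphs isomorphic to $H$ (copies of $H$) in a properly edge-coloured graph on $n$ vertices that contains no rainbow subgraph isomorphic to $F$. $C_m$ denotes the cycle of length $m$. The constants implied by $\Theta$ may depend on $s$ and $t$. *)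

theory Defs
  imports Complex_Main "HOL-Library.Landau_Symbols"
begin

type_synonym 'a graph = "'a set \<times> 'a set set"

abbreviation verts :: "'a graph \<Rightarrow> 'a set" where "verts \<equiv> fst"
abbreviation edges :: "'a graph \<Rightarrow> 'a set set" where "edges \<equiv> snd"

definition simple_graph :: "'a graph \<Rightarrow> bool" where
  "simple_graph G \<longleftrightarrow> finite (verts G) \<and> (\<forall>e\<in>edges G. e \<subseteq> verts G \<and> card e = 2)"

definition subgraph :: "'a graph \<Rightarrow> 'a graph \<Rightarrow> bool" where
  "subgraph S G \<longleftrightarrow> simple_graph S \<and> verts S \<subseteq> verts G \<and> edges S \<subseteq> edges G"

definition graph_iso :: "'a graph \<Rightarrow> 'b graph \<Rightarrow> bool" where
  "graph_iso G H \<longleftrightarrow>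
     (\<exists>f. bij_betw f (verts G) (verts H) \<and> (\<lambda>e. f ` e) ` edges G = edges H)"

text \<open>Copies are unlabelled: they are subgraphs, not embeddings.\<close>
definition copies :: "'b graph \<Rightarrow> 'a graph \<Rightarrow> 'a graph set" where
  "copies H G = {S. subgraph S G \<and> graph_iso S H}"

text \<open>The value of a colouring on sets that are not edges is irrelevant.\<close>
definition proper_edge_colouring :: "'a graph \<Rightarrow> ('a set \<Rightarrow> 'c) \<Rightarrow> bool" where
  "proper_edge_colouring G c \<longleftrightarrow>
     (\<forall>e\<in>edges G. \<forall>e'\<in>edges G. e \<noteq> e' \<and> e \<inter> e' \<noteq> {} \<longrightarrow> c e \<noteq> c e')"

definition rainbow :: "('a set \<Rightarrow> 'c) \<Rightarrow> 'a graph \<Rightarrow> bool" where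
  "rainbow c S \<longleftrightarrow> inj_on c (edges S)"

definition rainbow_free :: "'b graph \<Rightarrow> 'a graph \<Rightarrow> ('a set \<Rightarrow> 'c) \<Rightarrow> bool" where
  "rainbow_free F G c \<longleftrightarrow> \<not> (\<exists>S\<in>copies F G. rainbow c S)"

text \<open>Vertices and colours are natural numbers; since all graphs are finite, every
  edge-coloured graph is isomorphic to one of this kind.\<close>
definition rainbow_copy_counts :: "nat \<Rightarrow> 'b graph \<Rightarrow> 'd graph \<Rightarrow> nat set" where
  "rainbow_copy_counts n H F =
     {card (copies H G) | (G :: nat graph) (c :: nat set \<Rightarrow> nat).
        simple_graph G \<and> card (verts G) = n \<and> proper_edge_colouring G c \<and> rainbow_free F G c}"

definition ex_rainbow :: "nat \<Rightarrow> 'b graph \<Rightarrow> 'd graph \<Rightarrow> nat" where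
  "ex_rainbow n H F = Max (rainbow_copy_counts n H F)"

text \<open>Only meaningful for \<open>m \<ge> 3\<close>.\<close>
definition cycle_graph :: "nat \<Rightarrow> nat graph" where
  "cycle_graph m = ({..<m}, (\<lambda>i. {i, Suc i mod m}) ` {..<m})"

lemma simple_cycle_graph:
  assumes "m \<ge> 3"
  shows "simple_graph (cycle_graph m)"
proof -
  have "i \<noteq> Suc i mod m" if "i < m" for i
    using assms that by (cases "Suc i = m") auto
  then show ?thesis
    using assms by (auto simp: simple_graph_def cycle_graph_def card_2_iff)
qed

text \<open>The maximum defining \<open>ex_rainbow\<close> is taken over a finite set, which is nonempty as
  soon as the forbidden graph has an edge.\<close>

lemma finite_rainbow_copy_counts: "finite (rainbow_copy_counts n H F)"
proof (rule finite_subset)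
  show "rainbow_copy_counts n H F \<subseteq> {.. 2 ^ n * 2 ^ (2 ^ n)}"
  proof
    fix k assume "k \<in> rainbow_copy_counts n H F"
    then obtain G :: "nat graph" where G: "simple_graph G" "card (verts G) = n"
      and k: "k = card (copies H G)"
      by (auto simp: rainbow_copy_counts_def)
    have fin: "finite (verts G)" using G by (simp add: simple_graph_def)
    have "copies H G \<subseteq> Pow (verts G) \<times> Pow (Pow (verts G))"
      using G by (fastforce simp: copies_def subgraph_def simple_graph_def)
    then have "card (copies H G) \<le> card (Pow (verts G) \<times> Pow (Pow (verts G)))"
      using fin by (intro card_mono) auto
    also have "\<dots> = 2 ^ n * 2 ^ (2 ^ n)"
      using fin G by (simp add: card_cartesian_product card_Pow)
    finally show "k \<in> {.. 2 ^ n * 2 ^ (2 ^ n)}" using k by simp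
  qed
qed simp

lemma rainbow_copy_counts_nonempty:
  assumes "edges F \<noteq> {}"
  shows "rainbow_copy_counts n H F \<noteq> {}"
proof -
  let ?G = "({..<n}, {}) :: nat graph"
  have "simple_graph ?G" "card (verts ?G) = n" "proper_edge_colouring ?G (\<lambda>_. 0::nat)"
    "rainbow_free F ?G (\<lambda>_. 0::nat)"
    using assms by (auto simp: simple_graph_def proper_edge_colouring_def rainbow_free_def
        copies_def subgraph_def graph_iso_def)
  then show ?thesis unfolding rainbow_copy_counts_def by blast
qed

end

(*
  Upper bounds for even t. If a set R of edges pq with p adjacent to a fixed vertex u has more than
  3t (|{p}| + |{q}|) elements, then R has a subgraph of large minimum degree, and a generic (hence
  rainbow) path alternating in it closes through u to a rainbow C_t. So |R| = O(|{p}| + |{q}|) for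
  such "fans". Hence there are O(n) walks of length two from every vertex, and applying the bound to
  two consecutive vertices of C_s, the rest being fixed, bounds the number of C_s by O(1) times the
  number of walks with s - 2 edges. For even s this is O(n^(s/2)). For odd s and t >= 6 one needs
  that there are O(n^2) walks a x y b: unless almost all walks between a and b share x, or y, or the
  colour of xy, one finds a rainbow C_t in the union of the walks leaving a, and each of these three
  exceptions is again controlled by fans. For s = t all cycles have two edges of equal colour, which
  saves a further factor n.

  Upper bound for odd s <= t. Given many closed walks of length s, there is a subfamily in which
  every vertex, with two adjacent exceptions, can be exchanged in many ways without leaving the
  family. Going back and forth between two exchangeable positions lengthens the walk to a rainbow
  C_t.

  Lower bounds. Except for t = 4 they come from blowing up some vertices of a cycle and, where needed,
  replacing two of its edges by monochromatic matchings of the same colour. For t = 4 take the Cayley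
  graph of GF(2^k)^2, k odd, with generators (x, x^3), x nonzero, each edge coloured by its generator:
  a rainbow C_4 would violate the Sidon property of the generators in characteristic 2.
*)
theory Submission
  imports Defs "HOL-Algebra.Algebraic_Closure_Type"
begin

section \<open>Rainbow paths and fans in properly coloured graphs\<close>

text \<open>Genericity is mere counting: by properness a colour already used excludes at most one
  neighbour of a given vertex, so a rainbow path with l vertices can be prolonged or closed once
  there are more than 3 l candidates. This is the origin of 3 t. Fans add two edges to a walk at the
  price of a factor n. For odd s one edge is left over. For t = 4 it costs n^(3/2) by
  Cauchy-Schwarz, which is sharp. For t >= 6 this loses a factor n^(1/2), and a block of three edges
  has to be counted at once; one of its exceptions is bounded in terms of the number of these blocks
  itself, so that a quadratic inequality results. For odd s <= t the obstacle is that
  exchangeability is not inherited by subfamilies, whereas its opposite is. Positions are therefore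
  made inflexible one by one at the cost of a constant factor. Two non-adjacent inflexible positions
  give (card D)^2 = O(n^(s-2) N), where N counts all closed walks and D is a constant fraction of
  them, and one factor N cancels. The field has 2^k elements with k odd because cubing is then
  bijective, on which the count of the cycles rests.\<close>

fun path_cols :: "('a \<Rightarrow> 'a \<Rightarrow> 'c) \<Rightarrow> 'a list \<Rightarrow> 'c list" where
  "path_cols col (x # y # zs) = col x y # path_cols col (y # zs)"
| "path_cols col _ = []"

lemma length_path_cols [simp]: "length (path_cols col vs) = length vs - 1"
  by (induction col vs rule: path_cols.induct) auto

lemma path_cols_Cons: "vs \<noteq> [] \<Longrightarrow> path_cols col (x # vs) = col x (hd vs) # path_cols col vs"
  by (cases vs) auto

lemma nth_path_cols: "Suc i < length vs \<Longrightarrow> path_cols col vs ! i = col (vs ! i) (vs ! Suc i)"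
proof (induction col vs arbitrary: i rule: path_cols.induct)
  case (1 col x y zs)
  then show ?case by (cases i) auto
qed auto

text \<open>Curried \<open>adj\<close> and \<open>col\<close> on an arbitrary vertex type, so that
  the same theory serves the given graphs on natural numbers and the constructions of the lower
  bounds. Off the edges \<open>col\<close> only has to be symmetric.\<close>

locale coloured_graph =
  fixes V :: "'a set" and adj :: "'a \<Rightarrow> 'a \<Rightarrow> bool" and col :: "'a \<Rightarrow> 'a \<Rightarrow> 'c"
  assumes finite_V: "finite V"
    and adj_V: "adj x y \<Longrightarrow> x \<in> V"
    and adj_sym: "adj x y \<Longrightarrow> adj y x"
    and adj_irrefl: "\<not> adj x x"
    and col_sym: "col x y = col y x"
    and col_proper: "adj x y \<Longrightarrow> adj x z \<Longrightarrow> col x y = col x z \<Longrightarrow> y = z"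
begin

lemma adj_V2: "adj x y \<Longrightarrow> y \<in> V"
  using adj_V adj_sym by blast

text \<open>Labelled cycles: for s >= 3 a subgraph isomorphic to C_s corresponds to 2 s lists, a
  constant factor.\<close>

definition cycles :: "nat \<Rightarrow> 'a list set" where
  "cycles s = {vs. length vs = s \<and> distinct vs \<and> successively adj vs \<and> adj (last vs) (hd vs)}"

definition rainbow_cycle :: "'a list \<Rightarrow> bool" where
  "rainbow_cycle vs \<longleftrightarrow> distinct (col (last vs) (hd vs) # path_cols col vs)"

definition rainbow_cycle_free :: "nat \<Rightarrow> bool" where
  "rainbow_cycle_free t \<longleftrightarrow> (\<forall>vs\<in>cycles t. \<not> rainbow_cycle vs)"

definition rainbow_path :: "'a list \<Rightarrow> bool" where
  "rainbow_path ws \<longleftrightarrow> distinct ws \<and> successively adj ws \<and> distinct (path_cols col ws)"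

definition walks :: "nat \<Rightarrow> 'a list set" where
  "walks l = {vs. length vs = Suc l \<and> set vs \<subseteq> V \<and> successively adj vs}"

abbreviation nbrs :: "'a \<Rightarrow> 'a set" where "nbrs x \<equiv> {y. adj x y}"

lemma nbrs_subset: "nbrs x \<subseteq> V"
  using adj_V2 by blast

lemma finite_nbrs [simp]: "finite (nbrs x)"
  using finite_V nbrs_subset finite_subset by blast

lemma finite_adj [simp]: "finite {y. adj x y \<and> P y}" "finite {y. adj y x \<and> P y}"
  by (rule finite_subset[OF _ finite_V], use adj_V adj_V2 in blast)+

lemma adj_commute: "adj x y \<longleftrightarrow> adj y x"
  using adj_sym by blast

lemma rainbow_path_Cons:
  "ws \<noteq> [] \<Longrightarrow> rainbow_path (x # ws) \<longleftrightarrow>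
     rainbow_path ws \<and> x \<notin> set ws \<and> adj x (hd ws) \<and> col x (hd ws) \<notin> set (path_cols col ws)"
  by (auto simp: rainbow_path_def successively_Cons path_cols_Cons)

lemma rainbow_cycle_closing:
  assumes "rainbow_path ws" "length ws = t" "t \<ge> 3" "adj (last ws) (hd ws)"
    "col (last ws) (hd ws) \<notin> set (path_cols col ws)"
  shows "\<not> rainbow_cycle_free t"
  using assms unfolding rainbow_cycle_free_def cycles_def rainbow_cycle_def rainbow_path_def
  by auto

text \<open>By properness every colour in \<open>cs\<close> excludes at most one neighbour of \<open>q\<close> and one of \<open>u\<close>.\<close>

lemma pick_generic:
  assumes S: "S \<subseteq> {x. adj q x \<and> adj u x}" and card: "card S > length ws + 2 * length cs"
  obtains x where "x \<in> S" "x \<notin> set ws" "col q x \<notin> set cs" "col u x \<notin> set cs"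
proof -
  have fin: "finite S"
    using S finite_adj(1)[of q "adj u"] finite_subset by blast
  have bad: "card {x \<in> S. col z x \<in> set cs} \<le> length cs" if "z = q \<or> z = u" for z
  proof -
    have "inj_on (col z) {x \<in> S. col z x \<in> set cs}"
      using S that col_proper by (intro inj_onI) blast
    then have "card {x \<in> S. col z x \<in> set cs} = card (col z ` {x \<in> S. col z x \<in> set cs})"
      by (simp add: card_image)
    also have "\<dots> \<le> card (set cs)"
      by (rule card_mono) auto
    finally show ?thesis using card_length[of cs] by linarith
  qed
  let ?B = "(S \<inter> set ws) \<union> {x \<in> S. col q x \<in> set cs} \<union> {x \<in> S. col u x \<in> set cs}"
  have "card ?B \<le> card (S \<inter> set ws) + card {x \<in> S. col q x \<in> set cs} + card {x \<in> S. col u x \<in> set cs}"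
    by (meson add_right_mono card_Un_le le_trans)
  also have "\<dots> \<le> length ws + length cs + length cs"
    using bad card_length[of ws] card_mono[of "set ws" "S \<inter> set ws"] fin
    by (intro add_mono) auto
  finally have "card ?B < card S" using card by simp
  then have "\<not> S \<subseteq> ?B" using fin card_mono[of ?B S] by auto
  then show ?thesis using that by blast
qed

lemma pick_neighbour:
  assumes "S \<subseteq> nbrs q" "card S > length ws + 2 * length cs"
  obtains x where "x \<in> S" "x \<notin> set ws" "col q x \<notin> set cs"
  using pick_generic[of S q q ws cs] assms by auto

text \<open>A path with l vertices carries l - 1 colours, so \<open>pick_generic\<close> has to
  avoid l + 2 (l - 1) < 3 l candidates.\<close>

lemma extend_rainbow_path:
  assumes "rainbow_path ws" "ws \<noteq> []" "S \<subseteq> nbrs (hd ws)" "card S > 3 * length ws"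
  obtains x where "x \<in> S" "rainbow_path (x # ws)"
proof -
  have "card S > length ws + 2 * length (path_cols col ws)"
    using assms by simp
  from pick_neighbour[OF assms(3) this] obtain x
    where "x \<in> S" "x \<notin> set ws" "col (hd ws) x \<notin> set (path_cols col ws)" .
  moreover from this have "adj x (hd ws)" using assms(3) adj_sym by auto
  ultimately show ?thesis
    using that[of x] assms rainbow_path_Cons[of ws x] col_sym[of x "hd ws"] by auto
qed

lemma close_rainbow_path:
  assumes path: "rainbow_path ws" "length ws \<ge> 2" "Suc (length ws) = t"
    and S: "S \<subseteq> {x. adj (hd ws) x \<and> adj (last ws) x}" "card S > 3 * length ws"
  shows "\<not> rainbow_cycle_free t"
proof -
  have ne: "ws \<noteq> []" using path by auto
  have "card S > length ws + 2 * length (path_cols col ws)"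
    using S by simp
  from pick_generic[OF S(1) this] obtain x where x: "x \<in> S" "x \<notin> set ws"
    "col (hd ws) x \<notin> set (path_cols col ws)" "col (last ws) x \<notin> set (path_cols col ws)" .
  have adj: "adj x (hd ws)" "adj (last ws) x"
    using x(1) S(1) adj_sym by auto
  have p: "rainbow_path (x # ws)"
    using rainbow_path_Cons[OF ne] path x adj col_sym[of x "hd ws"] by auto
  \<comment> \<open>This is the role of \<open>length ws \<ge> 2\<close>: the two new edges at x are
    different, so properness separates their colours.\<close>
  have "hd ws \<noteq> last ws"
    using path by (cases ws) (auto simp: rainbow_path_def)
  then have "col (last ws) x \<noteq> col x (hd ws)"
    using col_proper[of x "hd ws" "last ws"] adj adj_sym col_sym[of x "last ws"] by auto
  then show ?thesis
    using p path x adj ne by (intro rainbow_cycle_closing[of "x # ws"]) (auto simp: path_cols_Cons)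
qed

end

lemma card_filter_split:
  assumes "finite A"
  shows "card A = card {x \<in> A. P x} + card {x \<in> A. \<not> P x}"
proof -
  have "A = {x \<in> A. P x} \<union> {x \<in> A. \<not> P x}" by blast
  then show ?thesis
    using card_Un_disjoint[of "{x \<in> A. P x}" "{x \<in> A. \<not> P x}"] assms by fastforce
qed

lemma minimal_dense_slice:
  fixes R :: "'z set" and f :: "'z \<Rightarrow> 'a" and g :: "'z \<Rightarrow> 'b"
  assumes fin: "finite R" and big: "card R > K * (card (f ` R) + card (g ` R))"
    and min: "\<And>Q. Q \<subset> R \<Longrightarrow> card Q \<le> K * (card (f ` Q) + card (g ` Q))"
    and z: "z \<in> R"
  shows "card {w \<in> R. f w = f z} > K"
proof (rule ccontr)
  assume le: "\<not> ?thesis"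
  let ?Q = "{w \<in> R. f w \<noteq> f z}"
  have un: "card R = card {w \<in> R. f w = f z} + card ?Q"
    using card_filter_split[OF fin] .
  have "card (f ` ?Q) \<le> card (f ` R - {f z})"
    using fin by (intro card_mono) auto
  moreover have "card (f ` R) = Suc (card (f ` R - {f z}))"
    using fin z by (intro card.remove) auto
  ultimately have 1: "card (f ` ?Q) + 1 \<le> card (f ` R)" by linarith
  have 2: "card (g ` ?Q) \<le> card (g ` R)"
    using fin by (intro card_mono) auto
  have "K * (card (f ` ?Q) + card (g ` ?Q)) + K = K * ((card (f ` ?Q) + 1) + card (g ` ?Q))"
    by (simp add: algebra_simps)
  also have "\<dots> \<le> K * (card (f ` R) + card (g ` R))"
    using 1 2 by (intro mult_le_mono2 add_mono)
  finally have "card ?Q > K * (card (f ` ?Q) + card (g ` ?Q))"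
    using big un le by linarith
  moreover have "?Q \<subset> R" using z by auto
  ultimately show False using min[of ?Q] by linarith
qed

text \<open>The bipartite form of the fact that large average degree yields a subgraph of large
  minimum degree. The two sides are the projections of R and may overlap as sets of
  vertices.\<close>

lemma dense_core:
  fixes R :: "('a \<times> 'b) set"
  assumes "finite R" "card R > K * (card (fst ` R) + card (snd ` R))"
  obtains R' where "R' \<subseteq> R" "R' \<noteq> {}"
    "\<And>p q. (p, q) \<in> R' \<Longrightarrow> card {q'. (p, q') \<in> R'} > K"
    "\<And>p q. (p, q) \<in> R' \<Longrightarrow> card {p'. (p', q) \<in> R'} > K"
proof -
  define good where "good = (\<lambda>Q :: ('a \<times> 'b) set. Q \<subseteq> R \<and> card Q > K * (card (fst ` Q) + card (snd ` Q)))"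
  obtain R' where R': "good R'" and min: "\<And>Q. good Q \<Longrightarrow> card R' \<le> card Q"
    using ex_has_least_nat[of good R card] assms by (auto simp: good_def)
  have sub: "R' \<subseteq> R" and big: "card R' > K * (card (fst ` R') + card (snd ` R'))"
    using R' by (auto simp: good_def)
  have fin: "finite R'" using sub assms(1) finite_subset by blast
  have min': "card Q \<le> K * (card (fst ` Q) + card (snd ` Q))" if "Q \<subset> R'" for Q
    using min[of Q] psubset_card_mono[OF fin that] that sub unfolding good_def by fastforce
  have 1: "card {q'. (p, q') \<in> R'} > K" if pq: "(p, q) \<in> R'" for p q
  proof -
    have "K < card {w \<in> R'. fst w = fst (p, q)}"
      by (rule minimal_dense_slice[where g = snd]) (use fin big min' pq in auto)
    also have "{w \<in> R'. fst w = fst (p, q)} = Pair p ` {q'. (p, q') \<in> R'}" by auto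
    also have "card \<dots> = card {q'. (p, q') \<in> R'}" by (intro card_image) (auto simp: inj_on_def)
    finally show ?thesis .
  qed
  have 2: "card {p'. (p', q) \<in> R'} > K" if pq: "(p, q) \<in> R'" for p q
  proof -
    have "K < card {w \<in> R'. snd w = snd (p, q)}"
      by (rule minimal_dense_slice[where g = fst]) (use fin big min' pq in \<open>auto simp: add.commute\<close>)
    also have "{w \<in> R'. snd w = snd (p, q)} = (\<lambda>p'. (p', q)) ` {p'. (p', q) \<in> R'}" by auto
    also have "card \<dots> = card {p'. (p', q) \<in> R'}" by (intro card_image) (auto simp: inj_on_def)
    finally show ?thesis .
  qed
  have "R' \<noteq> {}" using big by auto
  then show ?thesis using that sub 1 2 by blast
qed

context coloured_graph
begin

text \<open>A dense bipartite graph between neighbours of \<open>u\<close> and arbitrary vertices contains a long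
  generic path that starts and ends at neighbours of \<open>u\<close>, and \<open>u\<close> closes it to a cycle.\<close>

lemma fan_bound:
  assumes free: "rainbow_cycle_free t" and t: "even t" "t \<ge> 4"
    and R: "\<And>p q. (p, q) \<in> R \<Longrightarrow> adj u p \<and> adj p q"
  shows "card R \<le> 3 * t * (card (fst ` R) + card (snd ` R))"
proof (rule ccontr)
  assume "\<not> ?thesis"
  then have big: "card R > 3 * t * (card (fst ` R) + card (snd ` R))" by simp
  have "finite R"
    using big card.infinite by fastforce
  then obtain R' where R': "R' \<subseteq> R" "R' \<noteq> {}"
    and deg1: "\<And>p q. (p, q) \<in> R' \<Longrightarrow> card {q'. (p, q') \<in> R'} > 3 * t"
    and deg2: "\<And>p q. (p, q) \<in> R' \<Longrightarrow> card {p'. (p', q) \<in> R'} > 3 * t"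
    using dense_core[OF _ big] by metis
  have R'adj: "adj u p" "adj p q" if "(p, q) \<in> R'" for p q
    using that R R'(1) by auto
  \<comment> \<open>Lists grow at the head, and \<open>u\<close> stays last. From the head the path
    reads p, q, p, ..., p, u, and each round adds one q and one p.\<close>
  have ex: "\<exists>ws. rainbow_path ws \<and> length ws = 2 * Suc m \<and> last ws = u \<and> (\<exists>q. (hd ws, q) \<in> R')"
    if "2 * Suc m < t" for m
    using that
  proof (induction m)
    case 0
    obtain p q where pq: "(p, q) \<in> R'" using R'(2) by auto
    then have "rainbow_path [p, u]"
      using R'adj[OF pq] adj_irrefl adj_sym by (auto simp: rainbow_path_def)
    then show ?case using pq by (intro exI[of _ "[p, u]"]) auto
  next
    case (Suc m)
    then obtain ws q0 where ws: "rainbow_path ws" "length ws = 2 * Suc m" "last ws = u"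
      and q0: "(hd ws, q0) \<in> R'"
      by auto
    have ne: "ws \<noteq> []" using ws by auto
    have "{q'. (hd ws, q') \<in> R'} \<subseteq> nbrs (hd ws)" using R'adj by auto
    moreover have "card {q'. (hd ws, q') \<in> R'} > 3 * length ws"
      using deg1[OF q0] Suc.prems ws(2) by (intro le_less_trans[OF mult_le_mono2[of "length ws" t 3]]) auto
    ultimately obtain q where q: "(hd ws, q) \<in> R'" "rainbow_path (q # ws)"
      using extend_rainbow_path[OF ws(1) ne] by blast
    have "{p'. (p', q) \<in> R'} \<subseteq> nbrs (hd (q # ws))" using R'adj adj_sym by auto
    moreover have "card {p'. (p', q) \<in> R'} > 3 * length (q # ws)"
      using deg2[OF q(1)] Suc.prems ws(2) by simp
    ultimately obtain p where p: "(p, q) \<in> R'" "rainbow_path (p # q # ws)"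
      using extend_rainbow_path[OF q(2)] by blast
    then show ?case
      using ws ne by (intro exI[of _ "p # q # ws"]) auto
  qed
  \<comment> \<open>The path is stopped at t - 2 vertices: one more q, and a last p adjacent to both
    q and \<open>u\<close>, complete the cycle.\<close>
  obtain k where k: "t = 2 * k" using t(1) by (elim evenE)
  then have "2 * Suc (k - 2) < t" "2 * Suc (k - 2) + 2 = t" using t(2) by auto
  with ex[of "k - 2"] obtain ws q0 where ws: "rainbow_path ws" "length ws + 2 = t" "last ws = u"
    and q0: "(hd ws, q0) \<in> R'"
    by auto
  have ne: "ws \<noteq> []" using ws t by auto
  have "{q'. (hd ws, q') \<in> R'} \<subseteq> nbrs (hd ws)" using R'adj by auto
  moreover have "card {q'. (hd ws, q') \<in> R'} > 3 * length ws"
    using deg1[OF q0] ws(2) by linarith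
  ultimately obtain q where q: "(hd ws, q) \<in> R'" "rainbow_path (q # ws)"
    using extend_rainbow_path[OF ws(1) ne] by blast
  have "{p'. (p', q) \<in> R'} \<subseteq> {x. adj (hd (q # ws)) x \<and> adj (last (q # ws)) x}"
    using R'adj adj_sym ws ne by auto
  moreover have "card {p'. (p', q) \<in> R'} > 3 * length (q # ws)"
    using deg2[OF q(1)] ws(2) by simp
  ultimately have "\<not> rainbow_cycle_free t"
    using close_rainbow_path[OF q(2)] ws t by fastforce
  then show False using free by simp
qed

end

section \<open>Counting walks and cycles\<close>

text \<open>The scheme of all upper counts below: \<open>B\<close> holds the fixed part of a walk or
  cycle, \<open>C b\<close> its completions, usually a fan, and \<open>f b\<close> joins the
  two.\<close>

lemma card_UN_image_le:
  assumes "A \<subseteq> (\<Union>b\<in>B. f b ` C b)" "finite B" "\<And>b. b \<in> B \<Longrightarrow> finite (C b)"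
  shows "card A \<le> (\<Sum>b\<in>B. card (C b))"
proof -
  have "card A \<le> card (\<Union>b\<in>B. f b ` C b)"
    using assms by (intro card_mono) auto
  also have "\<dots> \<le> (\<Sum>b\<in>B. card (f b ` C b))"
    by (rule card_UN_le[OF assms(2)])
  also have "\<dots> \<le> (\<Sum>b\<in>B. card (C b))"
    using assms(3) by (intro sum_mono card_image_le) auto
  finally show ?thesis .
qed

text \<open>Cauchy-Schwarz against the constant function 1.\<close>

lemma sum_squared_le_card_mult:
  fixes f :: "'b \<Rightarrow> real"
  shows "(\<Sum>i\<in>I. f i)\<^sup>2 \<le> real (card I) * (\<Sum>i\<in>I. (f i)\<^sup>2)"
proof -
  have "0 \<le> (\<Sum>i\<in>I. \<Sum>j\<in>I. (f i - f j)\<^sup>2)"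
    by (intro sum_nonneg) auto
  also have "\<dots> = (\<Sum>i\<in>I. \<Sum>j\<in>I. (f i)\<^sup>2) + (\<Sum>i\<in>I. \<Sum>j\<in>I. (f j)\<^sup>2) - 2 * (\<Sum>i\<in>I. \<Sum>j\<in>I. f i * f j)"
    by (simp add: power2_diff sum.distrib sum_subtractf sum_distrib_left mult.assoc)
  also have "\<dots> = 2 * (real (card I) * (\<Sum>i\<in>I. (f i)\<^sup>2)) - 2 * (\<Sum>i\<in>I. f i)\<^sup>2"
  proof -
    have "(\<Sum>i\<in>I. \<Sum>j\<in>I. f i * f j) = (\<Sum>i\<in>I. f i)\<^sup>2"
      by (simp add: power2_eq_square sum_product)
    then show ?thesis by (simp add: sum_distrib_left)
  qed
  finally show ?thesis by simp
qed

context coloured_graph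
begin

lemma cycles_iff_nth:
  assumes "s \<ge> 1"
  shows "vs \<in> cycles s \<longleftrightarrow> length vs = s \<and> distinct vs \<and> (\<forall>i<s. adj (vs ! i) (vs ! (Suc i mod s)))"
proof (cases "length vs = s")
  case True
  have "(\<forall>i<s. adj (vs ! i) (vs ! (Suc i mod s))) \<longleftrightarrow> successively adj vs \<and> adj (last vs) (hd vs)"
  proof (intro iffI conjI allI impI)
    assume *: "\<forall>i<s. adj (vs ! i) (vs ! (Suc i mod s))"
    show "successively adj vs"
      unfolding successively_conv_nth
      using True * by (metis Suc_lessD mod_less)
    have "adj (vs ! (s - 1)) (vs ! (Suc (s - 1) mod s))"
      using assms by (intro *[rule_format]) auto
    moreover have "vs ! (s - 1) = last vs" "vs ! (Suc (s - 1) mod s) = hd vs"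
      using True assms by (simp_all add: last_conv_nth hd_conv_nth length_0_conv[symmetric] del: length_0_conv)
    ultimately show "adj (last vs) (hd vs)" by simp
  next
    fix i assume *: "successively adj vs \<and> adj (last vs) (hd vs)" "i < s"
    show "adj (vs ! i) (vs ! (Suc i mod s))"
    proof (cases "Suc i = s")
      case True
      then show ?thesis
        using * \<open>length vs = s\<close> assms
        by (auto simp: last_conv_nth hd_conv_nth length_0_conv[symmetric] simp del: length_0_conv)
    next
      case False
      then show ?thesis using * True unfolding successively_conv_nth by auto
    qed
  qed
  then show ?thesis using True by (auto simp: cycles_def)
qed (auto simp: cycles_def)

lemma rainbow_cycle_iff_nth:
  assumes "length vs = s" "s \<ge> 1"
  shows "rainbow_cycle vs \<longleftrightarrow> inj_on (\<lambda>i. col (vs ! i) (vs ! (Suc i mod s))) {..<s}"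
proof -
  let ?cs = "path_cols col vs @ [col (last vs) (hd vs)]"
  have nth: "?cs ! i = col (vs ! i) (vs ! (Suc i mod s))" if "i < s" for i
  proof (cases "Suc i = s")
    case True
    then show ?thesis using assms
      by (auto simp: nth_append last_conv_nth hd_conv_nth length_0_conv[symmetric] simp del: length_0_conv)
  next
    case False
    then show ?thesis using assms that by (auto simp: nth_append nth_path_cols)
  qed
  have "rainbow_cycle vs \<longleftrightarrow> distinct ?cs"
    by (auto simp: rainbow_cycle_def)
  also have "\<dots> \<longleftrightarrow> inj_on (\<lambda>i. ?cs ! i) {..<s}"
    using assms by (auto simp: distinct_conv_nth inj_on_def)
  also have "\<dots> \<longleftrightarrow> inj_on (\<lambda>i. col (vs ! i) (vs ! (Suc i mod s))) {..<s}"
    by (intro inj_on_cong) (auto simp: nth)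
  finally show ?thesis .
qed

lemma successively_adj_subset: "successively adj vs \<Longrightarrow> length vs \<ge> 2 \<Longrightarrow> set vs \<subseteq> V"
proof (induction vs rule: induct_list012)
  case (3 x y zs)
  then show ?case by (cases zs) (auto dest: adj_V adj_V2)
qed auto

lemma finite_walks [simp]: "finite (walks l)"
  by (rule finite_subset[OF _ finite_lists_length_eq[OF finite_V, of "Suc l"]]) (auto simp: walks_def)

lemma cycles_subset_walks: "s \<ge> 2 \<Longrightarrow> cycles s \<subseteq> walks (s - 1)"
  using successively_adj_subset by (auto simp: cycles_def walks_def)

lemma finite_cycles: "s \<ge> 2 \<Longrightarrow> finite (cycles s)"
  using cycles_subset_walks finite_walks finite_subset by blast

lemma card_walks_0: "card (walks 0) = card V"
proof -
  have "walks 0 = (\<lambda>x. [x]) ` V"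
    by (auto simp: walks_def length_Suc_conv)
  then show ?thesis by (simp add: card_image inj_on_def)
qed

lemma card_walks_Suc: "card (walks (Suc l)) = (\<Sum>vs\<in>walks l. card (nbrs (hd vs)))"
proof -
  have "walks (Suc l) = (\<lambda>(vs, x). x # vs) ` Sigma (walks l) (\<lambda>vs. nbrs (hd vs))"
  proof (intro equalityI subsetI)
    fix vs assume "vs \<in> walks (Suc l)"
    then obtain x ws where "vs = x # ws" "ws \<in> walks l" "adj x (hd ws)"
      by (cases vs) (auto simp: walks_def successively_Cons)
    then show "vs \<in> (\<lambda>(vs, x). x # vs) ` Sigma (walks l) (\<lambda>vs. nbrs (hd vs))"
      using adj_sym by (auto simp: image_iff)
  qed (auto simp: walks_def successively_Cons adj_commute intro: adj_V)
  moreover have "inj_on (\<lambda>(vs, x). x # vs) (Sigma (walks l) (\<lambda>vs. nbrs (hd vs)))"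
    by (auto simp: inj_on_def)
  ultimately show ?thesis
    by (simp add: card_image card_SigmaI)
qed

lemma rev_walks: "rev ` walks l = walks l"
proof -
  have "rev vs \<in> walks l" if "vs \<in> walks l" for vs
    using that adj_commute by (auto simp: walks_def cong: successively_cong)
  then show ?thesis by (force simp: image_iff)
qed

lemma card_walks_Suc_last: "card (walks (Suc l)) = (\<Sum>vs\<in>walks l. card (nbrs (last vs)))"
proof -
  have "card (walks (Suc l)) = (\<Sum>vs\<in>rev ` walks l. card (nbrs (hd vs)))"
    by (simp add: card_walks_Suc rev_walks)
  also have "\<dots> = (\<Sum>vs\<in>walks l. card (nbrs (last vs)))"
    by (subst sum.reindex) (auto simp: inj_on_def hd_rev)
  finally show ?thesis .
qed

lemma card_walks_1: "card (walks 1) = (\<Sum>x\<in>V. card (nbrs x))"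
proof -
  have "walks 0 = (\<lambda>x. [x]) ` V"
    by (auto simp: walks_def length_Suc_conv)
  then show ?thesis
    using card_walks_Suc[of 0] by (simp add: sum.reindex inj_on_def)
qed

lemma card_walks_2: "(\<Sum>x\<in>V. (card (nbrs x))\<^sup>2) \<le> card (walks 2)"
proof -
  let ?S = "Sigma V (\<lambda>x. nbrs x \<times> nbrs x)"
  have "(\<lambda>(x, y, z). [y, x, z]) ` ?S \<subseteq> walks 2"
    by (auto simp: walks_def intro: adj_V2 adj_sym)
  moreover have "inj_on (\<lambda>(x, y, z). [y, x, z]) ?S" by (auto simp: inj_on_def)
  ultimately have "card ?S \<le> card (walks 2)"
    by (intro card_inj_on_le) auto
  then show ?thesis
    using finite_V by (subst (asm) card_SigmaI) (auto simp: card_cartesian_product power2_eq_square)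
qed

text \<open>Together with the O(n^2) walks of two edges this gives O(n^(3/2)) edges, as used for odd
  s and t = 4.\<close>

lemma card_walks_1_squared: "(card (walks 1))\<^sup>2 \<le> card V * card (walks 2)"
proof -
  have "real ((card (walks 1))\<^sup>2) = (\<Sum>x\<in>V. real (card (nbrs x)))\<^sup>2"
    unfolding card_walks_1 by simp
  also have "\<dots> \<le> real (card V) * (\<Sum>x\<in>V. (real (card (nbrs x)))\<^sup>2)"
    by (rule sum_squared_le_card_mult)
  also have "\<dots> = real (card V * (\<Sum>x\<in>V. (card (nbrs x))\<^sup>2))" by simp
  also have "\<dots> \<le> real (card V * card (walks 2))"
    using card_walks_2 by (intro of_nat_mono mult_le_mono2)
  finally show ?thesis by (simp only: of_nat_le_iff)
qed

context
  fixes t :: nat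
  assumes free: "rainbow_cycle_free t" and t: "even t" "t \<ge> 4"
begin

lemma fan_bound_sets:
  assumes "\<And>p q. (p, q) \<in> R \<Longrightarrow> adj u p \<and> adj p q \<and> p \<in> A \<and> q \<in> B" "A \<subseteq> V" "B \<subseteq> V"
  shows "card R \<le> 3 * t * (card A + card B)"
proof -
  have "card R \<le> 3 * t * (card (fst ` R) + card (snd ` R))"
    using assms by (intro fan_bound[OF free t]) auto
  also have "\<dots> \<le> 3 * t * (card A + card B)"
    using assms finite_V by (intro mult_le_mono2 add_mono card_mono) (auto intro: finite_subset)
  finally show ?thesis .
qed

lemma finite_pairs: "(\<And>p q. (p, q) \<in> R \<Longrightarrow> adj p q) \<Longrightarrow> finite R"
  by (rule finite_subset[of _ "V \<times> V"]) (use finite_V in \<open>auto intro: adj_V adj_V2\<close>)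

lemma card_walks_add_2: "card (walks (l + 2)) \<le> 6 * t * card V * card (walks l)"
proof -
  let ?R = "\<lambda>vs. {(p, q). adj (hd vs) p \<and> adj p q}"
  have "card (walks (l + 2)) \<le> (\<Sum>vs\<in>walks l. card (?R vs))"
  proof (rule card_UN_image_le)
    show "walks (l + 2) \<subseteq> (\<Union>vs\<in>walks l. (\<lambda>(p, q). q # p # vs) ` ?R vs)"
    proof
      fix vs assume "vs \<in> walks (l + 2)"
      then obtain q p ws where "vs = q # p # ws" "ws \<in> walks l" "adj q p" "adj p (hd ws)"
        by (cases vs; cases "tl vs") (auto simp: walks_def successively_Cons)
      then show "vs \<in> (\<Union>vs\<in>walks l. (\<lambda>(p, q). q # p # vs) ` ?R vs)"
        using adj_sym by (intro UN_I[of ws] image_eqI[of _ _ "(p, q)"]) auto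
    qed
  qed (auto intro!: finite_pairs)
  also have "\<dots> \<le> (\<Sum>vs\<in>walks l. 3 * t * (card V + card V))"
    by (intro sum_mono fan_bound_sets) (auto intro: adj_V adj_V2)
  finally show ?thesis by (simp add: algebra_simps)
qed

lemma card_walks_add_even: "card (walks (l + 2 * j)) \<le> (6 * t * card V) ^ j * card (walks l)"
proof (induction j)
  case (Suc j)
  have "card (walks (l + 2 * Suc j)) \<le> 6 * t * card V * card (walks (l + 2 * j))"
    using card_walks_add_2[of "l + 2 * j"] by simp
  also have "\<dots> \<le> 6 * t * card V * ((6 * t * card V) ^ j * card (walks l))"
    using Suc by (intro mult_le_mono2)
  finally show ?case by simp
qed auto

lemma card_cycles_le_walks:
  assumes "s \<ge> 4"
  shows "card (cycles s) \<le> 6 * t * card (walks (s - 2))"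
proof -
  have s: "s - 2 = Suc (s - 3)" using assms by simp
  let ?R = "\<lambda>vs. {(p, q). adj (last vs) p \<and> adj p q \<and> adj q (hd vs)}"
  have "card (cycles s) \<le> (\<Sum>vs\<in>walks (s - 3). card (?R vs))"
  proof (rule card_UN_image_le)
    show "cycles s \<subseteq> (\<Union>vs\<in>walks (s - 3). (\<lambda>(p, q). p # q # vs) ` ?R vs)"
    proof
      fix vs assume vs: "vs \<in> cycles s"
      then obtain p q ws where pq: "vs = p # q # ws" "length ws = s - 2"
        using assms by (cases vs; cases "tl vs") (auto simp: cycles_def)
      then have "ws \<noteq> []" using assms by auto
      then have "ws \<in> walks (s - 3)" "(p, q) \<in> ?R ws"
        using vs pq assms successively_adj_subset[of ws]
        by (auto simp: cycles_def walks_def successively_Cons)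
      then show "vs \<in> (\<Union>vs\<in>walks (s - 3). (\<lambda>(p, q). p # q # vs) ` ?R vs)"
        using pq by (intro UN_I[of ws] image_eqI[of _ _ "(p, q)"]) auto
    qed
  qed (auto intro!: finite_pairs)
  \<comment> \<open>The sides of the fan lie in the neighbourhoods of the two ends of
    \<open>vs\<close>. Degrees of ends summed over the walks with s - 3 edges count the walks with s
    - 2 edges.\<close>
  also have "\<dots> \<le> (\<Sum>vs\<in>walks (s - 3). 3 * t * (card (nbrs (last vs)) + card (nbrs (hd vs))))"
    by (intro sum_mono fan_bound_sets) (auto intro: adj_V adj_V2 adj_sym)
  also have "\<dots> = 6 * t * card (walks (s - 2))"
    using card_walks_Suc[of "s - 3"] card_walks_Suc_last[of "s - 3"] s
    by (simp add: sum_distrib_left[symmetric] sum.distrib)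
  finally show ?thesis .
qed

end

end

section \<open>Books\<close>

lemma card_inj_hits:
  assumes "inj_on f M"
  shows "card {m \<in> M. f m \<in> set cs} \<le> length cs"
proof -
  have "inj_on f {m \<in> M. f m \<in> set cs}" by (rule inj_on_subset[OF assms]) auto
  then have "card {m \<in> M. f m \<in> set cs} \<le> card (set cs)"
    by (intro card_inj_on_le) auto
  then show ?thesis using card_length[of cs] by linarith
qed

context coloured_graph
begin

text \<open>By properness v is determined by w and the colour, and w is a neighbour of
  \<open>h\<close>. So prescribing a colour allows a fan to skip a vertex without enlarging its
  second side.\<close>

lemma card_colour_mates: "card {v. \<exists>w. adj v w \<and> col v w = \<gamma> \<and> adj w h} \<le> card (nbrs h)"
proof -
  have "{v. \<exists>w. adj v w \<and> col v w = \<gamma> \<and> adj w h} \<subseteq> (\<lambda>w. SOME v. adj v w \<and> col v w = \<gamma>) ` nbrs h"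
  proof
    fix v assume "v \<in> {v. \<exists>w. adj v w \<and> col v w = \<gamma> \<and> adj w h}"
    then obtain w where w: "adj v w" "col v w = \<gamma>" "adj w h" by auto
    let ?v = "SOME v. adj v w \<and> col v w = \<gamma>"
    have "adj ?v w \<and> col ?v w = \<gamma>"
      by (rule someI[of _ v]) (use w in auto)
    then have "v = ?v"
      using w col_proper[of w v ?v] adj_sym col_sym by metis
    then show "v \<in> (\<lambda>w. SOME v. adj v w \<and> col v w = \<gamma>) ` nbrs h"
      using w adj_sym by (intro image_eqI[of _ _ w]) auto
  qed
  then show ?thesis
    by (meson card_image_le card_mono finite_imageI finite_nbrs le_trans)
qed

text \<open>The converse of the preceding count: w may be left out of an encoding, since
  \<open>SOME\<close> recovers it from v and the colour.\<close>

lemma some_mate_eq: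
  assumes "adj v w" "col v w = \<gamma>" "P w"
  shows "(SOME w. adj v w \<and> col v w = \<gamma> \<and> P w) = w"
  by (rule some_equality) (use assms col_proper in auto)

lemma rotate_cycles:
  assumes "s \<ge> 1" "vs \<in> cycles s"
  shows "rotate r vs \<in> cycles s"
proof -
  have len: "length vs = s" and adj: "\<And>i. i < s \<Longrightarrow> adj (vs ! i) (vs ! (Suc i mod s))"
    and dist: "distinct vs"
    using assms by (auto simp: cycles_iff_nth)
  have "adj (rotate r vs ! i) (rotate r vs ! (Suc i mod s))" if "i < s" for i
  proof -
    have "rotate r vs ! i = vs ! ((r + i) mod s)"
      using that len by (simp add: nth_rotate)
    moreover have "rotate r vs ! (Suc i mod s) = vs ! ((r + Suc i mod s) mod s)"
      using that len assms(1) by (subst nth_rotate) auto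
    moreover have "(r + Suc i mod s) mod s = Suc ((r + i) mod s) mod s"
      by (simp add: mod_Suc_eq mod_add_right_eq)
    ultimately show ?thesis using adj[of "(r + i) mod s"] assms(1) by simp
  qed
  then show ?thesis using assms(1) len dist by (simp add: cycles_iff_nth)
qed

text \<open>Equally coloured edges are never consecutive, so with one of them at position 0 the
  other starts at position 2 or later. If i + 5 <= s, then the last vertex of the cycle lies on
  neither edge.\<close>

definition twin_edge_cycles :: "nat \<Rightarrow> nat \<Rightarrow> 'a list set" where
  "twin_edge_cycles s i = {vs \<in> cycles s. col (vs ! 0) (vs ! 1) = col (vs ! (i + 2)) (vs ! (i + 3))}"

context
  fixes t :: nat
  assumes free: "rainbow_cycle_free t" and t: "even t" "t \<ge> 4"
begin

text \<open>The fan consists of the last and the first vertex of the cycle; the second vertex follows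
  from the first one because the colour of their edge is prescribed by the remaining vertices.\<close>

lemma card_twin_edge_cycles:
  assumes "i + 5 \<le> s"
  shows "card (twin_edge_cycles s i) \<le> 6 * t * card (walks (s - 3))"
proof -
  have s: "s - 3 = Suc (s - 4)" using assms by simp
  define C where "C = (\<lambda>ws :: 'a list. col (ws ! i) (ws ! Suc i))"
  let ?P = "\<lambda>ws v w. adj v w \<and> col v w = C ws \<and> adj w (hd ws)"
  let ?R = "\<lambda>ws. {(z, v). adj (last ws) z \<and> adj z v \<and> (\<exists>w. ?P ws v w)}"
  let ?f = "\<lambda>ws (z, v). v # (SOME w. ?P ws v w) # ws @ [z]"
  have "card (twin_edge_cycles s i) \<le> (\<Sum>ws\<in>walks (s - 4). card (?R ws))"
  proof (rule card_UN_image_le)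
    show "twin_edge_cycles s i \<subseteq> (\<Union>ws\<in>walks (s - 4). ?f ws ` ?R ws)"
    proof
      fix vs assume vs: "vs \<in> twin_edge_cycles s i"
      then obtain v w ws z where eq: "vs = v # w # ws @ [z]" and len: "length ws = s - 3"
        using assms
        by (cases vs; cases "tl vs"; cases "tl (tl vs)" rule: rev_cases)
           (auto simp: twin_edge_cycles_def cycles_def)
      have ne: "ws \<noteq> []" using len assms by auto
      have "successively adj ws" "adj v w" "adj w (hd ws)" "adj (last ws) z" "adj z v"
        using vs ne unfolding eq twin_edge_cycles_def cycles_def
        by (auto simp: successively_Cons successively_append_iff)
      moreover have "col v w = C ws"
        using vs len assms unfolding eq twin_edge_cycles_def C_def by (auto simp: nth_append)
      moreover have "length ws \<ge> 2" using len assms by simp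
      ultimately have "ws \<in> walks (s - 4)" "(z, v) \<in> ?R ws" "?P ws v w"
        using len successively_adj_subset[of ws] assms by (auto simp: walks_def)
      moreover from this have "?f ws (z, v) = vs"
        using some_mate_eq[of v w "C ws" "\<lambda>w. adj w (hd ws)"] eq by auto
      ultimately show "vs \<in> (\<Union>ws\<in>walks (s - 4). ?f ws ` ?R ws)"
        by (metis (no_types, lifting) UN_iff image_iff)
    qed
  qed (auto intro!: finite_pairs[OF free t])
  also have "\<dots> \<le> (\<Sum>ws\<in>walks (s - 4). 3 * t * (card (nbrs (last ws)) + card (nbrs (hd ws))))"
  proof (rule sum_mono)
    fix ws
    have "card (?R ws) \<le> 3 * t * (card (nbrs (last ws)) + card {v. \<exists>w. ?P ws v w})"
      by (intro fan_bound_sets[OF free t]) (auto intro: adj_V adj_V2)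
    also have "\<dots> \<le> 3 * t * (card (nbrs (last ws)) + card (nbrs (hd ws)))"
      by (intro mult_le_mono2 add_mono order_refl card_colour_mates)
    finally show "card (?R ws) \<le> 3 * t * (card (nbrs (last ws)) + card (nbrs (hd ws)))" .
  qed
  also have "\<dots> = 6 * t * card (walks (s - 3))"
    using card_walks_Suc[of "s - 4"] card_walks_Suc_last[of "s - 4"] s
    by (simp add: sum_distrib_left[symmetric] sum.distrib)
  finally show ?thesis .
qed

text \<open>No cycle of length t is rainbow, so a rotation of it has twin edges; there are at most t
  rotations and at most t values of i to sum over.\<close>

lemma card_same_cycles:
  assumes "t \<ge> 6"
  shows "card (cycles t) \<le> t * t * (6 * t * card (walks (t - 3)))"
proof -
  have "cycles t \<subseteq> (\<Union>(r, i)\<in>{..<t} \<times> {..<t - 4}. rotate r ` twin_edge_cycles t i)"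
  proof
    fix vs assume vs: "vs \<in> cycles t"
    define e where "e = (\<lambda>i. col (vs ! i) (vs ! (Suc i mod t)))"
    have len: "length vs = t" and dist: "distinct vs"
      and adj: "\<And>i. i < t \<Longrightarrow> adj (vs ! i) (vs ! (Suc i mod t))"
      using vs assms by (auto simp: cycles_iff_nth)
    have "\<not> inj_on e {..<t}"
      using free vs rainbow_cycle_iff_nth[OF len] assms unfolding e_def rainbow_cycle_free_def by auto
    then obtain a b where ab: "a < b" "b < t" "e a = e b"
      unfolding inj_on_def by (metis lessThan_iff linorder_neqE_nat)
    have nadj: "e i \<noteq> e (Suc i mod t)" if "i < t" for i
    proof
      assume *: "e i = e (Suc i mod t)"
      let ?j = "Suc i mod t" let ?k = "Suc ?j mod t"
      have lt: "?j < t" "?k < t" using assms by auto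
      have "adj (vs ! ?j) (vs ! i)" using adj[OF that] by (rule adj_sym)
      then have "vs ! i = vs ! ?k"
        using col_proper[of "vs ! ?j" "vs ! i" "vs ! ?k"] adj[OF lt(1)] * by (simp add: e_def col_sym)
      then have "i = ?k" using dist lt that len by (simp add: nth_eq_iff_index_eq)
      moreover have "?k = (if i + 2 < t then i + 2 else i + 2 - t)"
        using that assms by (auto simp: mod_Suc)
      ultimately show False using assms by (auto split: if_splits)
    qed
    \<comment> \<open>The bound d <= t - 3 becomes i + 5 <= t for d = i + 2, as
      \<open>card_twin_edge_cycles\<close> requires.\<close>
    have shift: "\<exists>i < t - 4. rotate c vs \<in> twin_edge_cycles t i"
      if "c < t" "e c = e ((c + d) mod t)" "2 \<le> d" "d \<le> t - 3" for c d
    proof -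
      have "rotate c vs \<in> cycles t" using vs assms by (intro rotate_cycles) auto
      moreover have "col (rotate c vs ! 0) (rotate c vs ! 1) = e c"
        using that assms len by (simp add: nth_rotate e_def)
      moreover have "col (rotate c vs ! d) (rotate c vs ! Suc d) = e ((c + d) mod t)"
        using that assms len by (simp add: nth_rotate e_def mod_Suc_eq)
      moreover obtain i where "d = i + 2" using \<open>2 \<le> d\<close> by (metis add.commute le_Suc_ex)
      ultimately show ?thesis
        using that assms by (intro exI[of _ i]) (auto simp: twin_edge_cycles_def numeral_3_eq_3)
    qed
    have "\<exists>c<t. \<exists>i < t - 4. rotate c vs \<in> twin_edge_cycles t i"
    proof (cases "b - a \<le> t - 3")
      case True
      have "b \<noteq> Suc a" using nadj[of a] ab by auto
      then have "2 \<le> b - a" using ab by linarith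
      then show ?thesis using shift[of a "b - a"] ab True by (intro exI[of _ a]) auto
    next
      case False
      \<comment> \<open>The distance t - 1 would make the two edges consecutive, so b - a = t - 2.
        Read cyclically from b, the distance to a is 2.\<close>
      have "\<not> (a = 0 \<and> b = t - 1)" using nadj[of "t - 1"] ab by auto
      then have "(b + 2) mod t = a" using False ab assms
        by (subst mod_if) auto
      then show ?thesis using shift[of b 2] ab assms by auto
    qed
    then obtain c i where c: "c < t" "i < t - 4" "rotate c vs \<in> twin_edge_cycles t i" by blast
    have "rotate ((t - c) mod t) (rotate c vs) = vs"
      using c(1) len by (cases "c = 0") (auto simp: rotate_rotate)
    moreover have "(t - c) mod t < t" using assms by simp
    ultimately show "vs \<in> (\<Union>(r, i)\<in>{..<t} \<times> {..<t - 4}. rotate r ` twin_edge_cycles t i)"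
      using c by (intro UN_I[of "((t - c) mod t, i)"]) (auto intro!: image_eqI[of vs _ "rotate c vs"])
  qed
  then have "card (cycles t) \<le> (\<Sum>(r, i)\<in>{..<t} \<times> {..<t - 4}. card (twin_edge_cycles t i))"
  proof (intro order.trans[OF card_UN_image_le[where C = "\<lambda>(r, i). twin_edge_cycles t i" and f = "\<lambda>(r, i). rotate r"]])
    show "finite (case b of (r, i) \<Rightarrow> twin_edge_cycles t i)" for b
      using finite_cycles[of t] assms
      by (auto simp: twin_edge_cycles_def split: prod.splits intro: finite_subset)
  qed (auto simp: case_prod_unfold)
  also have "\<dots> \<le> (\<Sum>(r, i)\<in>{..<t} \<times> {..<t - 4}. 6 * t * card (walks (t - 3)))"
    by (intro sum_mono) (auto intro!: card_twin_edge_cycles)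
  also have "\<dots> = t * (t - 4) * (6 * t * card (walks (t - 3)))" by simp
  also have "\<dots> \<le> t * t * (6 * t * card (walks (t - 3)))"
    by (intro mult_le_mono) auto
  finally show ?thesis .
qed

end

text \<open>The last two conditions are what closing a rainbow cycle along a, x, y, b requires
  beyond properness and a generic choice; they discard at most \<open>2 * card walks2\<close> walks
  in total.\<close>

definition book :: "'a \<Rightarrow> ('a \<times> 'a \<times> 'a) set" where
  "book a = {(x, y, b). adj a x \<and> adj x y \<and> adj y b \<and> a \<noteq> y \<and> col a x \<noteq> col y b}"

text \<open>The three injectivity conditions ensure that l forbidden vertices or colours spoil at
  most l pairs in each respect.\<close>

definition rainbow_matching :: "('a \<times> 'a) set \<Rightarrow> bool" where
  "rainbow_matching M \<longleftrightarrow> finite M \<and> inj_on fst M \<and> inj_on snd M \<and> inj_on (\<lambda>(x, y). col x y) M"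

lemma finite_book: "finite (book a)"
  by (rule finite_subset[of _ "V \<times> V \<times> V"]) (use finite_V in \<open>auto simp: book_def intro: adj_V adj_V2\<close>)

text \<open>The cycle found here is \<open>a, x1, y1, b1, y2, b2, \<dots>, ym, xm\<close>, where all the \<open>yi\<close> have a common
  neighbour with \<open>a\<close>.\<close>

lemma rainbow_cycle_in_book:
  assumes t: "even t" "t \<ge> 6" and F: "F \<subseteq> book a" "F \<noteq> {}"
    and ends: "\<And>x y b. (x, y, b) \<in> F \<Longrightarrow> card {b'. (x, y, b') \<in> F} > 3 * t"
    and pages: "\<And>x y b. (x, y, b) \<in> F \<Longrightarrow>
      \<exists>M \<subseteq> {(x', y'). (x', y', b) \<in> F}. rainbow_matching M \<and> card M > 5 * t"
  shows "\<not> rainbow_cycle_free t"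
proof -
  have Fb: "adj a x" "adj x y" "adj y b" "a \<noteq> y" "col a x \<noteq> col y b" if "(x, y, b) \<in> F" for x y b
    using that F(1) by (auto simp: book_def)
  have le: "3 * l < c" if "3 * t < c" "l \<le> t" for l c :: nat
    using that by linarith
  \<comment> \<open>From the head \<open>ws\<close> reads b, y, ..., b1, y1, x1, a. On the way only
    the y of a matching edge is used; its x matters in the last step alone.\<close>
  have ex: "\<exists>ws x y. rainbow_path ws \<and> length ws = 2 * m + 4 \<and> last ws = a \<and> (x, y, hd ws) \<in> F"
    if "2 * m + 4 < t" for m
    using that
  proof (induction m)
    case 0
    obtain x y b0 where 0: "(x, y, b0) \<in> F" using F(2) by auto
    have "col a x \<noteq> col x y"
      using col_proper[of x a y] Fb[OF 0] adj_sym col_sym[of a x] by auto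
    then have p: "rainbow_path [y, x, a]"
      using Fb[OF 0] adj_sym adj_irrefl col_sym by (auto simp: rainbow_path_def)
    have "{b'. (x, y, b') \<in> F} \<subseteq> nbrs (hd [y, x, a])" using Fb by auto
    moreover have "card {b'. (x, y, b') \<in> F} > 3 * length [y, x, a]"
      using ends[OF 0] t(2) by simp
    ultimately obtain b where "(x, y, b) \<in> F" "rainbow_path (b # [y, x, a])"
      using extend_rainbow_path[OF p] by blast
    then show ?case by (intro exI[of _ "b # [y, x, a]"] exI[of _ x] exI[of _ y]) auto
  next
    case (Suc m)
    then obtain ws x0 y0 where ws: "rainbow_path ws" "length ws = 2 * m + 4" "last ws = a"
      and F0: "(x0, y0, hd ws) \<in> F"
      by auto
    have ne: "ws \<noteq> []" using ws by auto
    obtain M where M: "M \<subseteq> {(x', y'). (x', y', hd ws) \<in> F}" "rainbow_matching M" "card M > 5 * t"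
      using pages[OF F0] by blast
    have "adj (hd ws) y" if "(x, y) \<in> M" for x y
      using that M(1) Fb(3)[of x y "hd ws"] adj_sym by blast
    then have "snd ` M \<subseteq> nbrs (hd ws)" by auto
    moreover have "card (snd ` M) > 3 * length ws"
      using M Suc.prems ws(2) by (auto simp: rainbow_matching_def card_image)
    ultimately obtain y where "y \<in> snd ` M" and p: "rainbow_path (y # ws)"
      using extend_rainbow_path[OF ws(1) ne] by blast
    then obtain x where xy: "(x, y, hd ws) \<in> F" using M(1) by auto
    have "{b'. (x, y, b') \<in> F} \<subseteq> nbrs (hd (y # ws))" using Fb by auto
    moreover have "card {b'. (x, y, b') \<in> F} > 3 * length (y # ws)"
      using ends[OF xy] by (rule le) (use ws Suc.prems in auto)
    ultimately obtain b where "(x, y, b) \<in> F" "rainbow_path (b # y # ws)"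
      using extend_rainbow_path[OF p] by blast
    then show ?case
      using ws ne by (intro exI[of _ "b # y # ws"] exI[of _ x] exI[of _ y]) auto
  qed
  obtain k where k: "t = 2 * k" using t(1) by (elim evenE)
  then have "2 * (k - 3) + 4 < t" "2 * (k - 3) + 4 + 2 = t" using t(2) by auto
  with ex[of "k - 3"] obtain ws x0 y0 where ws: "rainbow_path ws" "length ws + 2 = t" "last ws = a"
    and F0: "(x0, y0, hd ws) \<in> F"
    by fastforce
  have ne: "ws \<noteq> []" using ws t by auto
  obtain M where M: "M \<subseteq> {(x', y'). (x', y', hd ws) \<in> F}" "rainbow_matching M" "card M > 5 * t"
    using pages[OF F0] by blast
  have inj: "inj_on fst M" "inj_on snd M" "inj_on (\<lambda>(x, y). col x y) M" and fin: "finite M"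
    using M(2) by (auto simp: rainbow_matching_def)
  have Madj: "adj a (fst m)" "adj (hd ws) (snd m)" if "m \<in> M" for m
    using that M(1) Fb(1,3)[of "fst m" "snd m" "hd ws"] adj_sym by auto
  have inj': "inj_on (\<lambda>m. col (hd ws) (snd m)) M" "inj_on (\<lambda>m. col a (fst m)) M"
  proof -
    show "inj_on (\<lambda>m. col (hd ws) (snd m)) M"
    proof (rule inj_onI)
      fix m m' assume m: "m \<in> M" "m' \<in> M" "col (hd ws) (snd m) = col (hd ws) (snd m')"
      then have "snd m = snd m'" using Madj(2) col_proper by blast
      then show "m = m'" using m inj(2) by (auto simp: inj_on_def)
    qed
    show "inj_on (\<lambda>m. col a (fst m)) M"
    proof (rule inj_onI)
      fix m m' assume m: "m \<in> M" "m' \<in> M" "col a (fst m) = col a (fst m')"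
      then have "fst m = fst m'" using Madj(1) col_proper by blast
      then show "m = m'" using m inj(1) by (auto simp: inj_on_def)
    qed
  qed
  let ?cs = "path_cols col ws"
  \<comment> \<open>Five possible clashes: x or y lies on the path, or one of the three new colours
    does. Each spoils at most \<open>length ws\<close> < t pairs, whence 5 t. The new colours differ
    from each other by properness and by the definition of \<open>book\<close>.\<close>
  let ?B = "{m \<in> M. fst m \<in> set ws} \<union> {m \<in> M. snd m \<in> set ws}
      \<union> {m \<in> M. (\<lambda>(x, y). col x y) m \<in> set ?cs} \<union> {m \<in> M. col (hd ws) (snd m) \<in> set ?cs}
      \<union> {m \<in> M. col a (fst m) \<in> set ?cs}"
  have "card ?B \<le> length ws + length ws + length ?cs + length ?cs + length ?cs"
    by (intro order.trans[OF card_Un_le] add_mono card_inj_hits inj inj')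
  also have "\<dots> < card M" using M(3) ws(2) by simp
  finally have "\<not> M \<subseteq> ?B" using fin card_mono[of ?B M] by auto
  then obtain m where "m \<in> M" "m \<notin> ?B" by blast
  then obtain x y where m: "(x, y) \<in> M" "x \<notin> set ws" "y \<notin> set ws"
    "col x y \<notin> set ?cs" "col (hd ws) y \<notin> set ?cs" "col a x \<notin> set ?cs"
    by (cases m) auto
  have xy: "(x, y, hd ws) \<in> F" using m(1) M(1) by auto
  note f = Fb[OF xy]
  have inws: "hd ws \<in> set ws" "a \<in> set ws" using ne ws(3) last_in_set by auto
  have p1: "rainbow_path (y # ws)"
    using rainbow_path_Cons[OF ne] ws(1) m f col_sym[of y "hd ws"] by auto
  have "col x y \<noteq> col y (hd ws)"
    using col_proper[of y x "hd ws"] f adj_sym col_sym[of x y] m inws by auto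
  then have p2: "rainbow_path (x # y # ws)"
    using rainbow_path_Cons[of "y # ws" x] p1 m f ne adj_irrefl by (auto simp: path_cols_Cons)
  have "col a x \<noteq> col x y"
    using col_proper[of x a y] f adj_sym col_sym[of a x] by auto
  then show ?thesis
    using p2 ws t m f ne
    by (intro rainbow_cycle_closing[of "x # y # ws"]) (auto simp: path_cols_Cons)
qed

text \<open>By \<open>rainbow_cycle_in_book\<close> a nonempty \<open>F\<close> has a poor spot. If
  it is a pair (x, y) with at most 3 t ends, its triples are dropped, which happens at most once per
  pair. If it is an end b without a large rainbow matching, all triples ending in b move to
  \<open>D\<close>, where no others with that end arrive later.\<close>

lemma book_reduction:
  assumes free: "rainbow_cycle_free t" and t: "even t" "t \<ge> 6" and F: "F \<subseteq> book a"
  shows "\<exists>D \<subseteq> F. card F \<le> card D + 3 * t * card ((\<lambda>(x, y, b). (x, y)) ` F) \<and>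
    (\<forall>b. \<forall>M \<subseteq> {(x, y). (x, y, b) \<in> D}. rainbow_matching M \<longrightarrow> card M \<le> 5 * t)"
  using F
proof (induction "card F" arbitrary: F rule: less_induct)
  case less
  let ?\<pi> = "\<lambda>(x, y, b). (x, y)"
  have fin: "finite F" using less.prems finite_book finite_subset by blast
  consider "F = {}"
    | x y b where "(x, y, b) \<in> F" "card {b'. (x, y, b') \<in> F} \<le> 3 * t"
    | x y b where "(x, y, b) \<in> F"
        "\<forall>M \<subseteq> {(x', y'). (x', y', b) \<in> F}. rainbow_matching M \<longrightarrow> card M \<le> 5 * t"
    using rainbow_cycle_in_book[OF t less.prems] free by (metis not_le_imp_less)
  then show ?case
  proof cases
    case 1
    then show ?thesis by (intro exI[of _ "{}"]) auto
  next
    case (2 x y b)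
    let ?F = "{z \<in> F. ?\<pi> z \<noteq> (x, y)}"
    have split: "card F = card {z \<in> F. ?\<pi> z = (x, y)} + card ?F"
      using card_filter_split[OF fin] .
    have "{z \<in> F. ?\<pi> z = (x, y)} = (\<lambda>b'. (x, y, b')) ` {b'. (x, y, b') \<in> F}" by auto
    then have "card {z \<in> F. ?\<pi> z = (x, y)} = card {b'. (x, y, b') \<in> F}"
      by (simp add: card_image inj_on_def)
    then have le: "card F \<le> 3 * t + card ?F" using split 2(2) by linarith
    have "(x, y, b) \<notin> ?F" by simp
    then have "?F \<subset> F" using 2(1) by blast
    then have "card ?F < card F" using fin by (rule psubset_card_mono[rotated])
    then obtain D where D: "D \<subseteq> ?F" "card ?F \<le> card D + 3 * t * card (?\<pi> ` ?F)"
      "\<forall>b. \<forall>M \<subseteq> {(x, y). (x, y, b) \<in> D}. rainbow_matching M \<longrightarrow> card M \<le> 5 * t"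
      using less.hyps[of ?F] less.prems by blast
    have "f ` {z \<in> F. f z \<noteq> c} \<subseteq> f ` F - {c}" for f :: "'a \<times> 'a \<times> 'a \<Rightarrow> 'a \<times> 'a" and c
      by auto
    from this[of ?\<pi> "(x, y)"] have "card (?\<pi> ` ?F) \<le> card (?\<pi> ` F - {(x, y)})"
      using fin by (intro card_mono) auto
    moreover have "card (?\<pi> ` F) = Suc (card (?\<pi> ` F - {(x, y)}))"
      using fin 2(1) by (intro card.remove) (auto intro: image_eqI[of _ _ "(x, y, b)"])
    ultimately have "Suc (card (?\<pi> ` ?F)) \<le> card (?\<pi> ` F)" by linarith
    then have "3 * t * Suc (card (?\<pi> ` ?F)) \<le> 3 * t * card (?\<pi> ` F)" by (rule mult_le_mono2)
    then have "card F \<le> card D + 3 * t * card (?\<pi> ` F)" using le D(2) by simp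
    then show ?thesis using D by (intro exI[of _ D]) auto
  next
    case (3 x y b)
    let ?B = "{z \<in> F. snd (snd z) = b}" and ?F = "{z \<in> F. snd (snd z) \<noteq> b}"
    have split: "card F = card ?B + card ?F"
      using card_filter_split[OF fin] .
    have "(x, y, b) \<notin> ?F" by simp
    then have "?F \<subset> F" using 3(1) by blast
    then have "card ?F < card F" using fin by (rule psubset_card_mono[rotated])
    then obtain D where D: "D \<subseteq> ?F" "card ?F \<le> card D + 3 * t * card (?\<pi> ` ?F)"
      "\<forall>b. \<forall>M \<subseteq> {(x, y). (x, y, b) \<in> D}. rainbow_matching M \<longrightarrow> card M \<le> 5 * t"
      using less.hyps[of ?F] less.prems by blast
    have "card (D \<union> ?B) = card D + card ?B"
      using D(1) fin by (intro card_Un_disjoint) (auto intro: finite_subset)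
    moreover have "card (?\<pi> ` ?F) \<le> card (?\<pi> ` F)"
      using fin by (intro card_mono image_mono) auto
    then have "3 * t * card (?\<pi> ` ?F) \<le> 3 * t * card (?\<pi> ` F)" by (rule mult_le_mono2)
    ultimately have "card F \<le> card (D \<union> ?B) + 3 * t * card (?\<pi> ` F)"
      using split D(2) by linarith
    moreover have "{(x, y). (x, y, b') \<in> D \<union> ?B} =
        (if b' = b then {(x', y'). (x', y', b) \<in> F} else {(x, y). (x, y, b') \<in> D})" for b'
      using D(1) by auto
    ultimately show ?thesis using D 3(2) by (intro exI[of _ "D \<union> ?B"]) auto
  qed
qed

text \<open>A rainbow matching of maximum size meets every pair of E in x, in y or in the colour.
  \<open>h\<close> enumerates it; values of \<open>h\<close> beyond its size do no harm.\<close>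

lemma cover_without_rainbow_matching:
  assumes "finite E" "\<forall>M\<subseteq>E. rainbow_matching M \<longrightarrow> card M \<le> m"
  shows "\<exists>h. \<forall>(x, y)\<in>E. \<exists>i\<le>m. x = fst (h i) \<or> y = snd (h i) \<or> col x y = col (fst (h i)) (snd (h i))"
proof -
  have "\<exists>M. (M \<subseteq> E \<and> rainbow_matching M) \<and> (\<forall>N. N \<subseteq> E \<and> rainbow_matching N \<longrightarrow> card N \<le> card M)"
    using assms by (intro ex_has_greatest_nat[of _ "{}" _ "Suc m"])
      (auto simp: rainbow_matching_def less_Suc_eq_le)
  then obtain M where M: "M \<subseteq> E" "rainbow_matching M"
    and max: "\<And>N. N \<subseteq> E \<Longrightarrow> rainbow_matching N \<Longrightarrow> card N \<le> card M"
    by blast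
  have fin: "finite M" using M(2) by (simp add: rainbow_matching_def)
  then obtain h where h: "bij_betw h {0..<card M} M" using ex_bij_betw_nat_finite by blast
  have "\<exists>i\<le>m. x = fst (h i) \<or> y = snd (h i) \<or> col x y = col (fst (h i)) (snd (h i))"
    if xy: "(x, y) \<in> E" for x y
  proof -
    have "\<exists>z\<in>M. x = fst z \<or> y = snd z \<or> col x y = col (fst z) (snd z)"
    proof (rule ccontr)
      assume *: "\<not> ?thesis"
      then have "(x, y) \<notin> M" by force
      moreover have "rainbow_matching (insert (x, y) M)"
        using M(2) * unfolding rainbow_matching_def by (auto simp: case_prod_unfold)
      ultimately show False using max[of "insert (x, y) M"] xy M(1) fin by auto
    qed
    then obtain z where z: "z \<in> M" "x = fst z \<or> y = snd z \<or> col x y = col (fst z) (snd z)" by blast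
    then obtain i where "i < card M" "z = h i"
      using h unfolding bij_betw_def by (metis atLeastLessThan_iff imageE)
    moreover have "card M \<le> m" using assms(2) M by blast
    ultimately show ?thesis using z(2) by (intro exI[of _ i]) auto
  qed
  then show ?thesis by blast
qed

end

section \<open>Walks with three edges\<close>

context coloured_graph
begin

definition edge_pairs :: "('a \<times> 'a) set" where
  "edge_pairs = {(a, x). adj a x}"

definition walks2 :: "('a \<times> 'a \<times> 'a) set" where
  "walks2 = {(x, y, b). adj x y \<and> adj y b}"

definition walks3 :: "('a \<times> 'a \<times> 'a \<times> 'a) set" where
  "walks3 = {(a, x, y, b). adj a x \<and> adj x y \<and> adj y b}"

lemma finite_edge_pairs [simp]: "finite edge_pairs"
  by (rule finite_subset[of _ "V \<times> V"])
    (use finite_V in \<open>auto simp: edge_pairs_def intro: adj_V adj_V2\<close>)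

lemma finite_walks2 [simp]: "finite walks2"
  by (rule finite_subset[of _ "V \<times> V \<times> V"])
    (use finite_V in \<open>auto simp: walks2_def intro: adj_V adj_V2\<close>)

lemma finite_walks3 [simp]: "finite walks3"
  by (rule finite_subset[of _ "V \<times> V \<times> V \<times> V"])
    (use finite_V in \<open>auto simp: walks3_def intro: adj_V adj_V2\<close>)

lemma card_walks_3_le: "card (walks 3) \<le> card walks3"
proof -
  have "walks 3 \<subseteq> (\<lambda>(a, x, y, b). [a, x, y, b]) ` walks3"
  proof
    fix vs assume vs: "vs \<in> walks 3"
    then have "length vs = Suc (Suc (Suc (Suc 0)))" by (simp add: walks_def)
    then obtain a x y b where "vs = [a, x, y, b]" by (auto simp: length_Suc_conv)
    then show "vs \<in> (\<lambda>(a, x, y, b). [a, x, y, b]) ` walks3"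
      using vs by (intro image_eqI[of _ _ "(a, x, y, b)"]) (auto simp: walks_def walks3_def)
  qed
  then show ?thesis
    by (meson card_image_le card_mono finite_imageI finite_walks3 le_trans)
qed

lemma sum_walks2_first: "(\<Sum>(x, y, b)\<in>walks2. card (nbrs x)) = card walks3"
proof -
  have "(\<Sum>z\<in>walks2. card (nbrs (fst z))) = card (Sigma walks2 (\<lambda>z. nbrs (fst z)))"
    by (simp add: card_SigmaI)
  also have "\<dots> = card walks3"
    by (rule bij_betw_same_card[of "\<lambda>((x, y, b), a). (a, x, y, b)"],
        rule bij_betwI[of _ _ _ "\<lambda>(a, x, y, b). ((x, y, b), a)"])
      (auto simp: walks2_def walks3_def intro: adj_sym)
  finally show ?thesis by (simp add: case_prod_unfold)
qed

lemma sum_walks2_last: "(\<Sum>(x, y, b)\<in>walks2. card (nbrs b)) = card walks3"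
proof -
  have "(\<Sum>z\<in>walks2. card (nbrs (snd (snd z)))) = card (Sigma walks2 (\<lambda>z. nbrs (snd (snd z))))"
    by (simp add: card_SigmaI)
  also have "\<dots> = card walks3"
    by (rule bij_betw_same_card[of "\<lambda>((x, y, b), a). (x, y, b, a)"],
        rule bij_betwI[of _ _ _ "\<lambda>(x, y, b, a). ((x, y, b), a)"])
      (auto simp: walks2_def walks3_def)
  finally show ?thesis by (simp add: case_prod_unfold)
qed

lemma sum_edge_pairs: "(\<Sum>(a, x)\<in>edge_pairs. card (nbrs x)) = card walks2"
proof -
  have "(\<Sum>z\<in>edge_pairs. card (nbrs (snd z))) = card (Sigma edge_pairs (\<lambda>z. nbrs (snd z)))"
    by (simp add: card_SigmaI)
  also have "\<dots> = card walks2"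
    by (rule bij_betw_same_card[of "\<lambda>((x, y), b). (x, y, b)"],
        rule bij_betwI[of _ _ _ "\<lambda>(x, y, b). ((x, y), b)"])
      (auto simp: walks2_def edge_pairs_def)
  finally show ?thesis by (simp add: case_prod_unfold)
qed

lemma sum_vertices_walks2: "(\<Sum>a\<in>V. card {(x, y). adj a x \<and> adj x y}) = card walks2"
proof -
  have fin: "finite {(x, y). adj a x \<and> adj x y}" for a
    by (rule finite_subset[OF _ finite_edge_pairs]) (auto simp: edge_pairs_def)
  then have "(\<Sum>a\<in>V. card {(x, y). adj a x \<and> adj x y}) = card (Sigma V (\<lambda>a. {(x, y). adj a x \<and> adj x y}))"
    using finite_V by (simp add: card_SigmaI)
  also have "Sigma V (\<lambda>a. {(x, y). adj a x \<and> adj x y}) = walks2"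
    by (auto simp: walks2_def intro: adj_V)
  finally show ?thesis .
qed

context
  fixes t :: nat
  assumes free: "rainbow_cycle_free t" and t: "even t" "t \<ge> 4"
begin

lemma card_walks2_le: "card walks2 \<le> 6 * t * (card V)\<^sup>2"
proof -
  have "card walks2 = (\<Sum>a\<in>V. card {(x, y). adj a x \<and> adj x y})"
    by (simp add: sum_vertices_walks2)
  also have "\<dots> \<le> (\<Sum>a\<in>V. 3 * t * (card V + card V))"
    by (intro sum_mono fan_bound_sets[OF free t]) (auto intro: adj_V adj_V2)
  finally show ?thesis by (simp add: power2_eq_square algebra_simps)
qed

text \<open>For a fixed edge a x the pairs (y, b) form a fan at x whose second side consists of the
  b with \<open>\<xi> a b = x\<close>. For fixed a these sides are disjoint, so they sum to at most
  n^2 overall, while the first sides sum to \<open>card walks2\<close>.\<close>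

lemma card_walks3_second_vertex:
  "card {(a, x, y, b) \<in> walks3. x = \<xi> a b} \<le> 3 * t * (card walks2 + (card V)\<^sup>2)"
proof -
  let ?R = "\<lambda>a x. {(y, b). adj x y \<and> adj y b \<and> \<xi> a b = x}"
  let ?B = "\<lambda>a x. {b \<in> V. \<xi> a b = x}"
  have "card {(a, x, y, b) \<in> walks3. x = \<xi> a b} \<le> (\<Sum>z\<in>edge_pairs. card (?R (fst z) (snd z)))"
  proof (rule card_UN_image_le)
    show "{(a, x, y, b) \<in> walks3. x = \<xi> a b} \<subseteq>
        (\<Union>z\<in>edge_pairs. (\<lambda>(y, b). (fst z, snd z, y, b)) ` ?R (fst z) (snd z))"
      by (force simp: walks3_def edge_pairs_def)
  qed (auto intro!: finite_pairs[OF free t])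
  also have "\<dots> \<le> (\<Sum>z\<in>edge_pairs. 3 * t * (card (nbrs (snd z)) + card (?B (fst z) (snd z))))"
    by (intro sum_mono fan_bound_sets[OF free t]) (auto intro: adj_V adj_V2)
  also have "\<dots> = 3 * t * (card walks2 + (\<Sum>z\<in>edge_pairs. card (?B (fst z) (snd z))))"
    using sum_edge_pairs by (simp add: sum_distrib_left[symmetric] sum.distrib case_prod_unfold)
  also have "(\<Sum>z\<in>edge_pairs. card (?B (fst z) (snd z))) \<le> (card V)\<^sup>2"
  proof -
    let ?S = "Sigma edge_pairs (\<lambda>z. ?B (fst z) (snd z))"
    have "(\<Sum>z\<in>edge_pairs. card (?B (fst z) (snd z))) = card ?S"
      using finite_V by (simp add: card_SigmaI)
    also have "\<dots> \<le> card (V \<times> V)"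
    proof (rule card_inj_on_le)
      show "inj_on (\<lambda>((a, x), b). (a, b)) ?S" by (auto simp: inj_on_def)
      show "(\<lambda>((a, x), b). (a, b)) ` ?S \<subseteq> V \<times> V" by (auto simp: edge_pairs_def intro: adj_V)
    qed (use finite_V in auto)
    finally show ?thesis by (simp add: card_cartesian_product power2_eq_square)
  qed
  finally show ?thesis by simp
qed

lemma card_walks3_third_vertex:
  "card {(a, x, y, b) \<in> walks3. y = \<eta> a b} \<le> 3 * t * (card walks2 + (card V)\<^sup>2)"
proof -
  have "card {(a, x, y, b) \<in> walks3. y = \<eta> a b} \<le> card {(a, x, y, b) \<in> walks3. x = \<eta> b a}"
  proof (rule card_inj_on_le)
    show "inj_on (\<lambda>(a, x, y, b). (b, y, x, a)) {(a, x, y, b) \<in> walks3. y = \<eta> a b}"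
      by (auto simp: inj_on_def)
    show "finite {(a, x, y, b) \<in> walks3. x = \<eta> b a}"
      by (rule finite_subset[OF _ finite_walks3]) auto
  qed (auto simp: walks3_def intro: adj_sym)
  also have "\<dots> \<le> 3 * t * (card walks2 + (card V)\<^sup>2)"
    by (rule card_walks3_second_vertex)
  finally show ?thesis .
qed

text \<open>Cauchy--Schwarz over the pairs \<open>(a, b)\<close> reduces this to counting pairs of walks
  \<open>a x y b\<close>, \<open>a x' y' b\<close> whose middle edges have the same colour; for given \<open>x'\<close>, \<open>y'\<close>, \<open>b\<close>
  the pairs \<open>(a, x)\<close> form a fan at \<open>x'\<close>, and \<open>y\<close> follows from \<open>x\<close>.\<close>

lemma card_walks3_middle_colour:
  "(card {(a, x, y, b) \<in> walks3. col x y = \<gamma> a b})\<^sup>2 \<le> (card V)\<^sup>2 * (6 * t * card walks3)"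
proof -
  let ?C = "{(a, x, y, b) \<in> walks3. col x y = \<gamma> a b}"
  define E where "E = (\<lambda>(a, b). {(x, y). adj a x \<and> adj x y \<and> adj y b \<and> col x y = \<gamma> a b})"
  have finE: "finite (E z)" for z
    by (rule finite_subset[OF _ finite_edge_pairs]) (auto simp: E_def edge_pairs_def split: prod.splits)
  have fin: "finite (V \<times> V)" using finite_V by simp
  have C: "card ?C = (\<Sum>z\<in>V \<times> V. card (E z))"
  proof -
    have "card ?C = card (Sigma (V \<times> V) E)"
      by (rule bij_betw_same_card[of "\<lambda>(a, x, y, b). ((a, b), (x, y))"],
          rule bij_betwI[of _ _ _ "\<lambda>((a, b), (x, y)). (a, x, y, b)"])
        (auto simp: E_def walks3_def intro: adj_V adj_V2)
    then show ?thesis using fin finE by (simp add: card_SigmaI)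
  qed
  let ?S = "Sigma (V \<times> V) (\<lambda>z. E z \<times> E z)"
  let ?P = "\<lambda>x' y' b x y. adj x y \<and> col x y = col x' y' \<and> adj y b"
  let ?R = "\<lambda>(x', y', b). {(a, x). adj x' a \<and> adj a x \<and> (\<exists>y. ?P x' y' b x y)}"
  have "(\<Sum>z\<in>V \<times> V. (card (E z))\<^sup>2) = card ?S"
    using fin finE by (simp add: card_SigmaI card_cartesian_product power2_eq_square)
  also have "\<dots> \<le> (\<Sum>w\<in>walks2. card (?R w))"
  proof (rule card_UN_image_le)
    let ?f = "\<lambda>(x', y', b) (a, x). ((a, b), (x, SOME y. ?P x' y' b x y), (x', y'))"
    show "?S \<subseteq> (\<Union>w\<in>walks2. ?f w ` ?R w)"
    proof
      fix z assume "z \<in> ?S"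
      then obtain a b x y x' y' where z: "z = ((a, b), (x, y), (x', y'))"
        and xy: "(x, y) \<in> E (a, b)" "(x', y') \<in> E (a, b)" by auto
      have P: "?P x' y' b x y" using xy by (auto simp: E_def)
      have "(x', y', b) \<in> walks2" using xy by (auto simp: E_def walks2_def)
      moreover have "(a, x) \<in> ?R (x', y', b)" using xy by (auto simp: E_def intro: adj_sym)
      moreover have "z = ?f (x', y', b) (a, x)"
        using some_mate_eq[of x y "col x' y'" "\<lambda>y. adj y b"] P z by auto
      ultimately show "z \<in> (\<Union>w\<in>walks2. ?f w ` ?R w)" by blast
    qed
  qed (auto intro!: finite_pairs[OF free t])
  also have "\<dots> \<le> (\<Sum>(x', y', b)\<in>walks2. 3 * t * (card (nbrs x') + card (nbrs b)))"
  proof (rule sum_mono)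
    fix w assume "w \<in> walks2"
    obtain x' y' b where w: "w = (x', y', b)" by (cases w) auto
    have "card (?R w) \<le> 3 * t * (card (nbrs x') + card {x. \<exists>y. ?P x' y' b x y})"
      unfolding w prod.case by (intro fan_bound_sets[OF free t]) (auto intro: adj_V adj_V2)
    also have "\<dots> \<le> 3 * t * (card (nbrs x') + card (nbrs b))"
      by (intro mult_le_mono2 add_mono order_refl card_colour_mates)
    finally show "card (?R w) \<le> (case w of (x', y', b) \<Rightarrow> 3 * t * (card (nbrs x') + card (nbrs b)))"
      by (simp add: w)
  qed
  also have "\<dots> = 6 * t * card walks3"
    using sum_walks2_first sum_walks2_last
    by (simp add: sum_distrib_left[symmetric] sum.distrib case_prod_unfold)
  finally have *: "(\<Sum>z\<in>V \<times> V. (card (E z))\<^sup>2) \<le> 6 * t * card walks3" .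
  have "real ((card ?C)\<^sup>2) = (\<Sum>z\<in>V \<times> V. real (card (E z)))\<^sup>2"
    unfolding C by simp
  also have "\<dots> \<le> real (card (V \<times> V)) * (\<Sum>z\<in>V \<times> V. (real (card (E z)))\<^sup>2)"
    by (rule sum_squared_le_card_mult)
  also have "\<dots> = real ((card V)\<^sup>2 * (\<Sum>z\<in>V \<times> V. (card (E z))\<^sup>2))"
    by (simp add: card_cartesian_product power2_eq_square)
  also have "\<dots> \<le> real ((card V)\<^sup>2 * (6 * t * card walks3))"
    using * by (intro of_nat_mono mult_le_mono2)
  finally show ?thesis by (simp only: of_nat_le_iff)
qed

end

text \<open>Outside the books, the walks \<open>a x y b\<close> with \<open>y = a\<close> or \<open>col a x = col y b\<close> remain.\<close>

lemma card_walks3_book_le: "card walks3 \<le> 2 * card walks2 + (\<Sum>a\<in>V. card (book a))"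
proof -
  let ?A = "{(a, x, y, b) \<in> walks3. a = y}"
  let ?B = "{(a, x, y, b) \<in> walks3. col a x = col y b}"
  let ?C = "Sigma V book"
  have "card walks3 \<le> card (?A \<union> ?B \<union> ?C)"
    using finite_V finite_book
    by (intro card_mono) (auto simp: walks3_def book_def intro: adj_V
        intro!: finite_subset[OF _ finite_walks3])
  also have "\<dots> \<le> card ?A + card ?B + card ?C"
    by (intro order.trans[OF card_Un_le] add_mono order_refl)
  also have "card ?A \<le> card walks2"
    using finite_walks2[unfolded walks2_def]
    by (intro card_inj_on_le[where f = "\<lambda>(a, x, y, b). (x, y, b)"])
      (auto simp: inj_on_def walks2_def walks3_def)
  \<comment> \<open>b is determined by a, x, y, since y b has the colour of a x.\<close>
  also have "card ?B \<le> card walks2"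
    using finite_walks2[unfolded walks2_def]
    by (intro card_inj_on_le[where f = "\<lambda>(a, x, y, b). (a, x, y)"])
      (use col_proper in \<open>auto simp: inj_on_def walks2_def walks3_def\<close>)
  also have "card ?C \<le> (\<Sum>a\<in>V. card (book a))"
    using finite_V finite_book by (simp add: card_SigmaI)
  finally show ?thesis by simp
qed

text \<open>The square of A + B, where w3 <= A n^2 + B n sqrt w3 is the inequality obtained for the
  number w3 of walks; the last summand is B, the other two form A.\<close>

definition three_walk_const :: "nat \<Rightarrow> nat" where
  "three_walk_const t =
     ((2 + 3 * t) * (6 * t) + (5 * t + 1) * (6 * t * (6 * t + 1)) + (5 * t + 1) * (6 * t))\<^sup>2"

text \<open>Each book consists of a part paid for by its pairs (x, y), which are
  \<open>card walks2\<close> in total, and of a part \<open>D a\<close> covered by 5 t + 1 choices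
  of a common x, y or colour for each b. The count for a common colour contains sqrt w3, so the
  bound is self-referential and must be solved for w3.\<close>

lemma card_walks3_bound:
  assumes free: "rainbow_cycle_free t" and t: "even t" "t \<ge> 6"
  shows "card walks3 \<le> three_walk_const t * (card V)\<^sup>2"
proof -
  have t4: "t \<ge> 4" using t by simp
  have "\<exists>D \<subseteq> book a. card (book a) \<le> card D + 3 * t * card ((\<lambda>(x, y, b). (x, y)) ` book a) \<and>
    (\<forall>b. \<forall>M \<subseteq> {(x, y). (x, y, b) \<in> D}. rainbow_matching M \<longrightarrow> card M \<le> 5 * t)" for a
    by (rule book_reduction[OF free t]) auto
  then obtain D where D: "\<And>a. D a \<subseteq> book a"
    and cardD: "\<And>a. card (book a) \<le> card (D a) + 3 * t * card ((\<lambda>(x, y, b). (x, y)) ` book a)"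
    and noM: "\<And>a b. \<forall>M \<subseteq> {(x, y). (x, y, b) \<in> D a}. rainbow_matching M \<longrightarrow> card M \<le> 5 * t"
    by metis
  have finD: "finite (D a)" for a using D finite_book finite_subset by blast
  have "finite {(x, y). (x, y, b) \<in> D a}" for a b
    by (rule finite_subset[OF _ finite_edge_pairs]) (use D[of a] in \<open>auto simp: book_def edge_pairs_def\<close>)
  note cover = cover_without_rainbow_matching[OF this noM]
  define Q where "Q = (\<lambda>a b h. \<forall>(x, y)\<in>{(x, y). (x, y, b) \<in> D a}. \<exists>i\<le>5 * t.
       x = fst (h i) \<or> y = snd (h i) \<or> col x y = col (fst (h i)) (snd (h i)))"
  define h where "h = (\<lambda>a b. SOME h. Q a b h)"
  have Q: "Q a b (h a b)" for a b
    unfolding h_def by (rule someI_ex[of "Q a b"]) (unfold Q_def, rule cover)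
  have h: "\<exists>i\<le>5 * t. x = fst (h a b i) \<or> y = snd (h a b i) \<or> col x y = col (fst (h a b i)) (snd (h a b i))"
    if "(x, y, b) \<in> D a" for a b x y
    using Q[of a b] that unfolding Q_def by blast
  define n where "n = real (card V)"
  define w2 where "w2 = real (card walks2)"
  define w3 where "w3 = real (card walks3)"
  define T where "T = real t"
  have T: "T \<ge> 6" using t by (simp add: T_def)
  have pos: "n \<ge> 0" "w2 \<ge> 0" "w3 \<ge> 0" by (simp_all add: n_def w2_def w3_def)
  define SX where "SX = (\<lambda>i. {(a, x, y, b) \<in> walks3. x = fst (h a b i)})"
  define SY where "SY = (\<lambda>i. {(a, x, y, b) \<in> walks3. y = snd (h a b i)})"
  define SC where "SC = (\<lambda>i. {(a, x, y, b) \<in> walks3. col x y = col (fst (h a b i)) (snd (h a b i))})"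
  have SX: "real (card (SX i)) \<le> 3 * T * (w2 + n\<^sup>2)" for i
    using of_nat_mono[OF card_walks3_second_vertex[OF free t(1) t4, of "\<lambda>a b. fst (h a b i)"], where 'a = real]
    by (simp add: SX_def T_def w2_def n_def)
  have SY: "real (card (SY i)) \<le> 3 * T * (w2 + n\<^sup>2)" for i
    using of_nat_mono[OF card_walks3_third_vertex[OF free t(1) t4, of "\<lambda>a b. snd (h a b i)"], where 'a = real]
    by (simp add: SY_def T_def w2_def n_def)
  have SC: "real (card (SC i)) \<le> n * (6 * T) * sqrt w3" for i
  proof (rule power2_le_imp_le)
    have "(real (card (SC i)))\<^sup>2 \<le> n\<^sup>2 * (6 * T * w3)"
      using of_nat_mono[OF card_walks3_middle_colour[OF free t(1) t4, of "\<lambda>a b. col (fst (h a b i)) (snd (h a b i))"], where 'a = real]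
      by (simp add: SC_def T_def w3_def n_def)
    \<comment> \<open>Squaring 6 T loses a constant, but keeps roots of T out of the final
      constant.\<close>
    also have "\<dots> \<le> n\<^sup>2 * ((6 * T)\<^sup>2 * w3)"
      using T pos by (intro mult_left_mono mult_right_mono) (auto simp: power2_eq_square)
    finally show "(real (card (SC i)))\<^sup>2 \<le> (n * (6 * T) * sqrt w3)\<^sup>2"
      using pos by (simp add: power_mult_distrib algebra_simps)
  qed (use pos T in auto)
  have finX: "finite (SX i)" "finite (SY i)" "finite (SC i)" for i
    unfolding SX_def SY_def SC_def by (rule finite_subset[OF _ finite_walks3], auto)+
  have "Sigma V D \<subseteq> (\<Union>i\<in>{..5 * t}. SX i \<union> SY i \<union> SC i)"
  proof
    fix z assume z: "z \<in> Sigma V D"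
    then obtain a x y b where z': "z = (a, x, y, b)" "(x, y, b) \<in> D a" by (cases z) auto
    then have "(a, x, y, b) \<in> walks3" using D by (auto simp: book_def walks3_def)
    then show "z \<in> (\<Union>i\<in>{..5 * t}. SX i \<union> SY i \<union> SC i)"
      using h[OF z'(2)] z'(1) by (auto simp: SX_def SY_def SC_def)
  qed
  then have "card (Sigma V D) \<le> card (\<Union>i\<in>{..5 * t}. SX i \<union> SY i \<union> SC i)"
    using finX by (intro card_mono) auto
  also have "\<dots> \<le> (\<Sum>i\<le>5 * t. card (SX i \<union> SY i \<union> SC i))"
    by (rule card_UN_le) auto
  also have "\<dots> \<le> (\<Sum>i\<le>5 * t. card (SX i) + card (SY i) + card (SC i))"
    by (intro sum_mono order.trans[OF card_Un_le] add_mono order_refl)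
  finally have "real (card (Sigma V D)) \<le> (\<Sum>i\<le>5 * t. real (card (SX i)) + real (card (SY i)) + real (card (SC i)))"
    by (metis (mono_tags, lifting) of_nat_add of_nat_mono of_nat_sum sum.cong)
  also have "\<dots> \<le> (\<Sum>i\<le>5 * t. 3 * T * (w2 + n\<^sup>2) + 3 * T * (w2 + n\<^sup>2) + n * (6 * T) * sqrt w3)"
    by (intro sum_mono add_mono SX SY SC)
  also have "\<dots> = (5 * T + 1) * (6 * T * (w2 + n\<^sup>2) + n * (6 * T) * sqrt w3)"
    by (simp add: T_def algebra_simps)
  finally have SD: "real (card (Sigma V D)) \<le> (5 * T + 1) * (6 * T * (w2 + n\<^sup>2) + n * (6 * T) * sqrt w3)" .
  have "(\<Sum>a\<in>V. card (book a)) \<le> (\<Sum>a\<in>V. card (D a) + 3 * t * card {(x, y). adj a x \<and> adj x y})"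
  proof (rule sum_mono)
    fix a
    have "finite {(x, y). adj a x \<and> adj x y}"
      by (rule finite_subset[OF _ finite_edge_pairs]) (auto simp: edge_pairs_def)
    then have "card ((\<lambda>(x, y, b). (x, y)) ` book a) \<le> card {(x, y). adj a x \<and> adj x y}"
      by (rule card_mono) (auto simp: book_def)
    then show "card (book a) \<le> card (D a) + 3 * t * card {(x, y). adj a x \<and> adj x y}"
      using cardD[of a] mult_le_mono2[of _ _ "3 * t"] by (meson add_left_mono le_trans)
  qed
  also have "\<dots> = card (Sigma V D) + 3 * t * card walks2"
    using finite_V finD by (simp add: sum.distrib sum_distrib_left[symmetric] card_SigmaI sum_vertices_walks2)
  finally have "card walks3 \<le> 2 * card walks2 + (card (Sigma V D) + 3 * t * card walks2)"
    using card_walks3_book_le by linarith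
  then have "w3 \<le> (2 + 3 * T) * w2 + real (card (Sigma V D))"
    unfolding w3_def w2_def T_def of_nat_le_iff[where 'a = real, symmetric] by (simp add: algebra_simps)
  also have "\<dots> \<le> (2 + 3 * T) * w2 + (5 * T + 1) * (6 * T * (w2 + n\<^sup>2) + n * (6 * T) * sqrt w3)"
    using SD by simp
  also have "\<dots> \<le> (2 + 3 * T) * (6 * T * n\<^sup>2) + (5 * T + 1) * (6 * T * (6 * T * n\<^sup>2 + n\<^sup>2) + n * (6 * T) * sqrt w3)"
  proof -
    have "w2 \<le> 6 * T * n\<^sup>2"
      using of_nat_mono[OF card_walks2_le[OF free t(1) t4], where 'a = real]
      by (simp add: w2_def T_def n_def)
    then show ?thesis using T by (intro add_mono mult_left_mono order_refl) auto
  qed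
  finally have main: "w3 \<le> ((2 + 3 * T) * (6 * T) + (5 * T + 1) * (6 * T * (6 * T + 1))) * n\<^sup>2
      + (5 * T + 1) * (6 * T) * n * sqrt w3"
    by (simp add: algebra_simps)
  define A where "A = (2 + 3 * T) * (6 * T) + (5 * T + 1) * (6 * T * (6 * T + 1))"
  define B where "B = (5 * T + 1) * (6 * T)"
  have AB: "A \<ge> 1" "B \<ge> 0" 
  proof -
    have "(5 * T + 1) * (6 * T * (6 * T + 1)) \<ge> 0" using T by simp
    moreover have "(2 + 3 * T) * (6 * T) \<ge> 1 * 1" using T by (intro mult_mono) auto
    ultimately show "A \<ge> 1" unfolding A_def by linarith
    show "B \<ge> 0" using T by (simp add: B_def)
  qed
  have sq: "(sqrt w3)\<^sup>2 \<le> A * n\<^sup>2 + B * n * sqrt w3"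
    using main pos by (simp add: A_def B_def)
  \<comment> \<open>Otherwise n <= sqrt w3, because A >= 1; then A n^2 <= A n sqrt w3, and dividing
    by sqrt w3 yields the claim after all.\<close>
  have "sqrt w3 \<le> (A + B) * n"
  proof (rule ccontr)
    assume "\<not> ?thesis"
    then have gt: "sqrt w3 > (A + B) * n" by simp
    have "1 * n \<le> (A + B) * n" using AB pos by (intro mult_right_mono) auto
    then have ge: "n \<le> sqrt w3" using gt by simp
    have "A * n\<^sup>2 \<le> A * (n * sqrt w3)"
      using AB pos ge by (intro mult_left_mono) (auto simp: power2_eq_square mult_left_mono)
    then have "(sqrt w3)\<^sup>2 \<le> ((A + B) * n) * sqrt w3" using sq by (simp add: algebra_simps)
    moreover have "sqrt w3 > 0" using gt AB pos by (smt (verit) mult_nonneg_nonneg)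
    then have "((A + B) * n) * sqrt w3 < sqrt w3 * sqrt w3" using gt by (rule mult_strict_right_mono[rotated])
    ultimately show False by (simp add: power2_eq_square)
  qed
  then have "(sqrt w3)\<^sup>2 \<le> ((A + B) * n)\<^sup>2" using pos by (intro power_mono) auto
  then have "w3 \<le> (A + B)\<^sup>2 * n\<^sup>2" using pos by (simp add: power_mult_distrib)
  also have "(A + B)\<^sup>2 * n\<^sup>2 = real (three_walk_const t * (card V)\<^sup>2)"
    unfolding three_walk_const_def A_def B_def T_def n_def
    by (simp only: of_nat_mult of_nat_add of_nat_power of_nat_numeral of_nat_1)
  finally show ?thesis unfolding w3_def by (simp only: of_nat_le_iff)
qed

end

section \<open>Odd cycles\<close>

definition flexible :: "nat \<Rightarrow> 'a list set \<Rightarrow> nat \<Rightarrow> bool" where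
  "flexible K F i \<longleftrightarrow> (\<forall>vs\<in>F. card {x. vs[i := x] \<in> F} > K)"

text \<open>Being light passes to subfamilies, being flexible does not. Hence light positions are
  accumulated and flexible ones are found only at the end.\<close>

definition light :: "nat \<Rightarrow> 'a list set \<Rightarrow> nat \<Rightarrow> bool" where
  "light K F i \<longleftrightarrow> (\<forall>vs\<in>F. card {x. vs[i := x] \<in> F} \<le> K)"

lemma finite_updates:
  assumes "finite F" "i < length vs"
  shows "finite {x. vs[i := x] \<in> F}"
proof (rule inj_on_finite[where f = "\<lambda>x. vs[i := x]"])
  show "inj_on (\<lambda>x. vs[i := x]) {x. vs[i := x] \<in> F}"
    using assms(2) by (intro inj_onI) (metis nth_list_update_eq)
qed (use assms in auto)

lemma light_subset:
  assumes "light K F i" "E \<subseteq> F" "finite F" "\<And>vs. vs \<in> F \<Longrightarrow> i < length vs"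
  shows "light K E i"
  unfolding light_def
proof
  fix vs assume "vs \<in> E"
  then have "card {x. vs[i := x] \<in> E} \<le> card {x. vs[i := x] \<in> F}"
    using assms by (intro card_mono finite_updates) auto
  then show "card {x. vs[i := x] \<in> E} \<le> K"
    using assms(1,2) \<open>vs \<in> E\<close> unfolding light_def by (meson le_trans subsetD)
qed

text \<open>If \<open>vs\<close> shows that position i is not flexible, the at most K members of F
  that agree with \<open>vs\<close> outside i are moved to \<open>D i\<close>. No later member
  agrees with them outside i, so \<open>D i\<close> stays light.\<close>

lemma split_flexible_light:
  assumes "finite F" "\<And>vs. vs \<in> F \<Longrightarrow> length vs = s" "I \<subseteq> {..<s}"
  shows "\<exists>F' D. (\<forall>i\<in>I. flexible K F' i) \<and> (\<forall>i\<in>I. D i \<subseteq> F \<and> light K (D i) i) \<and> F = F' \<union> (\<Union>i\<in>I. D i)"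
  using assms
proof (induction "card F" arbitrary: F rule: less_induct)
  case less
  show ?case
  proof (cases "\<forall>i\<in>I. flexible K F i")
    case True
    then show ?thesis by (intro exI[of _ F] exI[of _ "\<lambda>_. {}"]) (auto simp: light_def)
  next
    case False
    then obtain i vs where i: "i \<in> I" and vs: "vs \<in> F" and le: "card {x. vs[i := x] \<in> F} \<le> K"
      unfolding flexible_def by (meson not_le_imp_less)
    define S where "S = F \<inter> range (\<lambda>x. vs[i := x])"
    have "vs = vs[i := vs ! i]" by simp
    then have "vs \<in> S" using vs unfolding S_def by blast
    then have "F - S \<subset> F" using vs by blast
    then have "card (F - S) < card F" using less.prems(1) by (rule psubset_card_mono[rotated])
    then obtain F' D where flex: "\<forall>i\<in>I. flexible K F' i"
      and D: "\<forall>i\<in>I. D i \<subseteq> F - S \<and> light K (D i) i" and un: "F - S = F' \<union> (\<Union>i\<in>I. D i)"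
      using less.hyps[of "F - S"] less.prems by auto
    have len: "i < length vs" using i vs less.prems by auto
    have S_iff: "ws[i := x] \<in> S \<longleftrightarrow> vs[i := x] \<in> F" if "ws \<in> S" for ws x
      using that by (auto simp: S_def)
    have notin: "ws[i := x] \<notin> S" if "ws \<in> F - S" for ws x
    proof
      assume "ws[i := x] \<in> S"
      then obtain y where "ws[i := x] = vs[i := y]" by (auto simp: S_def)
      then have "(ws[i := x])[i := ws ! i] = vs[i := ws ! i]" by simp
      then have "ws = vs[i := ws ! i]" by simp
      then show False using that unfolding S_def by blast
    qed
    have "light K (D i \<union> S) i"
      unfolding light_def
    proof
      fix ws assume "ws \<in> D i \<union> S"
      then consider "ws \<in> D i" | "ws \<in> S" by blast
      then show "card {x. ws[i := x] \<in> D i \<union> S} \<le> K"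
      proof cases
        case 1
        then have "{x. ws[i := x] \<in> D i \<union> S} = {x. ws[i := x] \<in> D i}"
          using notin D i by blast
        then show ?thesis using 1 D i by (auto simp: light_def)
      next
        case 2
        then obtain y where "ws = vs[i := y]" by (auto simp: S_def)
        then have "{x. ws[i := x] \<in> D i \<union> S} \<subseteq> {x. vs[i := x] \<in> F}"
          using D i by (auto simp: S_def)
        then have "card {x. ws[i := x] \<in> D i \<union> S} \<le> card {x. vs[i := x] \<in> F}"
          using finite_updates[OF less.prems(1) len] by (intro card_mono)
        then show ?thesis using le by linarith
      qed
    qed
    moreover have "S \<subseteq> F" by (auto simp: S_def)
    moreover have "F = F' \<union> (\<Union>j\<in>I. (D(i := D i \<union> S)) j)"
    proof -
      have "F = (F - S) \<union> S" using \<open>S \<subseteq> F\<close> by blast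
      also have "\<dots> = F' \<union> (\<Union>j\<in>I. D j) \<union> S" by (simp only: un)
      also have "\<dots> = F' \<union> (\<Union>j\<in>I. (D(i := D i \<union> S)) j)" using i by (auto split: if_splits)
      finally show ?thesis .
    qed
    ultimately show ?thesis
      using flex D by (intro exI[of _ F'] exI[of _ "D(i := D i \<union> S)"]) auto
  qed
qed

text \<open>Either the flexible part of the splitting is nonempty, or some \<open>E i\<close>
  contains a fraction 1 / s of D and i becomes one more light position. Lightness refers to the
  large family \<open>D'\<close>, flexibility to some nonempty part \<open>F'\<close> of it.\<close>

lemma ex_flexible_core:
  assumes "finite D" "\<And>vs. vs \<in> D \<Longrightarrow> length vs = s" "D \<noteq> {}" "L \<subseteq> {..<s}"
    "\<forall>i\<in>L. light K D i" "s \<ge> 1"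
  shows "\<exists>L' D' F'. L' \<subseteq> {..<s} \<and> D' \<subseteq> D \<and> F' \<subseteq> D' \<and> F' \<noteq> {} \<and> (\<forall>i\<in>L'. light K D' i) \<and>
    (\<forall>i\<in>{..<s} - L'. flexible K F' i) \<and> card D \<le> s ^ card ({..<s} - L) * card D'"
  using assms
proof (induction "card ({..<s} - L)" arbitrary: L D)
  case (0 L D)
  then have "{..<s} - L = {}" by auto
  then show ?case using 0 by (intro exI[of _ L] exI[of _ D]) auto
next
  case (Suc m L D)
  let ?I = "{..<s} - L"
  obtain F' E where flex: "\<forall>i\<in>?I. flexible K F' i"
    and E: "\<forall>i\<in>?I. E i \<subseteq> D \<and> light K (E i) i" and un: "D = F' \<union> (\<Union>i\<in>?I. E i)"
    using split_flexible_light[of D s ?I K] Suc.prems by auto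
  show ?case
  proof (cases "F' = {}")
    case False
    have "1 \<le> s ^ card ?I" using Suc.prems by simp
    then have "1 * card D \<le> s ^ card ?I * card D" by (rule mult_le_mono1)
    then show ?thesis using False flex un Suc.prems by (intro exI[of _ L] exI[of _ D] exI[of _ F']) auto
  next
    case True
    have "\<exists>i\<in>?I. card D \<le> s * card (E i)"
    proof (rule ccontr)
      assume "\<not> ?thesis"
      then have lt: "\<And>i. i \<in> ?I \<Longrightarrow> s * card (E i) < card D" by (meson not_le)
      have ne: "?I \<noteq> {}" using un True Suc.prems(3) by auto
      have "s * card D \<le> s * (\<Sum>i\<in>?I. card (E i))"
        using un True card_UN_le[of ?I E] by (intro mult_le_mono2) auto
      also have "\<dots> = (\<Sum>i\<in>?I. s * card (E i))" by (simp add: sum_distrib_left)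
      also have "\<dots> < (\<Sum>i\<in>?I. card D)"
        using lt ne by (intro sum_strict_mono) auto
      also have "\<dots> \<le> s * card D"
        using card_mono[of "{..<s}" ?I] by (auto intro!: mult_le_mono1)
      finally show False by simp
    qed
    then obtain i where i: "i \<in> ?I" "card D \<le> s * card (E i)" by blast
    have sub: "E i \<subseteq> D" using E i by auto
    have "card D > 0" using Suc.prems by (simp add: card_gt_0_iff)
    then have "card (E i) > 0" using i(2) by (cases "card (E i)") auto
    then have ne: "E i \<noteq> {}" by auto
    have eq: "{..<s} - insert i L = ?I - {i}" by auto
    have m: "m = card ({..<s} - insert i L)"
      using Suc.hyps(2) i(1) unfolding eq by (subst card_Diff_singleton) auto
    have "\<forall>j\<in>insert i L. light K (E i) j"
      using E i Suc.prems sub by (auto intro!: light_subset[OF _ sub])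
    then obtain L' D' F'' where *: "L' \<subseteq> {..<s}" "D' \<subseteq> E i" "F'' \<subseteq> D'" "F'' \<noteq> {}"
      "\<forall>i\<in>L'. light K D' i" "\<forall>i\<in>{..<s} - L'. flexible K F'' i"
      "card (E i) \<le> s ^ card ({..<s} - insert i L) * card D'"
      using Suc.hyps(1)[OF m, of "E i"] Suc.prems i sub ne finite_subset[OF sub] by (auto simp: subset_iff)
    have "card D \<le> s * (s ^ m * card D')"
      using i(2) *(7) m by (meson le_trans mult_le_mono2)
    then have "card D \<le> s ^ card ?I * card D'"
      using Suc.hyps(2)[symmetric] by (simp add: mult.assoc)
    then show ?thesis using * sub by (intro exI[of _ L'] exI[of _ D'] exI[of _ F'']) auto
  qed
qed

text \<open>The bound s >= 4 is needed since three pairwise adjacent positions exist on a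
  triangle.\<close>

lemma adjacent_positions:
  assumes "L \<subseteq> {..<s}" "s \<ge> 4"
    and nonadj: "\<And>i j. i \<in> L \<Longrightarrow> j \<in> L \<Longrightarrow> i < j \<Longrightarrow> j = Suc i \<or> i = 0 \<and> j = s - 1"
  shows "\<exists>p<s. L \<subseteq> {p, Suc p mod s}"
proof (cases "L = {}")
  case True
  then show ?thesis using assms by (intro exI[of _ 0]) auto
next
  case False
  define i where "i = (LEAST i. i \<in> L)"
  have i: "i \<in> L" and min: "\<And>j. j \<in> L \<Longrightarrow> i \<le> j"
    using False unfolding i_def by (auto intro: LeastI Least_le)
  show ?thesis
  proof (cases "i = 0 \<and> s - 1 \<in> L")
    case True
    have "j \<in> {s - 1, 0}" if "j \<in> L" for j
    proof (rule ccontr)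
      assume "j \<notin> {s - 1, 0}"
      then have "j = 1" using nonadj[of 0 j] i True that by auto
      moreover have "1 < s - 1" "s - 1 \<noteq> Suc 1" using assms(2) by linarith+
      ultimately show False using nonadj[of 1 "s - 1"] True that by auto
    qed
    then show ?thesis using assms(2) by (intro exI[of _ "s - 1"]) auto
  next
    case False
    have "j \<in> {i, Suc i mod s}" if "j \<in> L" for j
    proof (cases "j = i")
      case F: False
      then have "j = Suc i" using nonadj[of i j] i min[OF that] that False by force
      then show ?thesis using that assms(1) by auto
    qed auto
    then show ?thesis using i assms(1) by (intro exI[of _ i]) auto
  qed
qed

context coloured_graph
begin

text \<open>Repeated vertices are allowed so that two non-adjacent vertices can be exchanged
  independently without leaving the set.\<close>

definition closed_walks :: "nat \<Rightarrow> 'a list set" where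
  "closed_walks s = {vs. length vs = s \<and> (\<forall>i<s. adj (vs ! i) (vs ! (Suc i mod s)))}"

lemma closed_walks_in_V: "vs \<in> closed_walks s \<Longrightarrow> i < s \<Longrightarrow> vs ! i \<in> V"
  using adj_V by (auto simp: closed_walks_def)

lemma finite_closed_walks: "finite (closed_walks s)"
proof (rule finite_subset[OF _ finite_lists_length_eq[OF finite_V, of s]])
  show "closed_walks s \<subseteq> {vs. set vs \<subseteq> V \<and> length vs = s}"
    by (force simp: in_set_conv_nth closed_walks_def intro: adj_V)
qed

text \<open>If two non-adjacent positions are light in \<open>D\<close>, then fixing the other \<open>s - 2\<close> vertices of a
  walk in \<open>D\<close> leaves few completions in \<open>D\<close> compared with those in the graph, where the two
  vertices can be chosen independently of each other.\<close>

lemma card_light_light: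
  assumes D: "D \<subseteq> closed_walks s" and ij: "i < j" "j < s" "j \<noteq> Suc i" "\<not> (i = 0 \<and> j = s - 1)"
    and light: "light K D i" "light K D j"
  shows "(card D)\<^sup>2 \<le> K\<^sup>2 * card V ^ (s - 2) * card (closed_walks s)"
proof -
  let ?CW = "closed_walks s"
  define J where "J = {..<s} - {i, j}"
  \<comment> \<open>\<open>\<kappa>\<close> forgets the entries i and j. Its fibres in D and in the
    set of all closed walks are the sets \<open>f w\<close> and \<open>g w\<close> compared
    below.\<close>
  define \<kappa> where "\<kappa> = (\<lambda>vs :: 'a list. restrict ((!) vs) J)"
  have finD: "finite D" using D finite_closed_walks finite_subset by blast
  have \<kappa>_eq: "vs ! k = ws ! k" if "\<kappa> vs = \<kappa> ws" "k < s" "k \<noteq> i" "k \<noteq> j" for vs ws k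
    using that unfolding \<kappa>_def J_def by (metis Diff_iff empty_iff insert_iff lessThan_iff restrict_apply')
  have \<kappa>_update: "\<kappa> (vs[i := x]) = \<kappa> vs" "\<kappa> (vs[j := x]) = \<kappa> vs" for vs x
    by (auto simp: \<kappa>_def J_def fun_eq_iff restrict_def)
  have len: "length vs = s" if "vs \<in> ?CW" for vs using that by (simp add: closed_walks_def)
  have eqI: "vs = ws" if "\<kappa> vs = \<kappa> ws" "vs \<in> ?CW" "length ws = s" "vs ! i = ws ! i" "vs ! j = ws ! j" for vs ws
  proof (rule nth_equalityI)
    show "length vs = length ws" using that len by simp
    show "vs ! k = ws ! k" if k: "k < length vs" for k
      using \<kappa>_eq[OF \<open>\<kappa> vs = \<kappa> ws\<close>, of k] k len[OF \<open>vs \<in> ?CW\<close>] \<open>vs ! i = ws ! i\<close> \<open>vs ! j = ws ! j\<close>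
      by (cases "k = i \<or> k = j") auto
  qed
  define f where "f = (\<lambda>w. {vs \<in> D. \<kappa> vs = w})"
  define g where "g = (\<lambda>w. {vs \<in> ?CW. \<kappa> vs = w})"
  have fin: "finite (f w)" "finite (g w)" for w
    using finD finite_closed_walks by (auto simp: f_def g_def)
  \<comment> \<open>With the entry a fixed only b can vary within a fibre, and b is light.\<close>
  have slice: "card (f w) \<le> K * card ((\<lambda>vs. vs ! a) ` f w)"
    if ab: "(a, b) = (i, j) \<or> (a, b) = (j, i)" for a b w
  proof -
    have lb: "light K D b" using ab light by auto
    have "f w = (\<Union>x\<in>(\<lambda>vs. vs ! a) ` f w. {vs \<in> f w. vs ! a = x})" by auto
    then have "card (f w) \<le> (\<Sum>x\<in>(\<lambda>vs. vs ! a) ` f w. card {vs \<in> f w. vs ! a = x})"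
      using card_UN_le[of "(\<lambda>vs. vs ! a) ` f w" "\<lambda>x. {vs \<in> f w. vs ! a = x}"] fin by simp
    also have "\<dots> \<le> (\<Sum>x\<in>(\<lambda>vs. vs ! a) ` f w. K)"
    proof (rule sum_mono)
      fix x assume "x \<in> (\<lambda>vs. vs ! a) ` f w"
      then obtain vs where vs: "vs \<in> D" "\<kappa> vs = w" "vs ! a = x" by (auto simp: f_def)
      have b: "b < length vs" using vs D len ab ij by auto
      have sub: "{us \<in> f w. us ! a = x} \<subseteq> (\<lambda>y. vs[b := y]) ` {y. vs[b := y] \<in> D}"
      proof
        fix us assume us: "us \<in> {us \<in> f w. us ! a = x}"
        have "us = vs[b := us ! b]"
        proof (rule eqI)
          show "\<kappa> us = \<kappa> (vs[b := us ! b])"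
            using us vs ab \<kappa>_update by (auto simp: f_def)
          show "us \<in> ?CW" "length (vs[b := us ! b]) = s" using us vs D len by (auto simp: f_def)
          show "us ! i = vs[b := us ! b] ! i" "us ! j = vs[b := us ! b] ! j"
            using us vs ab b ij by (auto simp: nth_list_update)
        qed
        moreover from this have "vs[b := us ! b] \<in> D" using us by (auto simp: f_def)
        ultimately show "us \<in> (\<lambda>y. vs[b := y]) ` {y. vs[b := y] \<in> D}" by blast
      qed
      have "card {us \<in> f w. us ! a = x} \<le> card {y. vs[b := y] \<in> D}"
        using finite_updates[OF finD b] by (intro order.trans[OF card_mono[OF _ sub]] card_image_le) auto
      also have "\<dots> \<le> K" using lb vs by (auto simp: light_def)
      finally show "card {us \<in> f w. us ! a = x} \<le> K" .
    qed
    also have "\<dots> = K * card ((\<lambda>vs. vs ! a) ` f w)" by simp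
    finally show ?thesis .
  qed
  have sq: "(card (f w))\<^sup>2 \<le> K\<^sup>2 * card (g w)" for w
  proof (cases "f w = {}")
    case False
    then obtain vs where vs: "vs \<in> f w" by blast
    let ?X = "(\<lambda>vs. vs ! i) ` f w" and ?Y = "(\<lambda>vs. vs ! j) ` f w"
    have lv: "length vs = s" using vs D len by (auto simp: f_def)
    have prod: "card (?X \<times> ?Y) \<le> card (g w)"
    proof (rule card_inj_on_le)
      show "inj_on (\<lambda>(x, y). vs[i := x, j := y]) (?X \<times> ?Y)"
      proof (rule inj_onI, clarify)
        fix x y x' y' assume "vs[i := x, j := y] = vs[i := x', j := y']"
        then have "vs[i := x, j := y] ! i = vs[i := x', j := y'] ! i"
          "vs[i := x, j := y] ! j = vs[i := x', j := y'] ! j" by simp_all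
        then show "x = x' \<and> y = y'" using lv ij by (simp add: nth_list_update)
      qed
      show "(\<lambda>(x, y). vs[i := x, j := y]) ` (?X \<times> ?Y) \<subseteq> g w"
      proof clarify
        fix ux uy assume ux: "ux \<in> f w" and uy: "uy \<in> f w"
        let ?u = "vs[i := ux ! i, j := uy ! j]"
        have agree: "?u ! k = ux ! k" if "k < s" "k \<noteq> j" for k
          using \<kappa>_eq[of ux vs k] ux vs that ij lv by (auto simp: f_def nth_list_update)
        have agree': "?u ! k = uy ! k" if "k < s" "k \<noteq> i" for k
          using \<kappa>_eq[of uy vs k] uy vs that ij lv by (auto simp: f_def nth_list_update)
        have adjx: "adj (ux ! k) (ux ! (Suc k mod s))" "adj (uy ! k) (uy ! (Suc k mod s))" if "k < s" for k
          using ux uy D that by (auto simp: f_def closed_walks_def)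
        have "adj (?u ! k) (?u ! (Suc k mod s))" if k: "k < s" for k
        proof -
          have k': "Suc k mod s < s" using k by auto
          have mod: "Suc k mod s = (if Suc k = s then 0 else Suc k)" using k by (simp add: mod_Suc)
          \<comment> \<open>No edge joins the positions i and j, so each edge of the mixed walk is
            an edge of \<open>ux\<close> or of \<open>uy\<close>.\<close>
          have "(k \<noteq> i \<and> Suc k mod s \<noteq> i) \<or> (k \<noteq> j \<and> Suc k mod s \<noteq> j)"
            using ij k unfolding mod by auto
          then show ?thesis
            using agree[of k] agree[OF k'] agree'[of k] agree'[OF k'] adjx[OF k] k by auto
        qed
        moreover have "\<kappa> ?u = w" using vs \<kappa>_update by (auto simp: f_def)
        ultimately show "?u \<in> g w" using lv by (auto simp: g_def closed_walks_def)
      qed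
    qed (rule fin)
    have "(card (f w))\<^sup>2 \<le> (K * card ?X) * (K * card ?Y)"
      unfolding power2_eq_square by (intro mult_le_mono slice[of i j] slice[of j i]) auto
    also have "\<dots> = K\<^sup>2 * card (?X \<times> ?Y)" by (simp add: card_cartesian_product power2_eq_square)
    also have "\<dots> \<le> K\<^sup>2 * card (g w)" using prod by (rule mult_le_mono2)
    finally show ?thesis .
  qed simp
  have cardD: "card D = (\<Sum>w\<in>\<kappa> ` D. card (f w))"
    using sum.image_gen[OF finD, where g = \<kappa> and h = "\<lambda>_. 1::nat"] by (simp add: f_def)
  have "(\<Sum>w\<in>\<kappa> ` D. card (g w)) \<le> (\<Sum>w\<in>\<kappa> ` ?CW. card (g w))"
    using D finite_closed_walks by (intro sum_mono2) auto
  also have "\<dots> = card ?CW"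
    using sum.image_gen[OF finite_closed_walks, where g = \<kappa> and h = "\<lambda>_. 1::nat"] by (simp add: g_def)
  finally have sum_g: "(\<Sum>w\<in>\<kappa> ` D. card (g w)) \<le> card ?CW" .
  have "card (\<kappa> ` D) \<le> card (J \<rightarrow>\<^sub>E V)"
  proof (rule card_mono)
    show "finite (J \<rightarrow>\<^sub>E V)" using finite_V by (intro finite_PiE) (auto simp: J_def)
    show "\<kappa> ` D \<subseteq> J \<rightarrow>\<^sub>E V" using D closed_walks_in_V by (fastforce simp: \<kappa>_def J_def)
  qed
  also have "\<dots> = card V ^ (s - 2)"
    using ij by (subst card_PiE) (auto simp: J_def card_Diff_subset numeral_2_eq_2)
  finally have card_\<kappa>: "card (\<kappa> ` D) \<le> card V ^ (s - 2)" .
  have "real ((card D)\<^sup>2) = (\<Sum>w\<in>\<kappa> ` D. real (card (f w)))\<^sup>2"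
    unfolding cardD by simp
  also have "\<dots> \<le> real (card (\<kappa> ` D)) * (\<Sum>w\<in>\<kappa> ` D. (real (card (f w)))\<^sup>2)"
    by (rule sum_squared_le_card_mult)
  also have "\<dots> = real (card (\<kappa> ` D) * (\<Sum>w\<in>\<kappa> ` D. (card (f w))\<^sup>2))" by simp
  finally have "(card D)\<^sup>2 \<le> card (\<kappa> ` D) * (\<Sum>w\<in>\<kappa> ` D. (card (f w))\<^sup>2)"
    by (simp only: of_nat_le_iff)
  also have "\<dots> \<le> card V ^ (s - 2) * (\<Sum>w\<in>\<kappa> ` D. K\<^sup>2 * card (g w))"
    by (intro mult_le_mono card_\<kappa> sum_mono sq)
  also have "\<dots> \<le> card V ^ (s - 2) * (K\<^sup>2 * card ?CW)"
    unfolding sum_distrib_left[symmetric] by (intro mult_le_mono2 sum_g)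
  finally show ?thesis by (simp add: algebra_simps)
qed

text \<open>Starting from the edge at the positions \<open>p\<close>, \<open>p + 1\<close>, the cycle zigzags between the positions
  \<open>p + 2\<close> and \<open>p + 3\<close> as often as necessary before it takes the remaining positions in turn.\<close>

lemma flexible_core_rainbow_cycle:
  assumes st: "odd s" "odd t" "5 \<le> s" "s \<le> t"
    and F: "F \<subseteq> closed_walks s" "F \<noteq> {}" and p: "p < s"
    and flex: "\<And>i. i < s \<Longrightarrow> i \<noteq> p \<Longrightarrow> i \<noteq> Suc p mod s \<Longrightarrow> flexible (3 * t) F i"
  shows "\<not> rainbow_cycle_free t"
proof -
  \<comment> \<open>Rotated numbering: the positions 0 and 1 may be inflexible, all others are
    flexible.\<close>
  define pos where "pos = (\<lambda>i. (p + i) mod s)"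
  have pos_lt: "pos i < s" for i using st by (simp add: pos_def)
  have pos_Suc: "pos (Suc i) = Suc (pos i) mod s" for i by (simp add: pos_def mod_Suc_eq)
  have pos_eq: "pos i = pos j \<longleftrightarrow> i = j" if "i < s" "j < s" for i j
    using that p by (auto simp: pos_def mod_if)
  have pos_s: "pos s = pos 0" by (simp add: pos_def)
  have len: "length vs = s" if "vs \<in> F" for vs using that F by (auto simp: closed_walks_def)
  have adjp: "adj (vs ! pos i) (vs ! pos (Suc i))" if "vs \<in> F" for vs i
    using that F pos_lt[of i] by (auto simp: closed_walks_def pos_Suc)
  have flexp: "card {x. vs[pos j := x] \<in> F} > 3 * t" if "vs \<in> F" "2 \<le> j" "j < s" for vs j
  proof -
    have "pos j \<noteq> pos 0" "pos j \<noteq> pos 1" using that pos_eq[of j 0] pos_eq[of j 1] st by auto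
    then have "flexible (3 * t) F (pos j)"
      using p by (intro flex pos_lt) (auto simp: pos_def)
    then show ?thesis using that by (auto simp: flexible_def)
  qed
  \<comment> \<open>Only the two ends of the path are tied to a common member of F, the head at
    position i and the last entry at position 0. The vertices in between may stem from other
    members, which is why the path can be longer than s.\<close>
  define st where "st = (\<lambda>ws i. rainbow_path ws \<and> ws \<noteq> [] \<and> (\<exists>vs\<in>F. vs ! pos i = hd ws \<and> vs ! pos 0 = last ws))"
  have step: "\<exists>x. st (x # ws) j"
    if "st ws i" "j = Suc i \<or> i = Suc j" "2 \<le> j" "j < s" "i < s" "length ws < t" for ws i j
  proof -
    obtain vs where vs: "vs \<in> F" "vs ! pos i = hd ws" "vs ! pos 0 = last ws"
      and ws: "rainbow_path ws" "ws \<noteq> []"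
      using \<open>st ws i\<close> unfolding st_def by blast
    have ne: "pos i \<noteq> pos j" "pos 0 \<noteq> pos j" using that pos_eq[of i j] pos_eq[of 0 j] by auto
    have "{x. vs[pos j := x] \<in> F} \<subseteq> nbrs (hd ws)"
    proof
      fix x assume "x \<in> {x. vs[pos j := x] \<in> F}"
      then have u: "vs[pos j := x] \<in> F" by simp
      have "adj (vs[pos j := x] ! pos i) (vs[pos j := x] ! pos j)"
        using adjp[OF u, of i] adjp[OF u, of j] that(2) adj_sym by auto
      then show "x \<in> nbrs (hd ws)" using ne len[OF vs(1)] pos_lt vs by simp
    qed
    moreover have "card {x. vs[pos j := x] \<in> F} > 3 * length ws"
      using flexp[OF vs(1) that(3,4)] that(6) by linarith
    ultimately obtain x where x: "vs[pos j := x] \<in> F" "rainbow_path (x # ws)"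
      using extend_rainbow_path[OF ws] by blast
    then have "st (x # ws) j"
      using ne len[OF vs(1)] pos_lt vs ws unfolding st_def by (intro conjI bexI[OF _ x(1)]) auto
    then show ?thesis by blast
  qed
  have zigzag: "\<exists>ws. st ws 3 \<and> length ws = 2 * m + 4" if "2 * m + 4 \<le> t" for m
    using that
  proof (induction m)
    case 0
    obtain vs where vs: "vs \<in> F" using F by auto
    have a: "adj (vs ! pos 0) (vs ! pos 1)" using adjp[OF vs, of 0] by simp
    then have "rainbow_path [vs ! pos 1, vs ! pos 0]"
      using adj_irrefl adj_sym by (auto simp: rainbow_path_def)
    then have "st [vs ! pos 1, vs ! pos 0] 1" using vs by (auto simp: st_def)
    from step[OF this, of 2] obtain x where x: "st [x, vs ! pos 1, vs ! pos 0] 2"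
      using 0 \<open>5 \<le> s\<close> by auto
    from step[OF this, of 3] obtain y where "st [y, x, vs ! pos 1, vs ! pos 0] 3"
      using 0 \<open>5 \<le> s\<close> by auto
    then show ?case by (intro exI[of _ "[y, x, vs ! pos 1, vs ! pos 0]"]) auto
  next
    case (Suc m)
    then obtain ws where ws: "st ws 3" "length ws = 2 * m + 4" by auto
    from step[OF this(1), of 2] obtain x where x: "st (x # ws) 2"
      using Suc.prems ws \<open>5 \<le> s\<close> by auto
    from step[OF this, of 3] obtain y where "st (y # x # ws) 3"
      using Suc.prems ws \<open>5 \<le> s\<close> by auto
    then show ?case using ws by (intro exI[of _ "y # x # ws"]) auto
  qed
  \<comment> \<open>Equal parity makes t - s even: d additional rounds between the positions 2 and 3
    supply the missing vertices.\<close>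
  obtain d where d: "t = s + 2 * d" using \<open>odd s\<close> \<open>odd t\<close> \<open>s \<le> t\<close>
    by (metis even_add evenE le_add_diff_inverse)
  have "\<exists>ws. st ws (3 + k) \<and> length ws = 2 * d + 4 + k" if "3 + k < s - 1" for k
    using that
  proof (induction k)
    case 0
    then show ?case using zigzag[of d] d by auto
  next
    case (Suc k)
    then obtain ws where ws: "st ws (3 + k)" "length ws = 2 * d + 4 + k" by auto
    have "3 + Suc k < s" using Suc.prems by linarith
    with step[OF ws(1), of "3 + Suc k"] obtain x where "st (x # ws) (3 + Suc k)"
      using Suc.prems ws d by auto
    then show ?case using ws by (intro exI[of _ "x # ws"]) auto
  qed
  moreover have "3 + (s - 5) = s - 2" "3 + (s - 5) < s - 1" "Suc (2 * d + 4 + (s - 5)) = t"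
    using \<open>5 \<le> s\<close> d by linarith+
  ultimately obtain ws where ws': "st ws (s - 2)" "Suc (length ws) = t"
    by metis
  then obtain vs where vs: "vs \<in> F" "vs ! pos (s - 2) = hd ws" "vs ! pos 0 = last ws"
    and ws: "rainbow_path ws" "ws \<noteq> []"
    by (auto simp: st_def)
  \<comment> \<open>The last position is adjacent to s - 2 and to 0, hence to both ends of the path,
    and closes the cycle.\<close>
  let ?j = "s - 1"
  have ne: "pos (s - 2) \<noteq> pos ?j" "pos 0 \<noteq> pos ?j"
    using \<open>5 \<le> s\<close> pos_eq[of "s - 2" ?j] pos_eq[of 0 ?j] by auto
  have "{x. vs[pos ?j := x] \<in> F} \<subseteq> {x. adj (hd ws) x \<and> adj (last ws) x}"
  proof
    fix x assume "x \<in> {x. vs[pos ?j := x] \<in> F}"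
    then have u: "vs[pos ?j := x] \<in> F" by simp
    have "Suc (s - 2) = ?j" "Suc ?j = s" using \<open>5 \<le> s\<close> by auto
    then have "adj (vs[pos ?j := x] ! pos (s - 2)) (vs[pos ?j := x] ! pos ?j)"
      "adj (vs[pos ?j := x] ! pos ?j) (vs[pos ?j := x] ! pos 0)"
      using adjp[OF u, of "s - 2"] adjp[OF u, of ?j] pos_s by auto
    then show "x \<in> {x. adj (hd ws) x \<and> adj (last ws) x}"
      using ne len[OF vs(1)] pos_lt vs adj_sym by simp
  qed
  moreover have "card {x. vs[pos ?j := x] \<in> F} > 3 * length ws"
    using flexp[OF vs(1), of ?j] ws'(2) \<open>5 \<le> s\<close> by linarith
  moreover have "length ws \<ge> 2" using ws'(2) \<open>5 \<le> s\<close> \<open>s \<le> t\<close> by linarith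
  ultimately show ?thesis
    using close_rainbow_path[OF ws(1)] ws'(2) by blast
qed

text \<open>A core flexible outside two adjacent positions would give a rainbow cycle, so two
  non-adjacent positions are light in some D with N <= s^s card D. The bound on (card D)^2 contains
  N once; cancelling it leaves the claim.\<close>

lemma card_odd_cycles:
  assumes free: "rainbow_cycle_free t" and st: "odd s" "odd t" "5 \<le> s" "s \<le> t"
  shows "card (cycles s) \<le> (s ^ s)\<^sup>2 * (3 * t)\<^sup>2 * card V ^ (s - 2)"
proof -
  let ?N = "card (closed_walks s)"
  have "cycles s \<subseteq> closed_walks s" using st by (auto simp: cycles_iff_nth closed_walks_def)
  then have le: "card (cycles s) \<le> ?N" by (intro card_mono finite_closed_walks)
  have "?N \<le> (s ^ s)\<^sup>2 * (3 * t)\<^sup>2 * card V ^ (s - 2)"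
  proof (cases "closed_walks s = {}")
    case False
    have "\<exists>L D F. L \<subseteq> {..<s} \<and> D \<subseteq> closed_walks s \<and> F \<subseteq> D \<and> F \<noteq> {} \<and>
      (\<forall>i\<in>L. light (3 * t) D i) \<and> (\<forall>i\<in>{..<s} - L. flexible (3 * t) F i) \<and>
      ?N \<le> s ^ card ({..<s} - {}) * card D"
    proof (rule ex_flexible_core[OF finite_closed_walks _ False])
      show "length vs = s" if "vs \<in> closed_walks s" for vs using that by (simp add: closed_walks_def)
    qed (use st in auto)
    then obtain L D F where LDF: "L \<subseteq> {..<s}" "D \<subseteq> closed_walks s" "F \<subseteq> D" "F \<noteq> {}"
      "\<forall>i\<in>L. light (3 * t) D i" "\<forall>i\<in>{..<s} - L. flexible (3 * t) F i" "?N \<le> s ^ s * card D"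
      by (elim exE conjE) simp
    have "\<not> (\<exists>p<s. L \<subseteq> {p, Suc p mod s})"
    proof
      assume "\<exists>p<s. L \<subseteq> {p, Suc p mod s}"
      then obtain p where "p < s" "L \<subseteq> {p, Suc p mod s}" by blast
      then have "\<not> rainbow_cycle_free t"
        using LDF by (intro flexible_core_rainbow_cycle[OF st, of F p]) auto
      then show False using free by simp
    qed
    then obtain i j where "i \<in> L" "j \<in> L" "i < j" "j \<noteq> Suc i" "\<not> (i = 0 \<and> j = s - 1)"
      using adjacent_positions[OF LDF(1)] st by force
    then have D: "(card D)\<^sup>2 \<le> (3 * t)\<^sup>2 * card V ^ (s - 2) * ?N"
      using LDF by (intro card_light_light) auto
    have "?N * ?N \<le> (s ^ s)\<^sup>2 * (card D)\<^sup>2"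
      using power_mono[OF LDF(7), of 2] by (simp add: power2_eq_square algebra_simps)
    also have "\<dots> \<le> (s ^ s)\<^sup>2 * ((3 * t)\<^sup>2 * card V ^ (s - 2) * ?N)"
      using D by (rule mult_le_mono2)
    also have "\<dots> = ((s ^ s)\<^sup>2 * (3 * t)\<^sup>2 * card V ^ (s - 2)) * ?N" by (simp add: mult.assoc)
    finally show ?thesis using False finite_closed_walks by (auto simp: card_gt_0_iff)
  qed simp
  then show ?thesis using le by linarith
qed

end

section \<open>Copies of cycles as lists of vertices\<close>

definition graph_adj :: "'a graph \<Rightarrow> 'a \<Rightarrow> 'a \<Rightarrow> bool" where
  "graph_adj G x y \<longleftrightarrow> {x, y} \<in> edges G"

definition graph_col :: "('a set \<Rightarrow> 'c) \<Rightarrow> 'a \<Rightarrow> 'a \<Rightarrow> 'c" where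
  "graph_col c x y = c {x, y}"

definition cycle_edge :: "'a list \<Rightarrow> nat \<Rightarrow> 'a set" where
  "cycle_edge vs i = {vs ! i, vs ! (Suc i mod length vs)}"

definition cycle_of_list :: "'a list \<Rightarrow> 'a graph" where
  "cycle_of_list vs = (set vs, cycle_edge vs ` {..<length vs})"

lemma inj_on_cycle_edge:
  assumes "distinct vs" "length vs \<ge> 3"
  shows "inj_on (cycle_edge vs) {..<length vs}"
proof (rule inj_onI)
  fix i j assume ij: "i \<in> {..<length vs}" "j \<in> {..<length vs}" and eq: "cycle_edge vs i = cycle_edge vs j"
  let ?s = "length vs"
  have lt: "i < ?s" "j < ?s" "Suc i mod ?s < ?s" "Suc j mod ?s < ?s"
    using ij assms(2) by (auto intro!: mod_less_divisor)
  have "i = j \<or> i = Suc j mod ?s \<and> Suc i mod ?s = j"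
    using eq lt assms(1) unfolding cycle_edge_def doubleton_eq_iff
    by (auto simp: nth_eq_iff_index_eq)
  then show "i = j"
    using lt assms(2) by (auto simp: mod_Suc split: if_splits)
qed

lemma coloured_graph_of_graph:
  assumes "simple_graph G" "proper_edge_colouring G c"
  shows "coloured_graph (verts G) (graph_adj G) (graph_col c)"
proof
  show "finite (verts G)" using assms by (simp add: simple_graph_def)
  show "x \<in> verts G" if "graph_adj G x y" for x y
    using that assms unfolding simple_graph_def graph_adj_def by auto
  show "graph_adj G y x" if "graph_adj G x y" for x y
    using that by (simp add: graph_adj_def insert_commute)
  show "\<not> graph_adj G x x" for x
    using assms(1) unfolding simple_graph_def graph_adj_def by fastforce
  show "graph_col c x y = graph_col c y x" for x y
    by (simp add: graph_col_def insert_commute)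
  show "y = z" if "graph_adj G x y" "graph_adj G x z" "graph_col c x y = graph_col c x z" for x y z
  proof (rule ccontr)
    assume "y \<noteq> z"
    then have "{x, y} \<noteq> {x, z}" by (auto simp: doubleton_eq_iff)
    moreover have "{x, y} \<inter> {x, z} \<noteq> {}" by auto
    ultimately show False
      using that assms(2)[unfolded proper_edge_colouring_def, THEN bspec[of _ _ "{x, y}"], THEN bspec[of _ _ "{x, z}"]]
      unfolding graph_adj_def graph_col_def by simp
  qed
qed

context
  fixes G :: "'a graph" and c :: "'a set \<Rightarrow> 'c"
  assumes G: "simple_graph G" "proper_edge_colouring G c"
begin

interpretation coloured_graph "verts G" "graph_adj G" "graph_col c"
  by (rule coloured_graph_of_graph[OF G])

lemma cycle_of_list_in_copies:
  assumes "s \<ge> 3" "vs \<in> cycles s"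
  shows "cycle_of_list vs \<in> copies (cycle_graph s) G"
proof -
  have len: "length vs = s" and dist: "distinct vs"
    and adj: "\<And>i. i < s \<Longrightarrow> graph_adj G (vs ! i) (vs ! (Suc i mod s))"
    using assms by (auto simp: cycles_iff_nth)
  have edges: "cycle_edge vs i \<in> edges G" if "i < s" for i
    using adj[OF that] len by (simp add: cycle_edge_def graph_adj_def)
  have sub: "set vs \<subseteq> verts G"
    using successively_adj_subset[of vs] assms by (auto simp: cycles_def)
  have "card (cycle_edge vs i) = 2" if "i < s" for i
    using edges[OF that] G(1) by (auto simp: simple_graph_def)
  moreover have "cycle_edge vs i \<subseteq> set vs" if "i < s" for i
    using that len assms(1) by (auto simp: cycle_edge_def)
  ultimately have "subgraph (cycle_of_list vs) G"
    using sub edges len by (auto simp: subgraph_def simple_graph_def cycle_of_list_def)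
  moreover have "graph_iso (cycle_of_list vs) (cycle_graph s)"
  proof -
    define f where "f = inv_into {..<s} ((!) vs)"
    have bij: "bij_betw ((!) vs) {..<s} (set vs)"
      using bij_betw_nth[OF dist] len by auto
    have f: "f (vs ! i) = i" if "i < s" for i
      using that bij unfolding f_def by (auto simp: bij_betw_def inv_into_f_f)
    have "f ` cycle_edge vs i = {i, Suc i mod s}" if "i < s" for i
      using f[OF that] f[of "Suc i mod s"] that len by (auto simp: cycle_edge_def)
    then have "(\<lambda>e. f ` e) ` edges (cycle_of_list vs) = edges (cycle_graph s)"
      using len by (auto simp: cycle_of_list_def cycle_graph_def image_image intro!: image_cong)
    moreover have "bij_betw f (verts (cycle_of_list vs)) (verts (cycle_graph s))"
      using bij_betw_inv_into[OF bij] by (simp add: f_def cycle_of_list_def cycle_graph_def)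
    ultimately show ?thesis unfolding graph_iso_def by blast
  qed
  ultimately show ?thesis by (simp add: copies_def)
qed

lemma copy_is_cycle_of_list:
  assumes "s \<ge> 3" "S \<in> copies (cycle_graph s) G"
  obtains vs where "vs \<in> cycles s" "cycle_of_list vs = S"
proof -
  obtain f where bij: "bij_betw f (verts S) {..<s}"
    and im: "(\<lambda>e. f ` e) ` edges S = (\<lambda>i. {i, Suc i mod s}) ` {..<s}"
    and sub: "simple_graph S" "edges S \<subseteq> edges G"
    using assms(2) by (auto simp: copies_def graph_iso_def subgraph_def cycle_graph_def)
  define g where "g = inv_into (verts S) f"
  have gb: "bij_betw g {..<s} (verts S)" unfolding g_def by (rule bij_betw_inv_into[OF bij])
  have gf: "g ` f ` e = e" if "e \<in> edges S" for e
    using that sub(1) bij unfolding g_def simple_graph_def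
    by (meson bij_betw_imp_inj_on inv_into_image_cancel)
  define vs where "vs = map g [0..<s]"
  have len: "length vs = s" by (simp add: vs_def)
  have set: "set vs = verts S" using gb by (auto simp: vs_def bij_betw_def atLeast0LessThan)
  have dist: "distinct vs" using gb by (auto simp: vs_def distinct_map bij_betw_def atLeast0LessThan)
  have edge: "cycle_edge vs i = g ` {i, Suc i mod s}" if "i < s" for i
    using that by (auto simp: cycle_edge_def vs_def)
  have "edges S = (\<lambda>e. g ` f ` e) ` edges S" using gf by simp
  also have "\<dots> = (\<lambda>e. g ` e) ` (\<lambda>e. f ` e) ` edges S" by (simp add: image_image)
  also have "\<dots> = cycle_edge vs ` {..<s}" unfolding im image_image using edge by (intro image_cong) auto
  finally have E: "edges S = cycle_edge vs ` {..<s}" .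
  have "graph_adj G (vs ! i) (vs ! (Suc i mod s))" if "i < s" for i
    using that E sub(2) len by (auto simp: graph_adj_def cycle_edge_def)
  then have "vs \<in> cycles s" using assms(1) len dist by (auto simp: cycles_iff_nth)
  moreover have "cycle_of_list vs = S" using set E len by (auto simp: cycle_of_list_def prod_eq_iff)
  ultimately show ?thesis using that by blast
qed

lemma rainbow_cycle_of_list:
  assumes "s \<ge> 3" "vs \<in> cycles s"
  shows "rainbow c (cycle_of_list vs) \<longleftrightarrow> rainbow_cycle vs"
proof -
  have len: "length vs = s" and dist: "distinct vs"
    using assms by (auto simp: cycles_def)
  have "rainbow c (cycle_of_list vs) \<longleftrightarrow> inj_on c (cycle_edge vs ` {..<s})"
    using len by (simp add: rainbow_def cycle_of_list_def)
  also have "\<dots> \<longleftrightarrow> inj_on (c \<circ> cycle_edge vs) {..<s}"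
    using inj_on_cycle_edge[OF dist] len assms(1) by (intro comp_inj_on_iff) auto
  also have "\<dots> \<longleftrightarrow> rainbow_cycle vs"
    using rainbow_cycle_iff_nth[OF len] assms(1) len
    by (simp add: comp_def cycle_edge_def graph_col_def)
  finally show ?thesis .
qed

lemma rainbow_free_cycle_graph_iff:
  assumes "t \<ge> 3"
  shows "rainbow_free (cycle_graph t) G c \<longleftrightarrow> rainbow_cycle_free t"
proof
  assume "rainbow_free (cycle_graph t) G c"
  then show "rainbow_cycle_free t"
    using cycle_of_list_in_copies[OF assms] rainbow_cycle_of_list[OF assms]
    unfolding rainbow_free_def rainbow_cycle_free_def by blast
next
  assume free: "rainbow_cycle_free t"
  show "rainbow_free (cycle_graph t) G c"
    unfolding rainbow_free_def
  proof clarify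
    fix S assume S: "S \<in> copies (cycle_graph t) G" "rainbow c S"
    then obtain vs where "vs \<in> cycles t" "cycle_of_list vs = S"
      using copy_is_cycle_of_list[OF assms] by blast
    then show False
      using S(2) free rainbow_cycle_of_list[OF assms] unfolding rainbow_cycle_free_def by auto
  qed
qed

lemma card_copies_le_cycles:
  assumes "s \<ge> 3"
  shows "card (copies (cycle_graph s) G) \<le> card (cycles s)"
proof -
  have "copies (cycle_graph s) G \<subseteq> cycle_of_list ` cycles s"
    using copy_is_cycle_of_list[OF assms] by blast
  moreover have "finite (cycles s)" using assms by (intro finite_cycles) auto
  ultimately show ?thesis
    by (meson card_image_le card_mono finite_imageI le_trans)
qed

text \<open>All lists for one copy use its s vertices, which bounds their number by s^s; this crude
  value suffices for orders of magnitude.\<close>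

lemma card_cycles_le_copies:
  assumes "s \<ge> 3"
  shows "card (cycles s) \<le> s ^ s * card (copies (cycle_graph s) G)"
proof -
  have "cycle_of_list ` cycles s \<subseteq> copies (cycle_graph s) G"
    using cycle_of_list_in_copies[OF assms] by blast
  moreover have fin: "finite (cycles s)" using assms by (intro finite_cycles) auto
  moreover have "copies (cycle_graph s) G \<subseteq> cycle_of_list ` cycles s"
    using copy_is_cycle_of_list[OF assms] by blast
  ultimately have eq: "cycle_of_list ` cycles s = copies (cycle_graph s) G" by blast
  have "card (cycles s) = (\<Sum>S\<in>copies (cycle_graph s) G. card {vs \<in> cycles s. cycle_of_list vs = S})"
    using sum.image_gen[OF fin, where g = cycle_of_list and h = "\<lambda>_. 1::nat"] by (simp add: eq)
  also have "\<dots> \<le> (\<Sum>S\<in>copies (cycle_graph s) G. s ^ s)"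
  proof (rule sum_mono)
    fix S assume "S \<in> copies (cycle_graph s) G"
    then have "S \<in> cycle_of_list ` cycles s" by (simp only: eq)
    then obtain us where us: "us \<in> cycles s" "cycle_of_list us = S" by auto
    have "{vs \<in> cycles s. cycle_of_list vs = S} \<subseteq> {vs. set vs \<subseteq> set us \<and> length vs = s}"
      using us(2) by (auto simp: cycle_of_list_def cycles_def)
    then have "card {vs \<in> cycles s. cycle_of_list vs = S} \<le> card {vs. set vs \<subseteq> set us \<and> length vs = s}"
      by (intro card_mono finite_lists_length_eq) auto
    also have "\<dots> = s ^ s"
      using us(1) by (simp add: card_lists_length_eq cycles_def distinct_card)
    finally show "card {vs \<in> cycles s. cycle_of_list vs = S} \<le> s ^ s" .
  qed
  finally show ?thesis by (simp add: mult.commute)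
qed

end

lemma ex_rainbow_le:
  assumes "s \<ge> 3" "t \<ge> 3"
    and bound: "\<And>V adj (col :: nat \<Rightarrow> nat \<Rightarrow> nat). coloured_graph V adj col \<Longrightarrow> card V = n \<Longrightarrow>
      coloured_graph.rainbow_cycle_free adj col t \<Longrightarrow> card (coloured_graph.cycles adj s) \<le> B"
  shows "ex_rainbow n (cycle_graph s) (cycle_graph t) \<le> B"
proof -
  have "edges (cycle_graph t) \<noteq> {}"
    using assms(2) by (auto simp: cycle_graph_def lessThan_empty_iff)
  then have "rainbow_copy_counts n (cycle_graph s) (cycle_graph t) \<noteq> {}"
    by (rule rainbow_copy_counts_nonempty)
  moreover have "k \<le> B" if "k \<in> rainbow_copy_counts n (cycle_graph s) (cycle_graph t)" for k
  proof -
    obtain G :: "nat graph" and c :: "nat set \<Rightarrow> nat"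
      where k: "k = card (copies (cycle_graph s) G)"
        and G: "simple_graph G" "card (verts G) = n" "proper_edge_colouring G c" "rainbow_free (cycle_graph t) G c"
      using \<open>k \<in> rainbow_copy_counts n (cycle_graph s) (cycle_graph t)\<close>
      unfolding rainbow_copy_counts_def by blast
    have "k \<le> card (coloured_graph.cycles (graph_adj G) s)"
      using card_copies_le_cycles[OF G(1,3) assms(1)] k by simp
    also have "\<dots> \<le> B"
      using coloured_graph_of_graph[OF G(1,3)] G(2,4) rainbow_free_cycle_graph_iff[OF G(1,3) assms(2)]
      by (intro bound) auto
    finally show ?thesis .
  qed
  ultimately show ?thesis
    unfolding ex_rainbow_def by (intro Max.boundedI[OF finite_rainbow_copy_counts]) auto
qed

text \<open>Vertices and colours are embedded into the natural numbers, and isolated vertices fill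
  the graph up to n. Constructions may thus use any types and need only at most n vertices.\<close>

lemma ex_rainbow_ge:
  fixes V :: "'a set" and col :: "'a \<Rightarrow> 'a \<Rightarrow> 'c"
  assumes cg: "coloured_graph V adj col" and "card V \<le> n" and st: "s \<ge> 3" "t \<ge> 3"
    and free: "coloured_graph.rainbow_cycle_free adj col t"
  shows "card (coloured_graph.cycles adj s) \<le> s ^ s * ex_rainbow n (cycle_graph s) (cycle_graph t)"
proof -
  interpret C: coloured_graph V adj col by (rule cg)
  obtain f :: "'a \<Rightarrow> nat" where f: "inj_on f V" "f ` V \<subseteq> {..<n}"
    using assms(2) C.finite_V by (metis card_le_inj card_lessThan finite_lessThan)
  define g where "g = inv_into V f"
  have gf: "g (f x) = x" if "x \<in> V" for x using that f by (simp add: g_def)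
  have "finite ((\<lambda>(x, y). col x y) ` (V \<times> V))" using C.finite_V by simp
  then obtain k :: "'c \<Rightarrow> nat" where inj_k: "inj_on k ((\<lambda>(x, y). col x y) ` (V \<times> V))"
    by (meson finite_imp_inj_to_nat_seg)
  have "col x y \<in> (\<lambda>(x, y). col x y) ` (V \<times> V)" if "x \<in> V" "y \<in> V" for x y
    using that by (intro image_eqI[of _ _ "(x, y)"]) auto
  then have k: "k (col x y) = k (col x' y') \<longleftrightarrow> col x y = col x' y'"
    if "x \<in> V" "y \<in> V" "x' \<in> V" "y' \<in> V" for x y x' y'
    using inj_on_eq_iff[OF inj_k] that by blast
  define G where "G = ({..<n}, {{f x, f y} | x y. adj x y})"
  \<comment> \<open>\<open>Min\<close> and \<open>Max\<close> recover the two ends from the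
    unordered edge.\<close>
  define c where "c = (\<lambda>e. k (col (g (Min e)) (g (Max e))))"
  have c: "c {f x, f y} = k (col x y)" if "adj x y" for x y
    using that gf[OF C.adj_V[OF that]] gf[OF C.adj_V2[OF that]] C.col_sym[of x y]
    by (cases "f x \<le> f y") (auto simp: c_def min_def max_def)
  have f_eq: "f x = f y \<longleftrightarrow> x = y" if "x \<in> V" "y \<in> V" for x y
    using that f(1) by (auto simp: inj_on_def)
  have gadj: "graph_adj G u v \<longleftrightarrow> (\<exists>x y. adj x y \<and> u = f x \<and> v = f y)" for u v
    unfolding graph_adj_def G_def by (auto simp: doubleton_eq_iff intro: C.adj_sym)
  have gadjf: "graph_adj G (f x) (f y) \<longleftrightarrow> adj x y" if "x \<in> V" "y \<in> V" for x y
  proof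
    assume "graph_adj G (f x) (f y)"
    then obtain x' y' where xy: "adj x' y'" "f x = f x'" "f y = f y'" by (auto simp: gadj)
    then have "x = x'" "y = y'" using f_eq C.adj_V[OF xy(1)] C.adj_V2[OF xy(1)] that by auto
    then show "adj x y" using xy by simp
  qed (auto simp: gadj)
  have simple: "simple_graph G"
  proof -
    have "{f x, f y} \<subseteq> {..<n} \<and> card {f x, f y} = 2" if "adj x y" for x y
    proof -
      have "x \<noteq> y" using that C.adj_irrefl by auto
      then show ?thesis
        using f(2) f_eq C.adj_V[OF that] C.adj_V2[OF that] by (auto simp: card_insert_if)
    qed
    then show ?thesis unfolding simple_graph_def G_def by auto
  qed
  have proper: "proper_edge_colouring G c"
    unfolding proper_edge_colouring_def
  proof (intro ballI impI notI)
    fix e e' assume "e \<in> edges G" "e' \<in> edges G" and ne: "e \<noteq> e' \<and> e \<inter> e' \<noteq> {}" and eq: "c e = c e'"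
    then obtain x y x' y' where e: "e = {f x, f y}" "adj x y" "e' = {f x', f y'}" "adj x' y'"
      by (auto simp: G_def)
    note V = C.adj_V[OF e(2)] C.adj_V2[OF e(2)] C.adj_V[OF e(4)] C.adj_V2[OF e(4)]
    have col: "col x y = col x' y'" using eq c e k V by auto
    have "x = x' \<or> x = y' \<or> y = x' \<or> y = y'"
      using ne e V f_eq by auto
    then have "{x, y} = {x', y'}"
      using col C.col_proper e C.adj_sym C.col_sym by (metis doubleton_eq_iff)
    then show False using ne e by (auto simp: doubleton_eq_iff)
  qed
  interpret H: coloured_graph "verts G" "graph_adj G" "graph_col c"
    by (rule coloured_graph_of_graph[OF simple proper])
  have map_cycle: "map f vs \<in> H.cycles r \<longleftrightarrow> vs \<in> C.cycles r" if "set vs \<subseteq> V" "r \<ge> 1" for vs r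
  proof -
    have "graph_adj G (map f vs ! i) (map f vs ! (Suc i mod r)) \<longleftrightarrow> adj (vs ! i) (vs ! (Suc i mod r))"
      if "length vs = r" "i < r" for i
    proof -
      have "Suc i mod r < r" using that by (intro mod_less_divisor) auto
      then show ?thesis
        using that \<open>set vs \<subseteq> V\<close> gadjf[of "vs ! i" "vs ! (Suc i mod r)"] by (simp add: subset_iff)
    qed
    moreover have "distinct (map f vs) \<longleftrightarrow> distinct vs"
      using f(1) that by (auto simp: distinct_map intro: inj_on_subset)
    ultimately show ?thesis using that(2)
      by (cases "length vs = r") (auto simp: H.cycles_iff_nth C.cycles_iff_nth simp del: nth_map)
  qed
  have inV: "set vs \<subseteq> V" if "vs \<in> C.cycles r" "r \<ge> 2" for vs r
    using that C.successively_adj_subset[of vs] by (auto simp: C.cycles_def)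
  have Hfree: "H.rainbow_cycle_free t"
    unfolding H.rainbow_cycle_free_def
  proof (intro ballI notI)
    fix us assume us: "us \<in> H.cycles t" "H.rainbow_cycle us"
    have imV: "u \<in> f ` V" if "u \<in> set us" for u
    proof -
      obtain i where "i < t" "us ! i = u"
        using \<open>u \<in> set us\<close> us(1) by (auto simp: in_set_conv_nth H.cycles_def)
      then have "graph_adj G u (us ! (Suc i mod t))" using us(1) st by (auto simp: H.cycles_iff_nth)
      then show ?thesis using C.adj_V by (auto simp: gadj)
    qed
    have fg: "f (g u) = u" if "u \<in> set us" for u
      using imV[OF that] by (simp add: g_def f_inv_into_f)
    have "map f (map g us) = us" by (simp add: map_idI fg)
    moreover have sub: "set (map g us) \<subseteq> V"
      using imV gf by fastforce
    ultimately have vs: "map g us \<in> C.cycles t" and eq: "us = map f (map g us)"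
      using map_cycle[OF sub, of t] us(1) st by auto
    let ?vs = "map g us"
    have len: "length ?vs = t" "length us = t" using us by (auto simp: H.cycles_def)
    have adj: "adj (?vs ! i) (?vs ! (Suc i mod t))" if "i < t" for i
      using vs st that by (auto simp: C.cycles_iff_nth simp del: length_map nth_map)
    have "graph_col c (us ! i) (us ! (Suc i mod t)) = k (col (?vs ! i) (?vs ! (Suc i mod t)))" if "i < t" for i
    proof -
      have "us ! i = f (?vs ! i)" "us ! (Suc i mod t) = f (?vs ! (Suc i mod t))"
        using eq that len by (metis length_map nth_map, metis length_map nth_map mod_less_divisor gr_implies_not0 neq0_conv)
      then show ?thesis using c[OF adj[OF that]] by (simp add: graph_col_def)
    qed
    then have "inj_on (\<lambda>i. k (col (?vs ! i) (?vs ! (Suc i mod t)))) {..<t}"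
      using us(2) H.rainbow_cycle_iff_nth[OF len(2)] st unfolding inj_on_def by fastforce
    then have "inj_on (\<lambda>i. col (?vs ! i) (?vs ! (Suc i mod t))) {..<t}"
      by (auto simp: inj_on_def)
    then have "C.rainbow_cycle ?vs" using C.rainbow_cycle_iff_nth[OF len(1)] st by auto
    then show False using free vs unfolding C.rainbow_cycle_free_def by blast
  qed
  have "map f ` C.cycles s \<subseteq> H.cycles s"
    using map_cycle inV st by auto
  moreover have "inj_on (map f) (C.cycles s)"
  proof (intro inj_on_mapI inj_on_subset[OF f(1)])
    show "\<Union> (set ` C.cycles s) \<subseteq> V" using inV[of _ s] st by fastforce
  qed
  ultimately have "card (C.cycles s) \<le> card (H.cycles s)"
    using H.finite_cycles[of s] st by (intro card_inj_on_le) auto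
  also have "\<dots> \<le> s ^ s * card (copies (cycle_graph s) G)"
    by (rule card_cycles_le_copies[OF simple proper st(1)])
  also have "card (copies (cycle_graph s) G) \<le> ex_rainbow n (cycle_graph s) (cycle_graph t)"
    unfolding ex_rainbow_def
  proof (rule Max_ge[OF finite_rainbow_copy_counts])
    have "card (verts G) = n" by (simp add: G_def)
    then show "card (copies (cycle_graph s) G) \<in> rainbow_copy_counts n (cycle_graph s) (cycle_graph t)"
      unfolding rainbow_copy_counts_def
      using simple proper rainbow_free_cycle_graph_iff[OF simple proper st(2)] Hfree by blast
  qed
  finally show ?thesis by simp
qed

section \<open>Blow-ups of cycles\<close>

text \<open>Unrolling a cycle to a periodic sequence on all natural numbers allows arguments about
  consecutive vertices without wrap-around.\<close>

lemma (in coloured_graph) cycle_periodic: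
  assumes "vs \<in> cycles t" "t \<ge> 1"
  obtains f where "\<And>k. adj (f k) (f (Suc k))" "\<And>j k. f j = f k \<longleftrightarrow> j mod t = k mod t"
    "\<And>j k. rainbow_cycle vs \<Longrightarrow> col (f j) (f (Suc j)) = col (f k) (f (Suc k)) \<Longrightarrow> j mod t = k mod t"
proof -
  define f where "f = (\<lambda>k. vs ! (k mod t))"
  have len: "length vs = t" and dist: "distinct vs"
    and adj: "\<And>i. i < t \<Longrightarrow> adj (vs ! i) (vs ! (Suc i mod t))"
    using assms by (auto simp: cycles_iff_nth)
  have lt: "k mod t < t" for k using assms(2) by (intro mod_less_divisor) auto
  have Suc: "f (Suc k) = vs ! (Suc (k mod t) mod t)" for k by (simp add: f_def mod_Suc_eq)
  show ?thesis
  proof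
    show "adj (f k) (f (Suc k))" for k
      using adj[OF lt[of k]] unfolding Suc by (simp add: f_def)
    show "f j = f k \<longleftrightarrow> j mod t = k mod t" for j k
      using lt[of j] lt[of k] dist len by (simp add: f_def nth_eq_iff_index_eq)
    show "j mod t = k mod t" if "rainbow_cycle vs" "col (f j) (f (Suc j)) = col (f k) (f (Suc k))" for j k
    proof -
      have "inj_on (\<lambda>i. col (vs ! i) (vs ! (Suc i mod t))) {..<t}"
        using rainbow_cycle_iff_nth[OF len assms(2)] that(1) by simp
      then show ?thesis
        using that(2) lt unfolding Suc by (auto simp: f_def inj_on_def)
    qed
  qed
qed

lemma (in coloured_graph) rainbow_cycle_periodic:
  assumes "vs \<in> cycles t" "t \<ge> 1" "rainbow_cycle vs"
  obtains f where "\<And>k. adj (f k) (f (Suc k))" "\<And>j k. f j = f k \<longleftrightarrow> j mod t = k mod t"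
    "\<And>j k. col (f j) (f (Suc j)) = col (f k) (f (Suc k)) \<Longrightarrow> j mod t = k mod t"
proof (rule cycle_periodic[OF assms(1,2)])
  fix f assume f: "\<And>k. adj (f k) (f (Suc k))" "\<And>j k. f j = f k \<longleftrightarrow> j mod t = k mod t"
    "\<And>j k. rainbow_cycle vs \<Longrightarrow> col (f j) (f (Suc j)) = col (f k) (f (Suc k)) \<Longrightarrow> j mod t = k mod t"
  show thesis
    by (rule that[of f]) (rule f(1), rule f(2), rule f(3)[OF assms(3)])
qed

text \<open>Blow-ups of the cycle on \<open>{..<r}\<close>: the vertices in \<open>Fix\<close> are not blown up, and the edges
  \<open>{e, e + 1}\<close> with \<open>e \<in> Mat\<close> become perfect matchings in the common colour \<open>None\<close>. All other
  edges have private colours.\<close>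

locale cycle_blow_up =
  fixes r m :: nat and Fix Mat :: "nat set"
  assumes r: "r \<ge> 3" and Mat: "Mat \<subseteq> {..<r}" "\<And>e. e \<in> Mat \<Longrightarrow> Suc e mod r \<notin> Mat"
begin

definition base :: "nat \<Rightarrow> nat \<Rightarrow> nat \<Rightarrow> bool" where
  "base e i j \<longleftrightarrow> {i, j} = {e, Suc e mod r}"

definition bverts :: "(nat \<times> nat) set" where
  "bverts = {(i, x). i < r \<and> x < m \<and> (i \<in> Fix \<longrightarrow> x = 0)}"

definition badj :: "nat \<times> nat \<Rightarrow> nat \<times> nat \<Rightarrow> bool" where
  "badj u v \<longleftrightarrow> u \<in> bverts \<and> v \<in> bverts \<and> (\<exists>e<r. base e (fst u) (fst v) \<and> (e \<in> Mat \<longrightarrow> snd u = snd v))"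

definition bcol :: "nat \<times> nat \<Rightarrow> nat \<times> nat \<Rightarrow> (nat \<times> nat) set option" where
  "bcol u v = (if \<exists>e\<in>Mat. base e (fst u) (fst v) then None else Some {u, v})"

lemma base_sym: "base e i j \<longleftrightarrow> base e j i"
  by (simp add: base_def insert_commute)

lemma Suc_mod_neq: "e < r \<Longrightarrow> Suc e mod r \<noteq> e"
  using r by (auto simp: mod_Suc)

lemma Suc_mod_inj: "e < r \<Longrightarrow> e' < r \<Longrightarrow> Suc e mod r = Suc e' mod r \<Longrightarrow> e = e'"
  by (auto simp: mod_Suc split: if_splits)

lemma base_unique: "base e i j \<Longrightarrow> base e' i j \<Longrightarrow> e < r \<Longrightarrow> e' < r \<Longrightarrow> e = e'"
  using r unfolding base_def by (auto simp: doubleton_eq_iff mod_Suc split: if_splits)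

lemma base_irrefl: "e < r \<Longrightarrow> \<not> base e i i"
  using Suc_mod_neq unfolding base_def by (metis doubleton_eq_iff)

lemma base_cases:
  assumes "base e i j"
  obtains "i = e" "j = Suc i mod r" | "j = e" "i = Suc j mod r"
  using assms by (auto simp: base_def doubleton_eq_iff)

text \<open>A vertex of the base cycle has only two neighbours: \<open>a\<close> and
  \<open>b\<close> both differ from \<open>c\<close>, so they coincide.\<close>

lemma base_third_neighbour:
  assumes "base e j a" "base e' j b" "base e'' j c" "e < r" "e' < r" "e'' < r" "a \<noteq> c" "b \<noteq> c"
  shows "a = b" "e = e'"
proof -
  show "a = b"
    using assms by (elim base_cases) (auto dest: Suc_mod_inj)
  then show "e = e'" using assms base_unique by blast
qed

sublocale coloured_graph bverts badj bcol
proof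
  show "finite bverts"
    by (rule finite_subset[of _ "{..<r} \<times> {..<m}"]) (auto simp: bverts_def)
  show "u \<in> bverts" if "badj u v" for u v using that by (simp add: badj_def)
  show "badj v u" if "badj u v" for u v using that base_sym by (auto simp: badj_def)
  show "\<not> badj u u" for u using base_irrefl by (auto simp: badj_def)
  show "bcol u v = bcol v u" for u v
    using base_sym[of _ "fst u" "fst v"] by (simp add: bcol_def insert_commute)
  show "v = w" if "badj u v" "badj u w" "bcol u v = bcol u w" for u v w
  proof (cases "bcol u v")
    case (Some e)
    then have "{u, v} = {u, w}" using that(3) by (auto simp: bcol_def split: if_splits)
    then show ?thesis by (auto simp: doubleton_eq_iff)
  next
    case None
    then obtain e e' where e: "e \<in> Mat" "base e (fst u) (fst v)" "e' \<in> Mat" "base e' (fst u) (fst w)"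
      using \<open>bcol u v = bcol u w\<close> by (auto simp: bcol_def split: if_splits)
    have lt: "e < r" "e' < r" using e Mat(1) by auto
    have "snd u = snd v" "snd u = snd w"
      using that(1,2) e lt base_unique unfolding badj_def by blast+
    \<comment> \<open>Different base edges at a common vertex are consecutive, and
      \<open>Mat\<close> contains no two consecutive ones.\<close>
    moreover have "fst v = fst w"
      using e(2,4) Mat(2)[OF e(1)] Mat(2)[OF e(3)] e(1,3) lt
      by (elim base_cases) (auto dest: Suc_mod_inj)
    ultimately show ?thesis by (simp add: prod_eq_iff)
  qed
qed

lemma card_bverts_le: "card bverts \<le> r * m"
proof -
  have "card bverts \<le> card ({..<r} \<times> {..<m})"
    by (intro card_mono) (auto simp: bverts_def)
  then show ?thesis by (simp add: card_cartesian_product)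
qed

text \<open>Without the edge e the base cycle is a path, hence bipartite. \<open>q\<close> numbers
  this path from the end e + 1 to the end e, and its parity would change at every step of a closed
  walk of odd length.\<close>

lemma odd_cycle_uses_base_edge:
  assumes adj: "\<And>k. badj (f k) (f (Suc k))" and per: "\<And>j k. f j = f k \<longleftrightarrow> j mod t = k mod t"
    and "odd t" "e < r"
  shows "\<exists>k. base e (fst (f k)) (fst (f (Suc k)))"
proof (rule ccontr)
  assume none: "\<not> ?thesis"
  define q where "q = (\<lambda>i. if i > e then i - Suc e else i + r - Suc e)"
  have flip: "even (q (fst (f (Suc k)))) \<longleftrightarrow> odd (q (fst (f k)))" for k
  proof -
    have step: "q (Suc i mod r) = Suc (q i)" if "i < r" "i \<noteq> e" for i
      using that \<open>e < r\<close> by (auto simp: q_def mod_Suc)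
    obtain e' where e': "e' < r" "base e' (fst (f k)) (fst (f (Suc k)))"
      using adj[of k] by (auto simp: badj_def)
    then have "e' \<noteq> e" using none by auto
    then show ?thesis
      using e'(2) step[of e'] e'(1) by (elim base_cases) auto
  qed
  have "even (q (fst (f k))) \<longleftrightarrow> (even (q (fst (f 0))) \<longleftrightarrow> even k)" for k
    by (induction k) (auto simp: flip)
  from this[of t] have "f t \<noteq> f 0" using \<open>odd t\<close> by auto
  then show False using per[of t 0] by simp
qed

text \<open>An odd cycle passes over all r base edges, each at a different step.\<close>

lemma no_short_odd_cycles:
  assumes "odd t" "t < r"
  shows "cycles t = {}"
proof (rule ccontr)
  assume "cycles t \<noteq> {}"
  then obtain vs where "vs \<in> cycles t" by blast
  moreover have "t \<ge> 1" using assms by (cases t) auto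
  ultimately obtain f where adj: "\<And>k. badj (f k) (f (Suc k))" and per: "\<And>j k. f j = f k \<longleftrightarrow> j mod t = k mod t"
    by (rule cycle_periodic) blast
  have "\<exists>k<t. base e (fst (f k)) (fst (f (Suc k)))" if e: "e < r" for e
  proof -
    obtain k where "base e (fst (f k)) (fst (f (Suc k)))"
      using odd_cycle_uses_base_edge[OF adj per assms(1) e] by blast
    moreover have "f k = f (k mod t)" "f (Suc k) = f (Suc (k mod t))"
      by (simp_all add: per mod_Suc_eq)
    ultimately show ?thesis using \<open>t \<ge> 1\<close> by (intro exI[of _ "k mod t"]) auto
  qed
  then obtain \<kappa> where \<kappa>: "\<And>e. e < r \<Longrightarrow> \<kappa> e < t \<and> base e (fst (f (\<kappa> e))) (fst (f (Suc (\<kappa> e))))"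
    by metis
  then have "inj_on \<kappa> {..<r}" using base_unique by (intro inj_onI) (metis lessThan_iff)
  moreover have "\<kappa> ` {..<r} \<subseteq> {..<t}" using \<kappa> by auto
  ultimately have "card {..<r} \<le> card {..<t}" by (intro card_inj_on_le) auto
  then show False using assms(2) by simp
qed

text \<open>An odd cycle passes over both matchings, so the colour \<open>None\<close> occurs
  twice.\<close>

lemma no_rainbow_odd_cycles:
  assumes "odd t" "{a, b} \<subseteq> Mat" "a \<noteq> b"
  shows "rainbow_cycle_free t"
  unfolding rainbow_cycle_free_def
proof (intro ballI notI)
  fix vs assume vs: "vs \<in> cycles t" "rainbow_cycle vs"
  have "t \<ge> 1" using assms by (cases t) auto
  from \<open>t \<ge> 1\<close> obtain f where adj: "\<And>k. badj (f k) (f (Suc k))"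
    and per: "\<And>j k. f j = f k \<longleftrightarrow> j mod t = k mod t"
    and rb: "\<And>j k. bcol (f j) (f (Suc j)) = bcol (f k) (f (Suc k)) \<Longrightarrow> j mod t = k mod t"
    using rainbow_cycle_periodic[OF vs(1) _ vs(2)] by blast
  have lt: "a < r" "b < r" using assms(2) Mat(1) by auto
  obtain j where j: "base a (fst (f j)) (fst (f (Suc j)))"
    using odd_cycle_uses_base_edge[OF adj per assms(1) lt(1)] by blast
  obtain k where k: "base b (fst (f k)) (fst (f (Suc k)))"
    using odd_cycle_uses_base_edge[OF adj per assms(1) lt(2)] by blast
  from j k have "bcol (f j) (f (Suc j)) = bcol (f k) (f (Suc k))"
    using assms(2) unfolding bcol_def by (metis insert_subset)
  then have "j mod t = k mod t" by (rule rb)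
  moreover from this have "Suc j mod t = Suc k mod t" by (metis mod_Suc_eq)
  ultimately have "f j = f k" "f (Suc j) = f (Suc k)" by (simp_all only: per)
  then show False using base_unique[OF j _ lt] k assms(3) by simp
qed

text \<open>If every base edge is a matching or has a fixed end, then a rainbow cycle cannot turn around:
  a turn would complete it to a cycle of length 4 or make it use two edges of colour \<open>None\<close>.\<close>

lemma no_turn:
  assumes cover: "\<And>e. e < r \<Longrightarrow> e \<in> Mat \<or> e \<in> Fix \<or> Suc e mod r \<in> Fix"
    and adj: "\<And>k. badj (f k) (f (Suc k))" and per: "\<And>j k. f j = f k \<longleftrightarrow> j mod t = k mod t"
    and rb: "\<And>j k. bcol (f j) (f (Suc j)) = bcol (f k) (f (Suc k)) \<Longrightarrow> j mod t = k mod t"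
    and t: "t \<ge> 5"
  shows "fst (f (k + 1)) \<noteq> fst (f (k + 3))"
proof
  assume eq: "fst (f (k + 1)) = fst (f (k + 3))"
  have neq: "(k + a) mod t \<noteq> (k + b) mod t" if "a < b" "b \<le> 4" for a b
  proof
    assume "(k + a) mod t = (k + b) mod t"
    then have "t dvd (k + b) - (k + a)" by (metis mod_eq_dvd_iff_nat add_le_cancel_left less_imp_le that(1))
    then have "t dvd b - a" by simp
    then show False using that t dvd_imp_le[of t "b - a"] by auto
  qed
  define j where "j = fst (f (k + 1))"
  have V: "f l \<in> bverts" for l using adj[of l] by (simp add: badj_def)
  have fix0: "snd (f l) = 0" if "fst (f l) \<in> Fix" for l
    using V[of l] that by (auto simp: bverts_def)
  have edge: "\<exists>e<r. base e (fst (f l)) (fst (f (Suc l))) \<and> (e \<in> Mat \<longrightarrow> snd (f l) = snd (f (Suc l)))" for l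
    using adj[of l] by (auto simp: badj_def)
  have ne13: "f (k + 1) \<noteq> f (k + 3)" using neq[of 1 3] per[of "k + 1" "k + 3"] by simp
  have ne02: "f k \<noteq> f (k + 2)" using neq[of 0 2] per[of k "k + 2"] by simp
  have ne24: "f (k + 2) \<noteq> f (k + 4)" using neq[of 2 4] per[of "k + 2" "k + 4"] by simp
  have ne04: "f k \<noteq> f (k + 4)" using neq[of 0 4] per[of k "k + 4"] by simp
  obtain e where e: "e < r" "base e j (fst (f (k + 2)))" "e \<in> Mat \<longrightarrow> snd (f (k + 1)) = snd (f (k + 2))"
    using edge[of "k + 1"] by (auto simp: j_def)
  obtain e' where e': "e' < r" "base e' j (fst (f (k + 2)))" "e' \<in> Mat \<longrightarrow> snd (f (k + 3)) = snd (f (k + 2))"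
    using edge[of "k + 2"] eq base_sym by (auto simp: j_def eval_nat_numeral)
  have "e = e'" using e e' base_unique by blast
  \<comment> \<open>In a matching the vertices k + 1 and k + 3 would both share their second
    coordinate with the vertex k + 2 and so coincide; they would also coincide if j were fixed. So
    \<open>cover\<close> makes the class of the vertex k + 2 fixed.\<close>
  then have "e \<notin> Mat" using e(3) e'(3) ne13 eq by (auto simp: prod_eq_iff)
  moreover have jF: "j \<notin> Fix" using ne13 eq fix0[of "k + 1"] fix0[of "k + 3"] by (auto simp: j_def prod_eq_iff)
  ultimately have iF: "fst (f (k + 2)) \<in> Fix"
    using cover[OF e(1)] e(2) by (auto elim!: base_cases)
  obtain c where c: "c < r" "base c j (fst (f k))"
    using edge[of k] base_sym by (auto simp: j_def)
  obtain d where d: "d < r" "base d j (fst (f (k + 4)))"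
    using edge[of "k + 3"] eq by (auto simp: j_def eval_nat_numeral)
  \<comment> \<open>Being different from the only vertex of that class, the vertices k and k + 4
    both lie over the other neighbour of j.\<close>
  have n0: "fst (f k) \<noteq> fst (f (k + 2))"
    using ne02 iF fix0[of k] fix0[of "k + 2"] by (auto simp: prod_eq_iff)
  have n4: "fst (f (k + 4)) \<noteq> fst (f (k + 2))"
    using ne24 iF fix0[of "k + 4"] fix0[of "k + 2"] by (auto simp: prod_eq_iff)
  have same: "fst (f k) = fst (f (k + 4))" and cd: "c = d"
    using base_third_neighbour[OF c(2) d(2) e(2) c(1) d(1) e(1) n0 n4] by auto
  show False
  proof (cases "c \<in> Mat")
    case True
    have "bcol (f k) (f (Suc k)) = None"
      using True c base_sym by (auto simp: bcol_def j_def)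
    moreover have "bcol (f (k + 3)) (f (Suc (k + 3))) = None"
      using True d cd eq by (auto simp: bcol_def j_def eval_nat_numeral)
    ultimately have "k mod t = (k + 3) mod t" by (intro rb) simp
    then show False using neq[of 0 3] by simp
  next
    case False
    then have "fst (f k) \<in> Fix" using cover[OF c(1)] c(2) jF by (auto elim!: base_cases)
    then have "f k = f (k + 4)" using fix0[of k] fix0[of "k + 4"] same by (auto simp: prod_eq_iff)
    then show False using ne04 by simp
  qed
qed

text \<open>Without turns the projection to the base cycle keeps its direction, which
  \<open>D\<close> records, and so winds around it.\<close>

lemma rainbow_cycle_winds:
  assumes cover: "\<And>e. e < r \<Longrightarrow> e \<in> Mat \<or> e \<in> Fix \<or> Suc e mod r \<in> Fix"
    and adj: "\<And>k. badj (f k) (f (Suc k))" and per: "\<And>j k. f j = f k \<longleftrightarrow> j mod t = k mod t"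
    and rb: "\<And>j k. bcol (f j) (f (Suc j)) = bcol (f k) (f (Suc k)) \<Longrightarrow> j mod t = k mod t"
    and t: "t \<ge> 5"
  shows "r dvd t" "\<And>k. fst (f (k + r)) = fst (f k)"
    "\<And>e. e < r \<Longrightarrow> \<exists>k. base e (fst (f k)) (fst (f (Suc k)))"
proof -
  define p where "p = (\<lambda>k. fst (f k))"
  define D where "D = (\<lambda>k. p (Suc k) = Suc (p k) mod r)"
  have lt: "p k < r" for k using adj[of k] by (auto simp: p_def badj_def bverts_def)
  have turn: "p k \<noteq> p (Suc (Suc k))" for k
  proof -
    \<comment> \<open>\<open>no_turn\<close> concerns k + 1 and k + 3; the index k itself is reached
      as k + t, by periodicity.\<close>
    obtain t' where t': "t = Suc t'" using t by (cases t) auto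
    have "fst (f (k + t' + 1)) \<noteq> fst (f (k + t' + 3))"
      by (rule no_turn[OF cover adj per rb t])
    moreover have "(k + t' + 1) mod t = k mod t" "(k + t' + 3) mod t = Suc (Suc k) mod t"
      using mod_add_self2[of k t] mod_add_self2[of "Suc (Suc k)" t] unfolding t'
      by (simp_all add: eval_nat_numeral)
    then have "f (k + t' + 1) = f k" "f (k + t' + 3) = f (Suc (Suc k))"
      by (simp_all only: per)
    ultimately show ?thesis unfolding p_def by simp
  qed
  have DnD: "p k = Suc (p (Suc k)) mod r" if "\<not> D k" for k
    using adj[of k] that by (auto simp: badj_def D_def p_def elim: base_cases)
  have D_Suc: "D (Suc k) \<longleftrightarrow> D k" for k
  proof
    assume "D (Suc k)"
    show "D k"
    proof (rule ccontr)
      assume "\<not> D k"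
      then have "p k = p (Suc (Suc k))" using DnD[of k] \<open>D (Suc k)\<close> unfolding D_def by argo
      then show False using turn[of k] by contradiction
    qed
  next
    assume "D k"
    show "D (Suc k)"
    proof (rule ccontr)
      assume "\<not> D (Suc k)"
      then have "Suc (p k) mod r = Suc (p (Suc (Suc k))) mod r"
        using DnD[of "Suc k"] \<open>D k\<close> unfolding D_def by argo
      then show False using turn[of k] Suc_mod_inj[OF lt[of k] lt[of "Suc (Suc k)"]] by argo
    qed
  qed
  have D_const: "D k \<longleftrightarrow> D 0" for k by (induction k) (auto simp: D_Suc)
  \<comment> \<open>The two directions. The backward one is stated with n on the left to avoid
    subtraction.\<close>
  have main: "p (k + n) = (p k + n) mod r \<or> (p (k + n) + n) mod r = p k" for k n
  proof (cases "D 0")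
    case True
    have "p (k + n) = (p k + n) mod r"
      using True D_const lt by (induction n) (auto simp: D_def mod_Suc_eq)
    then show ?thesis by simp
  next
    case False
    have "(p (k + n) + n) mod r = p k"
    proof (induction n)
      case (Suc n)
      have "p (k + n) = Suc (p (Suc (k + n))) mod r" using DnD False D_const by blast
      then have "(p (k + n) + n) mod r = (p (k + Suc n) + Suc n) mod r"
        by (simp add: mod_add_left_eq)
      then show ?case using Suc by simp
    qed (simp add: lt)
    then show ?thesis by simp
  qed
  have pt: "p t = p 0" using per[of t 0] by (simp add: p_def)
  have "(p 0 + t) mod r = p 0 mod r" using main[of 0 t] pt lt by auto
  then show "r dvd t" by (metis add_diff_cancel_left' le_add1 mod_eq_dvd_iff_nat)
  show "fst (f (k + r)) = fst (f k)" for k using main[of k r] lt by (auto simp: p_def)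
  show "\<exists>k. base e (fst (f k)) (fst (f (Suc k)))" if e: "e < r" for e
  proof (cases "D 0")
    case True
    have "p n = (p 0 + n) mod r" for n
      using True D_const lt by (induction n) (auto simp: D_def mod_Suc_eq)
    from this[of "e + r - p 0"] have "p (e + r - p 0) = e" using lt[of 0] e by simp
    then show ?thesis
      using True D_const[of "e + r - p 0"] by (intro exI[of _ "e + r - p 0"]) (auto simp: base_def D_def p_def)
  next
    case False
    have *: "(p n + n) mod r = p 0" for n
    proof (induction n)
      case (Suc n)
      have "p n = Suc (p (Suc n)) mod r" using DnD False D_const by blast
      then have "(p n + n) mod r = (p (Suc n) + Suc n) mod r" by (simp add: mod_add_left_eq)
      then show ?case using Suc by simp
    qed (simp add: lt)
    define n where "n = p 0 + r - e"
    have "(p n + n) mod r = (e + n) mod r" using *[of n] e lt by (simp add: n_def)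
    \<comment> \<open>Adding n (r - 1) cancels n modulo r. So the walk is over e at time n, hence
      over e + 1 one step before time n + r, and traverses the edge e backwards.\<close>
    then have "(p n + n + n * (r - 1)) mod r = (e + n + n * (r - 1)) mod r" by (metis mod_add_left_eq)
    moreover have "n + n * (r - 1) = n * r" using r by (cases r) auto
    then have "p n + n + n * (r - 1) = p n + n * r" "e + n + n * (r - 1) = e + n * r" by linarith+
    ultimately have "(p n + n * r) mod r = (e + n * r) mod r" by (simp only:)
    then have "p n = e" using lt[of n] e by simp
    moreover have "p (n + r - 1) = Suc (p n) mod r"
    proof -
      have "Suc (n + r - 1) = n + r" using r by simp
      then have "p (n + r - 1) = Suc (p (n + r)) mod r" using DnD[of "n + r - 1"] False D_const by metis
      then show ?thesis using main[of n r] lt by auto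
    qed
    moreover have "p (Suc (n + r - 1)) = p n" using main[of n r] lt r by auto
    ultimately show ?thesis by (intro exI[of _ "n + r - 1"]) (auto simp: base_def p_def insert_commute)
  qed
qed

text \<open>A rainbow cycle would wind around. If the class 0 is a single vertex, it is met again
  after r steps, so t divides r as well as r divides t. If there are two matchings, both are passed
  and \<open>None\<close> is repeated.\<close>

lemma no_rainbow_cycles_fixed:
  assumes cover: "\<And>e. e < r \<Longrightarrow> e \<in> Mat \<or> e \<in> Fix \<or> Suc e mod r \<in> Fix"
    and "t \<ge> 5" and "t \<noteq> r \<and> 0 \<in> Fix \<or> {a, b} \<subseteq> Mat \<and> a \<noteq> b"
  shows "rainbow_cycle_free t"
  unfolding rainbow_cycle_free_def
proof (intro ballI notI)
  fix vs assume vs: "vs \<in> cycles t" "rainbow_cycle vs"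
  have "t \<ge> 1" using assms by simp
  from \<open>t \<ge> 1\<close> obtain f where adj: "\<And>k. badj (f k) (f (Suc k))"
    and per: "\<And>j k. f j = f k \<longleftrightarrow> j mod t = k mod t"
    and rb: "\<And>j k. bcol (f j) (f (Suc j)) = bcol (f k) (f (Suc k)) \<Longrightarrow> j mod t = k mod t"
    using rainbow_cycle_periodic[OF vs(1) _ vs(2)] by blast
  have winds: "r dvd t" "\<And>k. fst (f (k + r)) = fst (f k)"
    "\<And>e. e < r \<Longrightarrow> \<exists>k. base e (fst (f k)) (fst (f (Suc k)))"
    by (rule rainbow_cycle_winds[OF cover adj per rb \<open>t \<ge> 5\<close>]; assumption)+
  from assms(3) show False
  proof
    assume "t \<noteq> r \<and> 0 \<in> Fix"
    then have ne: "t \<noteq> r" and F: "0 \<in> Fix" by auto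
    have "\<exists>k. fst (f k) = 0"
      using winds(3)[of 0] r unfolding base_def by (auto simp: doubleton_eq_iff)
    then obtain k where k: "fst (f k) = 0" by blast
    have V: "f l \<in> bverts" for l using adj[of l] by (simp add: badj_def)
    have "f (k + r) = f k"
      using winds(2)[of k] k F V[of k] V[of "k + r"] by (auto simp: bverts_def prod_eq_iff)
    then have "(k + r) mod t = k mod t" by (simp add: per)
    then have "t dvd r" by (metis add_diff_cancel_left' le_add1 mod_eq_dvd_iff_nat)
    then show False using winds(1) ne dvd_antisym by blast
  next
    assume ab: "{a, b} \<subseteq> Mat \<and> a \<noteq> b"
    then have lt: "a < r" "b < r" using Mat(1) by auto
    obtain j where j: "base a (fst (f j)) (fst (f (Suc j)))" using winds(3)[of a] lt by blast
    obtain k where k: "base b (fst (f k)) (fst (f (Suc k)))" using winds(3)[of b] lt by blast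
      from j k have "bcol (f j) (f (Suc j)) = bcol (f k) (f (Suc k))"
      using ab unfolding bcol_def by (metis insert_subset)
    then have "j mod t = k mod t" by (rule rb)
    moreover from this have "Suc j mod t = Suc k mod t" by (metis mod_Suc_eq)
    ultimately have "f j = f k" "f (Suc j) = f (Suc k)" by (simp_all only: per)
    then show False using base_unique[OF j _ lt] k ab by simp
  qed
qed

text \<open>\<open>h\<close> is a closed walk in the base cycle, and \<open>\<sigma> k\<close> is the entry of \<open>xs\<close> that is used as second
  coordinate of the \<open>k\<close>-th vertex.\<close>

lemma card_cycles_blow_up:
  assumes s: "s \<ge> 3" and d: "d \<le> m" and "m \<ge> 1"
    and h: "\<And>k. k < s \<Longrightarrow> h k < r"
    and walk: "\<And>k. k < s \<Longrightarrow> \<exists>e<r. base e (h k) (h (Suc k mod s)) \<and>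
       (e \<in> Mat \<longrightarrow> h k \<notin> Fix \<and> h (Suc k mod s) \<notin> Fix \<and> \<sigma> k = \<sigma> (Suc k mod s))"
    and \<sigma>: "\<And>k. k < s \<Longrightarrow> h k \<notin> Fix \<Longrightarrow> \<sigma> k < d" "\<And>i. i < d \<Longrightarrow> \<exists>k<s. h k \<notin> Fix \<and> \<sigma> k = i"
    and dist: "\<And>k l. k < s \<Longrightarrow> l < s \<Longrightarrow> h k = h l \<Longrightarrow> h k \<in> Fix \<or> \<sigma> k = \<sigma> l \<Longrightarrow> k = l"
  shows "(m - d) ^ d \<le> card (cycles s)"
proof -
  let ?X = "{xs. length xs = d \<and> distinct xs \<and> set xs \<subseteq> {..<m}}"
  define vert where "vert = (\<lambda>xs k. (h k, if h k \<in> Fix then 0 else xs ! \<sigma> k :: nat))"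
  define F where "F = (\<lambda>xs. map (vert xs) [0..<s])"
  \<comment> \<open>The falling factorial of m of length d counts \<open>?X\<close>. Distinct
    entries keep apart those vertices of the cycle that lie in the same class.\<close>
  have "(m - d) ^ d = (\<Prod>i\<in>{m - d + 1..m}. m - d)" using d by simp
  also have "\<dots> \<le> \<Prod>{m - d + 1..m}" by (intro prod_mono) auto
  also have "\<dots> = card ?X" using d by (subst card_lists_distinct_length_eq) auto
  also have "\<dots> \<le> card (cycles s)"
  proof (rule card_inj_on_le[where f = F])
    show "inj_on F ?X"
    proof (rule inj_onI)
      fix xs ys assume xy: "xs \<in> ?X" "ys \<in> ?X" "F xs = F ys"
      have "xs ! i = ys ! i" if "i < d" for i
      proof -
        obtain k where k: "k < s" "h k \<notin> Fix" "\<sigma> k = i" using \<sigma>(2)[OF \<open>i < d\<close>] by blast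
        have "F xs ! k = F ys ! k" using xy(3) by simp
        then show ?thesis using k by (simp add: F_def vert_def)
      qed
      then show "xs = ys" using xy by (intro nth_equalityI) auto
    qed
    show "F ` ?X \<subseteq> cycles s"
    proof clarify
      fix xs :: "nat list" assume xs: "distinct xs" "set xs \<subseteq> {..<m}" "d = length xs"
      have V: "vert xs k \<in> bverts" if "k < s" for k
        using h[OF that] \<sigma>(1)[OF that] xs \<open>m \<ge> 1\<close> by (auto simp: vert_def bverts_def subset_iff)
      have "badj (vert xs k) (vert xs (Suc k mod s))" if k: "k < s" for k
      proof -
        have "Suc k mod s < s" using s by (intro mod_less_divisor) auto
        then show ?thesis
          using V[OF k] V[of "Suc k mod s"] walk[OF k] by (auto simp: badj_def vert_def)
      qed
      moreover have "inj_on (vert xs) {..<s}"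
      proof (rule inj_onI)
        fix k l assume kl: "k \<in> {..<s}" "l \<in> {..<s}" "vert xs k = vert xs l"
        then have hkl: "h k = h l" "h k \<notin> Fix \<longrightarrow> xs ! \<sigma> k = xs ! \<sigma> l"
          by (auto simp: vert_def split: if_splits)
        have "h k \<in> Fix \<or> \<sigma> k = \<sigma> l"
          using hkl \<sigma>(1)[of k] \<sigma>(1)[of l] kl xs by (auto simp: nth_eq_iff_index_eq)
        then show "k = l" using dist kl hkl by auto
      qed
      ultimately show "F xs \<in> cycles s"
        using s by (auto simp: cycles_iff_nth F_def distinct_map atLeast0LessThan)
    qed
  qed (use finite_cycles s in auto)
  finally show ?thesis .
qed

end

section \<open>Orders of magnitude\<close>

context coloured_graph
begin

lemma card_even_cycles_even:
  assumes free: "rainbow_cycle_free t" and t: "even t" "t \<ge> 4" and s: "s = 2 * j + 4"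
  shows "card (cycles s) \<le> 6 * t * (6 * t) ^ (j + 1) * card V ^ (j + 2)"
proof -
  have "card (cycles s) \<le> 6 * t * card (walks (s - 2))"
    using s by (intro card_cycles_le_walks[OF free t]) auto
  also have "s - 2 = 0 + 2 * (j + 1)" using s by simp
  also have "6 * t * card (walks (0 + 2 * (j + 1))) \<le> 6 * t * ((6 * t * card V) ^ (j + 1) * card (walks 0))"
    by (intro mult_le_mono2 card_walks_add_even[OF free t])
  finally show ?thesis by (simp add: card_walks_0 power_mult_distrib algebra_simps)
qed

text \<open>Squared because s / 2 is not an integer. A walk with s - 2 edges is an edge, bounded by
  \<open>card_walks_1_squared\<close>, extended j + 1 times by two edges. This serves t = 4; for t
  >= 6 three edges are taken as the start instead.\<close>

lemma card_odd_cycles_even_squared: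
  assumes free: "rainbow_cycle_free t" and t: "even t" "t \<ge> 4" and s: "s = 2 * j + 5"
  shows "(card (cycles s))\<^sup>2 \<le> (6 * t)\<^sup>2 * (6 * t) ^ (2 * j + 3) * card V ^ s"
proof -
  have "card (cycles s) \<le> 6 * t * card (walks (s - 2))"
    using s by (intro card_cycles_le_walks[OF free t]) auto
  also have "s - 2 = 1 + 2 * (j + 1)" using s by simp
  also have "6 * t * card (walks (1 + 2 * (j + 1))) \<le> 6 * t * ((6 * t * card V) ^ (j + 1) * card (walks 1))"
    by (intro mult_le_mono2 card_walks_add_even[OF free t])
  finally have "(card (cycles s))\<^sup>2 \<le> (6 * t * ((6 * t * card V) ^ (j + 1) * card (walks 1)))\<^sup>2"
    by (rule power_mono) simp
  also have "\<dots> = (6 * t)\<^sup>2 * (6 * t * card V) ^ (2 * j + 2) * (card (walks 1))\<^sup>2"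
  proof -
    have "(j + 1) * 2 = 2 * j + 2" by simp
    then show ?thesis by (simp only: power_mult_distrib power_mult[symmetric] mult.assoc)
  qed
  also have "(card (walks 1))\<^sup>2 \<le> card V * (6 * t * card V * card V)"
    using card_walks_1_squared card_walks_add_2[OF free t, of 0]
    by (simp add: card_walks_0 numeral_2_eq_2) (meson le_trans mult_le_mono2)
  finally have "(card (cycles s))\<^sup>2 \<le> (6 * t)\<^sup>2 * (6 * t * card V) ^ (2 * j + 2) * (card V * (6 * t * card V * card V))"
    by simp
  also have "\<dots> = (6 * t)\<^sup>2 * (6 * t) ^ (2 * j + 3) * card V ^ s"
  proof -
    have "x\<^sup>2 * (x * n) ^ (2 * j + 2) * (n * (x * n * n)) = x\<^sup>2 * x ^ (2 * j + 3) * n ^ (2 * j + 5)" for x n :: nat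
      by (simp add: power_mult_distrib power_add power2_eq_square power3_eq_cube eval_nat_numeral mult_ac)
    from this[of "6 * t" "card V"] show ?thesis by (simp only: s)
  qed
  finally show ?thesis .
qed

lemma card_walks_odd:
  assumes free: "rainbow_cycle_free t" and t: "even t" "t \<ge> 6"
  shows "card (walks (3 + 2 * j)) \<le> (6 * t) ^ j * three_walk_const t * card V ^ (j + 2)"
proof -
  have "card (walks (3 + 2 * j)) \<le> (6 * t * card V) ^ j * card (walks 3)"
    using t by (intro card_walks_add_even[OF free]) auto
  also have "\<dots> \<le> (6 * t * card V) ^ j * (three_walk_const t * (card V)\<^sup>2)"
    using card_walks_3_le card_walks3_bound[OF free t] by (intro mult_le_mono2) linarith
  finally show ?thesis by (simp add: power_mult_distrib power_add power2_eq_square algebra_simps)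
qed

lemma card_odd_cycles_even:
  assumes free: "rainbow_cycle_free t" and t: "even t" "t \<ge> 6" and s: "s = 2 * j + 5"
  shows "card (cycles s) \<le> 6 * t * ((6 * t) ^ j * three_walk_const t) * card V ^ (j + 2)"
proof -
  have "card (cycles s) \<le> 6 * t * card (walks (s - 2))"
    using s t by (intro card_cycles_le_walks[OF free]) auto
  also have "s - 2 = 3 + 2 * j" using s by simp
  also have "6 * t * card (walks (3 + 2 * j)) \<le> 6 * t * ((6 * t) ^ j * three_walk_const t * card V ^ (j + 2))"
    by (intro mult_le_mono2 card_walks_odd[OF free t])
  finally show ?thesis by (simp add: mult.assoc)
qed

lemma card_same_cycles_even:
  assumes free: "rainbow_cycle_free t" and t: "t = 2 * j + 6"
  shows "card (cycles t) \<le> t * t * (6 * t) * ((6 * t) ^ j * three_walk_const t) * card V ^ (j + 2)"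
proof -
  have "card (cycles t) \<le> t * t * (6 * t * card (walks (t - 3)))"
    using t by (intro card_same_cycles[OF free]) auto
  also have "t - 3 = 3 + 2 * j" using t by simp
  also have "t * t * (6 * t * card (walks (3 + 2 * j)))
      \<le> t * t * (6 * t * ((6 * t) ^ j * three_walk_const t * card V ^ (j + 2)))"
    using t by (intro mult_le_mono2 card_walks_odd[OF free]) auto
  finally show ?thesis by (simp add: mult.assoc)
qed

lemma card_cycles_le_power:
  assumes "s \<ge> 2"
  shows "card (cycles s) \<le> card V ^ s"
proof -
  have "cycles s \<subseteq> {vs. set vs \<subseteq> V \<and> length vs = s}"
    using successively_adj_subset assms by (fastforce simp: cycles_def)
  then have "card (cycles s) \<le> card {vs. set vs \<subseteq> V \<and> length vs = s}"
    by (intro card_mono finite_lists_length_eq finite_V)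
  then show ?thesis by (simp add: card_lists_length_eq finite_V)
qed

end

section \<open>From bounds for single graphs to orders of magnitude\<close>

lemma ex_rainbow_bigo:
  assumes "s \<ge> 3" "t \<ge> 3"
    and bound: "\<And>V adj (col :: nat \<Rightarrow> nat \<Rightarrow> nat). coloured_graph V adj col \<Longrightarrow> card V \<ge> 1 \<Longrightarrow>
      coloured_graph.rainbow_cycle_free adj col t \<Longrightarrow>
      real (card (coloured_graph.cycles adj s)) \<le> C * real (card V) powr e"
  shows "(\<lambda>n. real (ex_rainbow n (cycle_graph s) (cycle_graph t))) \<in> O(\<lambda>n. real n powr e)"
proof (rule bigoI[of _ C])
  show "\<forall>\<^sub>F n in at_top. norm (real (ex_rainbow n (cycle_graph s) (cycle_graph t))) \<le> C * norm (real n powr e)"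
    using eventually_ge_at_top[of 1]
  proof eventually_elim
    case (elim n)
    have "ex_rainbow n (cycle_graph s) (cycle_graph t) \<le> nat \<lfloor>C * real n powr e\<rfloor>"
      using bound elim by (intro ex_rainbow_le[OF assms(1,2)] le_nat_floor) auto
    moreover have "ex_rainbow n (cycle_graph s) (cycle_graph t) = 0" if "C * real n powr e < 0"
      using calculation that by simp
    ultimately have "real (ex_rainbow n (cycle_graph s) (cycle_graph t)) \<le> max 0 (C * real n powr e)"
      by linarith
    moreover have "C * real n powr e \<ge> 0"
    proof -
      \<comment> \<open>The edgeless graph shows that the right-hand side of the bound is
        nonnegative.\<close>
      have "coloured_graph ({..<n} :: nat set) (\<lambda>_ _. False) (\<lambda>_ _. 0 :: nat)" by standard auto
      then interpret E: coloured_graph "{..<n} :: nat set" "\<lambda>_ _. False" "\<lambda>_ _. 0 :: nat" .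
      have "E.rainbow_cycle_free t" by (auto simp: E.rainbow_cycle_free_def E.cycles_def)
      then show ?thesis using bound[OF E.coloured_graph_axioms] elim by fastforce
    qed
    ultimately show ?case by simp
  qed
qed

lemma bigo_of_nat_bound:
  assumes "s \<ge> 3" "t \<ge> 3"
    and bound: "\<And>V adj (col :: nat \<Rightarrow> nat \<Rightarrow> nat). coloured_graph V adj col \<Longrightarrow>
      coloured_graph.rainbow_cycle_free adj col t \<Longrightarrow> card (coloured_graph.cycles adj s) \<le> C * card V ^ d"
    and e: "e = real d"
  shows "(\<lambda>n. real (ex_rainbow n (cycle_graph s) (cycle_graph t))) \<in> O(\<lambda>n. real n powr e)"
proof (rule ex_rainbow_bigo[OF assms(1,2)])
  fix V adj and col :: "nat \<Rightarrow> nat \<Rightarrow> nat"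
  assume *: "coloured_graph V adj col" "card V \<ge> 1" "coloured_graph.rainbow_cycle_free adj col t"
  have "real (card (coloured_graph.cycles adj s)) \<le> real (C * card V ^ d)"
    using bound[OF *(1,3)] by (rule of_nat_mono)
  also have "\<dots> = real C * real (card V) powr e"
    using *(2) by (simp add: e powr_realpow)
  finally show "real (card (coloured_graph.cycles adj s)) \<le> real C * real (card V) powr e" .
qed

text \<open>With m = n div r one has n < r (m + 1), and for n >= 2 r (d + 1) this gives m - d >= n /
  (2 r), the source of the constant.\<close>

lemma bigomega_of_nat_bound:
  assumes "r \<ge> 1" "C \<ge> 1" and e: "e = real d"
    and bound: "\<And>n m. m \<ge> 1 \<Longrightarrow> d \<le> m \<Longrightarrow> r * m \<le> n \<Longrightarrow> (m - d) ^ d \<le> C * f n"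
  shows "(\<lambda>n. real (f n)) \<in> \<Omega>(\<lambda>n. real n powr e)"
proof (rule landau_omega.bigI)
  let ?c = "1 / (real C * (2 * real r) ^ d)"
  show "?c > 0" using assms by simp
  show "\<forall>\<^sub>F n in at_top. norm (real (f n)) \<ge> ?c * norm (real n powr e)"
    using eventually_ge_at_top[of "2 * r * (d + 1)"]
  proof eventually_elim
    case (elim n)
    define m where "m = n div r"
    have "r * m \<le> n" by (simp add: m_def)
    have "n < r * (m + 1)" using assms(1) by (simp add: m_def dividend_less_times_div)
    then have lt: "real n < real r * (real m + 1)" by (metis of_nat_1 of_nat_add of_nat_less_iff of_nat_mult)
    have "real n \<ge> 2 * real r * (real d + 1)"
      using of_nat_mono[OF elim, where 'a = real] by (simp add: algebra_simps)
    with lt have ge: "real n \<le> 2 * (real r * (real m - real d))" by (simp add: algebra_simps)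
    have "real r * (real m + 1) > 2 * real r * (real d + 1)"
      using \<open>real n \<ge> 2 * real r * (real d + 1)\<close> lt by linarith
    then have "real r * (real m + 1) > real r * (2 * (real d + 1))" by (simp add: algebra_simps)
    then have "real m + 1 > 2 * (real d + 1)"
      using assms(1) by (simp add: mult_less_cancel_left_pos)
    then have "real (2 * d + 1) < real m" by simp
    then have "2 * d + 1 < m" by (simp only: of_nat_less_iff)
    then have m: "m \<ge> 1" "d \<le> m" by linarith+
    have "0 < 2 * r * (d + 1)" using assms(1) by simp
    then have n: "real n \<ge> 1" using elim by linarith
    have "real n powr e = real n ^ d" using n by (simp add: e powr_realpow)
    also have "\<dots> \<le> (2 * (real r * (real m - real d))) ^ d"
      using ge by (intro power_mono) auto
    also have "\<dots> = (2 * real r) ^ d * real ((m - d) ^ d)"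
      using m by (simp add: power_mult_distrib of_nat_diff)
    also have "\<dots> \<le> (2 * real r) ^ d * real (C * f n)"
      using bound[OF m \<open>r * m \<le> n\<close>] by (intro mult_left_mono of_nat_mono) auto
    finally show ?case using assms by (simp add: field_simps)
  qed
qed

section \<open>Lower bounds from blow-ups\<close>

lemma (in cycle_blow_up) blow_up_lower_bound:
  assumes "s \<ge> 3" "t \<ge> 3" "rainbow_cycle_free t" "r * m \<le> n" "(m - d) ^ d \<le> card (cycles s)"
  shows "(m - d) ^ d \<le> s ^ s * ex_rainbow n (cycle_graph s) (cycle_graph t)"
proof -
  have "card bverts \<le> n" using card_bverts_le assms(4) by linarith
  from ex_rainbow_ge[OF coloured_graph_axioms this assms(1-3)] show ?thesis using assms(5) by linarith
qed

text \<open>The full blow-up of C_(t+2) contains no C_t at all. An even cycle fits into the blow-up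
  of a single base edge; an odd one, of length at least t + 2, goes around once and then to and fro
  over the last base edge. The map \<open>h\<close> describes both.\<close>

lemma lower_bound_odd_t:
  assumes t: "odd t" "t \<ge> 3" and s: "s \<ge> 4" "s > t \<or> even s"
  shows "(\<lambda>n. real (ex_rainbow n (cycle_graph s) (cycle_graph t))) \<in> \<Omega>(\<lambda>n. real n powr real s)"
proof (rule bigomega_of_nat_bound[where r = "t + 2" and d = s and C = "s ^ s"])
  fix n m assume m: "m \<ge> 1" "s \<le> m" "(t + 2) * m \<le> n"
  interpret B: cycle_blow_up "t + 2" m "{}" "{}" using t by unfold_locales auto
  have "B.cycles t = {}" by (rule B.no_short_odd_cycles[OF t(1)]) simp
  then have free: "B.rainbow_cycle_free t" unfolding B.rainbow_cycle_free_def by blast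
  define h where "h = (\<lambda>k. if even s then k mod 2 else if k < t + 2 then k
    else if even (k - (t + 2)) then 0 else t + 1)"
  have "(m - s) ^ s \<le> card (B.cycles s)"
  proof (rule B.card_cycles_blow_up[where h = h and \<sigma> = "\<lambda>k. k"])
    show "h k < t + 2" for k
      by (auto simp: h_def)
    show "\<exists>e<t + 2. B.base e (h k) (h (Suc k mod s)) \<and>
        (e \<in> {} \<longrightarrow> h k \<notin> {} \<and> h (Suc k mod s) \<notin> {} \<and> k = Suc k mod s)" if k: "k < s" for k
    proof (cases "even s")
      case True
      then have "Suc k mod s mod 2 = Suc k mod 2" by (intro mod_mod_cancel) simp
      then have hk: "h k = k mod 2" "h (Suc k mod s) = Suc k mod 2"
        using True by (simp_all only: h_def if_True)
      have "k mod 2 = 0 \<and> Suc k mod 2 = 1 \<or> k mod 2 = 1 \<and> Suc k mod 2 = 0" by presburger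
      then have "{k mod 2, Suc k mod 2} = {0, 1}"
        unfolding doubleton_eq_iff by blast
      then have "{h k, h (Suc k mod s)} = {0, 1}" by (simp only: hk)
      moreover have "Suc 0 mod (t + 2) = 1" by simp
      ultimately have "B.base 0 (h k) (h (Suc k mod s))" by (simp only: B.base_def)
      then show ?thesis by (intro exI[of _ 0]) simp
    next
      case False
      then have st: "t + 2 \<le> s" using s(2) t(1) by presburger
      show ?thesis
      proof (cases "Suc k < t + 2")
        case True
        then have "Suc k mod s = Suc k" "Suc k mod (t + 2) = Suc k" using st by simp_all
        moreover have "h k = k" "h (Suc k) = Suc k" using False True by (simp_all add: h_def)
        ultimately have "B.base k (h k) (h (Suc k mod s))" by (simp only: B.base_def)
        then show ?thesis using True by (intro exI[of _ k]) simp
      next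
        case F: False
        have "{h k, h (Suc k mod s)} = {t + 1, 0}"
        proof (cases "Suc k = s")
          case True
          then have "h (Suc k mod s) = 0" using False by (simp add: h_def)
          moreover have "h k = t + 1"
            using True F False t(1) by (cases "k = t + 1") (auto simp: h_def)
          ultimately show ?thesis by simp
        next
          case ne: False
          then have "Suc k mod s = Suc k" using k by simp
          then show ?thesis using F False by (cases "k = t + 1") (auto simp: h_def Suc_diff_le)
        qed
        moreover have "Suc (t + 1) mod (t + 2) = 0" by simp
        ultimately have "B.base (t + 1) (h k) (h (Suc k mod s))" by (simp only: B.base_def)
        then show ?thesis by (intro exI[of _ "t + 1"]) simp
      qed
    qed
  qed (use s m in auto)
  then show "(m - s) ^ s \<le> s ^ s * ex_rainbow n (cycle_graph s) (cycle_graph t)"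
    using B.blow_up_lower_bound[OF _ _ free m(3), of s s] s t by auto
qed (use s in auto)

text \<open>The base is C_s itself, with matchings on the edges 01 and 23, which every odd cycle
  uses. Each matching ties two second coordinates together, so s - 2 of them remain free.\<close>

lemma lower_bound_odd_odd:
  assumes t: "odd t" "t \<ge> 3" and s: "s \<ge> 5"
  shows "(\<lambda>n. real (ex_rainbow n (cycle_graph s) (cycle_graph t))) \<in> \<Omega>(\<lambda>n. real n powr (real s - 2))"
proof (rule bigomega_of_nat_bound[where r = s and d = "s - 2" and C = "s ^ s"])
  fix n m assume m: "m \<ge> 1" "s - 2 \<le> m" "s * m \<le> n"
  interpret B: cycle_blow_up s m "{}" "{0, 2}" using s by unfold_locales auto
  have free: "B.rainbow_cycle_free t"
    by (rule B.no_rainbow_odd_cycles[of t 0 2]) (use t in auto)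
  define \<sigma> where "\<sigma> = (\<lambda>k :: nat. if k < 2 then 0 else if k < 4 then 1 else k - 2)"
  have "(m - (s - 2)) ^ (s - 2) \<le> card (B.cycles s)"
  proof (rule B.card_cycles_blow_up[where h = "\<lambda>k. k" and \<sigma> = \<sigma>])
    show "\<exists>e<s. B.base e k (Suc k mod s) \<and>
        (e \<in> {0, 2} \<longrightarrow> k \<notin> {} \<and> Suc k mod s \<notin> {} \<and> \<sigma> k = \<sigma> (Suc k mod s))" if k: "k < s" for k
      using k s by (intro exI[of _ k]) (auto simp: B.base_def \<sigma>_def)
    show "\<exists>k<s. k \<notin> {} \<and> \<sigma> k = i" if "i < s - 2" for i
      using that s
      by (intro exI[of _ "if i = 0 then 0 else i + 2"]) (auto simp: \<sigma>_def)
  qed (use s m in \<open>auto simp: \<sigma>_def\<close>)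
  then show "(m - (s - 2)) ^ (s - 2) \<le> s ^ s * ex_rainbow n (cycle_graph s) (cycle_graph t)"
    using B.blow_up_lower_bound[OF _ _ free m(3), of s "s - 2"] s t by auto
qed (use s in auto)

text \<open>Every base edge has an even, hence fixed, end; for odd s the edge from s - 1 to 0 has
  two. The floor(s / 2) odd positions are free.\<close>

lemma lower_bound_alternating:
  assumes t: "t \<ge> 5" "t \<noteq> s" and s: "s \<ge> 4"
  shows "(\<lambda>n. real (ex_rainbow n (cycle_graph s) (cycle_graph t))) \<in> \<Omega>(\<lambda>n. real n powr real (s div 2))"
proof (rule bigomega_of_nat_bound[where r = s and d = "s div 2" and C = "s ^ s"])
  fix n m assume m: "m \<ge> 1" "s div 2 \<le> m" "s * m \<le> n"
  interpret B: cycle_blow_up s m "{k. even k}" "{}" using s by unfold_locales auto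
  have free: "B.rainbow_cycle_free t"
    by (rule B.no_rainbow_cycles_fixed) (use t in \<open>auto simp: mod_Suc\<close>)
  have "(m - s div 2) ^ (s div 2) \<le> card (B.cycles s)"
  proof (rule B.card_cycles_blow_up[where h = "\<lambda>k. k" and \<sigma> = "\<lambda>k. k div 2"])
    show "\<exists>e<s. B.base e k (Suc k mod s) \<and>
        (e \<in> {} \<longrightarrow> k \<notin> {k. even k} \<and> Suc k mod s \<notin> {k. even k} \<and> k div 2 = Suc k mod s div 2)" if k: "k < s" for k
      using k by (intro exI[of _ k]) (auto simp: B.base_def)
    show "\<exists>k<s. k \<notin> {k. even k} \<and> k div 2 = i" if "i < s div 2" for i
      using that by (intro exI[of _ "2 * i + 1"]) auto
    show "k div 2 < s div 2" if "k < s" "k \<notin> {k. even k}" for k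
      using that by (auto elim!: oddE)
  qed (use s m in auto)
  then show "(m - s div 2) ^ (s div 2) \<le> s ^ s * ex_rainbow n (cycle_graph s) (cycle_graph t)"
    using B.blow_up_lower_bound[OF _ _ free m(3), of s "s div 2"] s t by auto
qed (use s in auto)

text \<open>Here t = r, so two matchings of the same colour are needed, on 12 and 45. Free are one
  coordinate for each matching and one for each of the odd positions 7, 9, ..., t - 1, together t /
  2 - 1.\<close>

lemma lower_bound_same_even:
  assumes t: "t \<ge> 6" "even t"
  shows "(\<lambda>n. real (ex_rainbow n (cycle_graph t) (cycle_graph t))) \<in> \<Omega>(\<lambda>n. real n powr real (t div 2 - 1))"
proof (rule bigomega_of_nat_bound[where r = t and d = "t div 2 - 1" and C = "t ^ t"])
  fix n m assume m: "m \<ge> 1" "t div 2 - 1 \<le> m" "t * m \<le> n"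
  let ?F = "{k. k = 0 \<or> k = 3 \<or> 6 \<le> k \<and> even k}"
  interpret B: cycle_blow_up t m ?F "{1, 4}" using t by unfold_locales auto
  have cover: "e \<in> {1, 4} \<or> e \<in> ?F \<or> Suc e mod t \<in> ?F" if "e < t" for e
  proof (cases "Suc e = t")
    case False
    then have S: "Suc e mod t = Suc e" using that by simp
    have "e = 0 \<or> e = 1 \<or> e = 2 \<or> e = 3 \<or> e = 4 \<or> e \<ge> 5" by linarith
    then show ?thesis unfolding S by auto
  qed auto
  have free: "B.rainbow_cycle_free t"
    by (rule B.no_rainbow_cycles_fixed[OF cover, where a = 1 and b = 4]) (use t in auto)
  define \<sigma> where "\<sigma> = (\<lambda>k :: nat. if k < 3 then 0 else if k < 6 then 1 else (k - 3) div 2)"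
  have "(m - (t div 2 - 1)) ^ (t div 2 - 1) \<le> card (B.cycles t)"
  proof (rule B.card_cycles_blow_up[where h = "\<lambda>k. k" and \<sigma> = \<sigma>])
    show "\<exists>e<t. B.base e k (Suc k mod t) \<and>
        (e \<in> {1, 4} \<longrightarrow> k \<notin> ?F \<and> Suc k mod t \<notin> ?F \<and> \<sigma> k = \<sigma> (Suc k mod t))" if k: "k < t" for k
      using k t by (intro exI[of _ k]) (auto simp: B.base_def \<sigma>_def)
    show "\<exists>k<t. k \<notin> ?F \<and> \<sigma> k = i" if "i < t div 2 - 1" for i
      using that t
      by (intro exI[of _ "if i = 0 then 1 else if i = 1 then 4 else 2 * i + 3"]) (auto simp: \<sigma>_def)
    show "\<sigma> k < t div 2 - 1" if "k < t" "k \<notin> ?F" for k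
      using that t by (auto simp: \<sigma>_def elim!: evenE oddE)
  qed (use t m in auto)
  then show "(m - (t div 2 - 1)) ^ (t div 2 - 1) \<le> t ^ t * ex_rainbow n (cycle_graph t) (cycle_graph t)"
    using B.blow_up_lower_bound[OF _ _ free m(3), of t "t div 2 - 1"] t by auto
qed (use t in auto)

section \<open>A Cayley graph without rainbow 4-cycles\<close>

text \<open>The scheme of the lower counts: at least c extensions for each member of
  \<open>B\<close>, all of them recoverable from the result.\<close>

lemma card_extend_lists:
  assumes "finite B" "finite A" "\<And>b. b \<in> B \<Longrightarrow> c \<le> card (E b)" "\<And>b. b \<in> B \<Longrightarrow> finite (E b)"
    "\<And>b x. b \<in> B \<Longrightarrow> x \<in> E b \<Longrightarrow> g b x \<in> A"
    "\<And>b b' x x'. b \<in> B \<Longrightarrow> b' \<in> B \<Longrightarrow> x \<in> E b \<Longrightarrow> x' \<in> E b' \<Longrightarrow> g b x = g b' x' \<Longrightarrow> b = b' \<and> x = x'"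
  shows "c * card B \<le> card A"
proof -
  have "c * card B = (\<Sum>b\<in>B. c)" by simp
  also have "\<dots> \<le> (\<Sum>b\<in>B. card (E b))" using assms(3) by (rule sum_mono)
  also have "\<dots> = card (Sigma B E)" using assms by (simp add: card_SigmaI)
  also have "\<dots> \<le> card A"
  proof (rule card_inj_on_le[where f = "\<lambda>(b, x). g b x"])
    show "inj_on (\<lambda>(b, x). g b x) (Sigma B E)"
    proof (rule inj_onI)
      fix p p' assume *: "p \<in> Sigma B E" "p' \<in> Sigma B E" "(case p of (b, x) \<Rightarrow> g b x) = (case p' of (b, x) \<Rightarrow> g b x)"
      obtain b x b' x' where "p = (b, x)" "p' = (b', x')" by (cases p; cases p') auto
      then show "p = p'" using * assms(6)[of b b' x x'] by simp
    qed
    show "(\<lambda>(b, x). g b x) ` Sigma B E \<subseteq> A" using assms(5) by auto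
  qed (rule assms)
  finally show ?thesis .
qed

lemma cube_add_identity: "(x + y) ^ 3 = x ^ 3 + y ^ 3 + 3 * ((x + y) * (x * y))"
  for x y :: "'a :: comm_ring_1"
  by (simp add: power3_eq_cube algebra_simps)

lemma cube_add_3_identity: "(x + y + z) ^ 3 = x ^ 3 + y ^ 3 + z ^ 3 + 3 * ((x + y) * (y + z) * (z + x))"
  for x y z :: "'a :: comm_ring_1"
  by (simp add: power3_eq_cube algebra_simps)

text \<open>Abstracts the field with 2^k elements, k odd, inside a larger field.
  \<open>cube_1\<close> excludes third roots of unity other than 1, so cubing permutes F.\<close>

locale char_2_subfield =
  fixes F :: "'a :: field set" and q :: nat
  assumes two: "(2 :: 'a) = 0" and finite_F: "finite F" and card_F: "card F = q"
    and zero: "0 \<in> F" and one: "1 \<in> F"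
    and add: "x \<in> F \<Longrightarrow> y \<in> F \<Longrightarrow> x + y \<in> F"
    and mult: "x \<in> F \<Longrightarrow> y \<in> F \<Longrightarrow> x * y \<in> F"
    and inv: "x \<in> F \<Longrightarrow> inverse x \<in> F"
    and cube_1: "x \<in> F \<Longrightarrow> x ^ 3 = 1 \<Longrightarrow> x = 1"
begin

lemma add_self [simp]: "x + x = (0 :: 'a)"
  using two by (metis mult_2 mult_zero_left)

lemma add_self_left [simp]: "x + (x + y) = (y :: 'a)"
  by (simp add: add.assoc[symmetric])

lemma add_eq_0 [simp]: "x + y = 0 \<longleftrightarrow> x = (y :: 'a)"
  by (metis add_self add_self_left add.right_neutral)

lemma three: "(3 :: 'a) = 1"
  using two by (metis add.right_neutral add_0 numeral_Bit1 one_add_one numeral_One)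

lemma cube: "x \<in> F \<Longrightarrow> x ^ 3 \<in> F"
  by (simp add: power3_eq_cube mult)

lemma divide: "x \<in> F \<Longrightarrow> y \<in> F \<Longrightarrow> x / y \<in> F"
  by (simp add: divide_inverse mult inv)

lemma add_cancel: "x + y = x + z \<longleftrightarrow> y = (z :: 'a)"
  by simp

lemma add_swap: "p = s + (p + r) \<Longrightarrow> s = (r :: 'a)"
  by (metis add.left_commute add.right_neutral add_left_cancel add_eq_0)

lemma cube_root:
  assumes "c \<in> F"
  obtains u where "u \<in> F" "u ^ 3 = c"
proof -
  have "inj_on (\<lambda>x. x ^ 3) F"
  proof (rule inj_onI)
    fix x y assume xy: "x \<in> F" "y \<in> F" "x ^ 3 = y ^ 3"
    show "x = y"
    proof (cases "y = 0")
      case True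
      then show ?thesis using xy by simp
    next
      case False
      then have "(x / y) ^ 3 = 1" using xy by (simp add: power_divide)
      then have "x / y = 1" using cube_1 divide xy by blast
      then show ?thesis using False by simp
    qed
  qed
  moreover have "(\<lambda>x. x ^ 3) ` F \<subseteq> F" using cube by auto
  ultimately have "(\<lambda>x. x ^ 3) ` F = F" using finite_F endo_inj_surj by blast
  then show ?thesis using assms that by (metis (mono_tags, lifting) imageE)
qed

lemma cube_add: "(x + y) ^ 3 = x ^ 3 + y ^ 3 + (x + y) * (x * (y :: 'a))"
  unfolding cube_add_identity by (simp add: three)

lemma cube_add_3: "(x + y + z) ^ 3 = x ^ 3 + y ^ 3 + z ^ 3 + (x + y) * (y + z) * (z + (x :: 'a))"
  unfolding cube_add_3_identity by (simp add: three)

text \<open>The curve \<open>{(x, x ^ 3)}\<close> is a Sidon set up to the trivial solutions with \<open>x = y\<close>.\<close>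

lemma sidon:
  fixes x y z w :: 'a
  assumes "x + y = z + w" "x ^ 3 + y ^ 3 = z ^ 3 + w ^ 3" "x \<noteq> y"
  shows "x = z \<and> y = w \<or> x = w \<and> y = z"
proof -
  have "(x + y) * (x * y) = (z + w) * (z * w)"
    using cube_add[of x y] cube_add[of z w] assms(1,2) by (metis add_left_cancel)
  then have "x * y = z * w" using assms(1,3) by (metis add_eq_0 mult_left_cancel)
  \<comment> \<open>Both pairs have the same sum and the same product, so x is a root of (X + z) (X
    + w).\<close>
  have "(x + z) * (x + w) = x * x + x * (z + w) + z * w" by (simp add: algebra_simps)
  also have "\<dots> = x * x + x * (x + y) + x * y" using assms(1) \<open>x * y = z * w\<close> by simp
  also have "\<dots> = 2 * (x * x + x * y)" by (simp only: distrib_left mult_2 add_ac)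
  finally have "(x + z) * (x + w) = 0" by (simp add: two)
  then have "x = z \<or> x = w" by simp
  then show ?thesis using assms(1) by (metis add.commute add_left_cancel)
qed

definition cverts :: "('a \<times> 'a) set" where "cverts = F \<times> F"

definition shift :: "'a \<times> 'a \<Rightarrow> 'a \<Rightarrow> 'a \<times> 'a" where "shift v x = (fst v + x, snd v + x ^ 3)"

definition cadj :: "'a \<times> 'a \<Rightarrow> 'a \<times> 'a \<Rightarrow> bool" where
  "cadj v w \<longleftrightarrow> v \<in> cverts \<and> (\<exists>x\<in>F. x \<noteq> 0 \<and> w = shift v x)"

definition ccol :: "'a \<times> 'a \<Rightarrow> 'a \<times> 'a \<Rightarrow> 'a" where "ccol v w = fst v + fst w"

lemma shift_verts: "v \<in> cverts \<Longrightarrow> x \<in> F \<Longrightarrow> shift v x \<in> cverts"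
  by (auto simp: cverts_def shift_def add cube)

lemma shift_shift [simp]: "shift (shift v x) x = v"
  by (simp add: shift_def add.assoc)

lemma shift_eq_iff [simp]: "shift v x = shift v y \<longleftrightarrow> x = y"
  by (auto simp: shift_def)

lemma shift_neq: "x \<noteq> 0 \<Longrightarrow> shift v x \<noteq> v"
  by (simp add: shift_def prod_eq_iff)

lemma cadj_shift: "v \<in> cverts \<Longrightarrow> x \<in> F \<Longrightarrow> x \<noteq> 0 \<Longrightarrow> cadj v (shift v x)"
  by (auto simp: cadj_def)

lemma ccol_shift: "ccol v (shift v x) = x"
  by (simp add: ccol_def shift_def)

sublocale coloured_graph cverts cadj ccol
proof
  show "finite cverts" using finite_F by (simp add: cverts_def)
  show "v \<in> cverts" if "cadj v w" for v w using that by (simp add: cadj_def)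
  show "cadj w v" if "cadj v w" for v w
  proof -
    from that obtain x where x: "v \<in> cverts" "x \<in> F" "x \<noteq> 0" "w = shift v x" by (auto simp: cadj_def)
    then have "cadj w (shift w x)" "shift w x = v"
      using cadj_shift[OF shift_verts[OF x(1,2)] x(2,3)] by simp_all
    then show ?thesis by simp
  qed
  show "\<not> cadj v v" for v using shift_neq by (metis cadj_def)
  show "ccol v w = ccol w v" for v w by (simp add: ccol_def add.commute)
  show "w = u" if "cadj v w" "cadj v u" "ccol v w = ccol v u" for v w u
    using that by (auto simp: cadj_def ccol_shift)
qed

lemma no_rainbow_C4: "rainbow_cycle_free 4"
  unfolding rainbow_cycle_free_def
proof (intro ballI notI)
  fix vs assume vs: "vs \<in> cycles 4" "rainbow_cycle vs"
  then have "length vs = Suc (Suc (Suc (Suc 0)))" by (simp add: cycles_def)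
  then obtain v0 v1 v2 v3 where eq: "vs = [v0, v1, v2, v3]" by (auto simp: length_Suc_conv)
  have adj: "cadj v0 v1" "cadj v1 v2" "cadj v2 v3" "cadj v3 v0"
    using vs by (auto simp: eq cycles_def)
  then obtain x0 x1 x2 x3 where x: "v1 = shift v0 x0" "v2 = shift v1 x1" "v3 = shift v2 x2" "v0 = shift v3 x3"
    by (auto simp: cadj_def)
  have "distinct [x3, x0, x1, x2]"
  proof -
    have "ccol v0 v1 = x0" "ccol v1 v2 = x1" "ccol v2 v3 = x2" "ccol v3 v0 = x3"
      using ccol_shift[of v0 x0] ccol_shift[of v1 x1] ccol_shift[of v2 x2] ccol_shift[of v3 x3]
      by (simp_all only: x(1)[symmetric] x(2)[symmetric] x(3)[symmetric] x(4)[symmetric])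
    then show ?thesis using vs(2) by (simp add: eq rainbow_cycle_def)
  qed
  moreover have "x0 + x1 = x2 + x3" "x0 ^ 3 + x1 ^ 3 = x2 ^ 3 + x3 ^ 3"
  proof -
    have "shift (shift (shift (shift v0 x0) x1) x2) x3 = v0" using x by simp
    then have "fst (shift (shift (shift (shift v0 x0) x1) x2) x3) = fst v0"
      "snd (shift (shift (shift (shift v0 x0) x1) x2) x3) = snd v0" by (simp_all only:)
    then have "x0 = x1 + (x2 + x3)" "x0 ^ 3 = x1 ^ 3 + (x2 ^ 3 + x3 ^ 3)"
      by (simp_all add: shift_def add.assoc)
    then show "x0 + x1 = x2 + x3" "x0 ^ 3 + x1 ^ 3 = x2 ^ 3 + x3 ^ 3"
      by (metis add.commute add_self_left)+
  qed
  ultimately show False using sidon[of x0 x1 x2 x3] by auto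
qed

lemma card_nbrs_eq: "v \<in> cverts \<Longrightarrow> card (nbrs v) = q - 1"
proof -
  assume v: "v \<in> cverts"
  have "nbrs v = shift v ` (F - {0})" using v by (auto simp: cadj_def)
  moreover have "inj_on (shift v) (F - {0})" by (auto simp: inj_on_def)
  ultimately show ?thesis using finite_F zero card_F by (simp add: card_image)
qed

definition paths :: "nat \<Rightarrow> ('a \<times> 'a) list set" where
  "paths j = {vs \<in> walks j. distinct vs}"

lemma finite_paths [simp]: "finite (paths j)"
  by (simp add: paths_def)

lemma card_paths: "(q - (j + 1)) ^ j * q\<^sup>2 \<le> card (paths j)"
proof (induction j)
  case 0
  have "walks 0 = paths 0" by (auto simp: paths_def walks_def length_Suc_conv)
  then show ?case
    using card_walks_0 card_F by (simp add: cverts_def card_cartesian_product power2_eq_square)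
next
  case (Suc j)
  have "(q - (j + 2)) * card (paths j) \<le> card (paths (Suc j))"
  proof (rule card_extend_lists[where E = "\<lambda>vs. nbrs (hd vs) - set vs" and g = "\<lambda>vs x. x # vs"])
    fix vs assume vs: "vs \<in> paths j"
    then have hd: "hd vs \<in> cverts" and len: "length vs = j + 1" and ne: "vs \<noteq> []"
      by (auto simp: paths_def walks_def intro: subsetD[OF _ hd_in_set])
    have "card (nbrs (hd vs)) \<le> card (nbrs (hd vs) - set vs) + card (set vs)"
      using card_Un_le[of "nbrs (hd vs) - set vs" "set vs"] card_mono[of "nbrs (hd vs) \<union> set vs" "nbrs (hd vs)"]
      by simp
    then show "q - (j + 2) \<le> card (nbrs (hd vs) - set vs)"
      using card_nbrs_eq[OF hd] card_length[of vs] len by linarith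
    show "x # vs \<in> paths (Suc j)" if "x \<in> nbrs (hd vs) - set vs" for x
    proof -
      have *: "cadj (hd vs) x" using that by blast
      have "cadj x (hd vs)" "x \<in> cverts" by (rule adj_sym[OF *], rule adj_V2[OF *])
      then have "x # vs \<in> walks (Suc j)"
        using vs ne by (simp add: paths_def walks_def successively_Cons)
      moreover have "x \<notin> set vs" "distinct vs" using that vs by (simp_all add: paths_def)
      ultimately show ?thesis by (simp add: paths_def)
    qed
  qed auto
  moreover have "(q - (j + 2)) ^ j * q\<^sup>2 \<le> (q - (j + 1)) ^ j * q\<^sup>2"
    by (intro mult_le_mono1 power_mono diff_le_mono2) auto
  then have "(q - (j + 2)) ^ j * q\<^sup>2 \<le> card (paths j)"
    using Suc.IH by (rule le_trans)
  then have "(q - (j + 2)) * ((q - (j + 2)) ^ j * q\<^sup>2) \<le> (q - (j + 2)) * card (paths j)"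
    by (rule mult_le_mono2)
  ultimately have "(q - (j + 2)) * ((q - (j + 2)) ^ j * q\<^sup>2) \<le> card (paths (Suc j))"
    by (rule le_trans[rotated])
  then show ?case by (simp add: mult.assoc)
qed

text \<open>Zero exactly if the difference of v and w lies on the curve (x, x^3), that is, for v and
  w in \<open>cverts\<close>, if they are equal or adjacent.\<close>

definition defect :: "'a \<times> 'a \<Rightarrow> 'a \<times> 'a \<Rightarrow> 'a" where
  "defect v w = (fst v + fst w) ^ 3 + (snd v + snd w)"

text \<open>As a function of x the defect is a quadratic polynomial with leading coefficient a,
  whose roots sum to a; if a = 0, it is the constant b, nonzero because v and w differ.\<close>

lemma few_bad_shifts:
  assumes "v \<noteq> w"
  shows "finite {x. defect v (shift w x) = 0}" "card {x. defect v (shift w x) = 0} \<le> 2"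
proof -
  define a where "a = fst v + fst w"
  define b where "b = snd v + snd w"
  have d: "defect v (shift w x) = a ^ 3 + (a + x) * (a * x) + b" for x
  proof -
    have "defect v (shift w x) = (a + x) ^ 3 + (b + x ^ 3)"
      by (simp add: defect_def shift_def a_def b_def add.assoc)
    then show ?thesis by (simp add: cube_add[of a x] algebra_simps)
  qed
  have "\<exists>y. {x. defect v (shift w x) = 0} \<subseteq> {y, a + y}"
  proof (cases "\<exists>y. defect v (shift w y) = 0")
    case True
    then obtain y where y: "defect v (shift w y) = 0" by blast
    have "x \<in> {y, a + y}" if x: "defect v (shift w x) = 0" for x
    proof -
      have "a \<noteq> 0"
      proof
        assume "a = 0"
        then have "b = 0" using y unfolding d by simp
        then show False using \<open>a = 0\<close> assms by (auto simp: a_def b_def prod_eq_iff)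
      qed
      have "a ^ 3 + (a + x) * (a * x) + b = a ^ 3 + (a + y) * (a * y) + b"
        using x y unfolding d by simp
      then have "(a + x) * (a * x) = (a + y) * (a * y)" by simp
      then have "a * ((a + x) * x) = a * ((a + y) * y)" by (simp add: algebra_simps)
      then have "(a + x) * x = (a + y) * y" using \<open>a \<noteq> 0\<close> by simp
      then have "(a + x) * x + (a + y) * y = 0" by simp
      moreover have "(x + y) * (a + (x + y)) = (a + x) * x + (a + y) * y"
        by (simp add: algebra_simps)
      ultimately have "(x + y) * (a + (x + y)) = 0" by simp
      then have "x = y \<or> a = x + y" by simp
      then show ?thesis by (auto simp: add.assoc)
    qed
    then show ?thesis by blast
  qed auto
  then obtain y where sub: "{x. defect v (shift w x) = 0} \<subseteq> {y, a + y}" by blast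
  then show "finite {x. defect v (shift w x) = 0}" by (rule finite_subset) simp
  have "card {x. defect v (shift w x) = 0} \<le> card {y, a + y}" using sub by (intro card_mono) auto
  also have "\<dots> \<le> 2" using card_length[of "[y, a + y]"] by simp
  finally show "card {x. defect v (shift w x) = 0} \<le> 2" .
qed

text \<open>The steps of walks with three edges between vertices with difference (a, b), except that
  steps 0 are still allowed.\<close>

definition triples :: "'a \<Rightarrow> 'a \<Rightarrow> ('a \<times> 'a \<times> 'a) set" where
  "triples a b = {(x, y, z). x \<in> F \<and> y \<in> F \<and> z \<in> F \<and> x + y + z = a \<and> x ^ 3 + y ^ 3 + z ^ 3 = b}"

lemma finite_triples: "finite (triples a b)"
  by (rule finite_subset[of _ "F \<times> F \<times> F"]) (use finite_F in \<open>auto simp: triples_def\<close>)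

text \<open>Substituting \<open>x = a + u\<close>, \<open>y = a + u * v\<close>, \<open>z = a + u * (1 + v)\<close> turns the system into the
  single equation \<open>u ^ 3 * v * (1 + v) = a ^ 3 + b\<close>, which has a unique solution \<open>u\<close> for each \<open>v\<close>.\<close>

lemma card_triples_ge:
  assumes ab: "a \<in> F" "b \<in> F" "a ^ 3 + b \<noteq> 0"
  shows "q - 2 \<le> card (triples a b)"
proof -
  define c where "c = a ^ 3 + b"
  have c: "c \<in> F" "c \<noteq> 0" using ab by (simp_all add: c_def add cube)
  have "\<exists>u. u \<in> F \<and> u ^ 3 * (v * (1 + v)) = c" if v: "v \<in> F - {0, 1}" for v
  proof -
    have "v * (1 + v) \<noteq> 0" using v by auto
    moreover have "c / (v * (1 + v)) \<in> F" using v c one by (auto intro!: divide mult add)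
    ultimately show ?thesis using cube_root[of "c / (v * (1 + v))"] by (metis nonzero_eq_divide_eq)
  qed
  then obtain u where u: "\<And>v. v \<in> F - {0, 1} \<Longrightarrow> u v \<in> F \<and> u v ^ 3 * (v * (1 + v)) = c" by metis
  define T where "T = (\<lambda>v. (a + u v, a + u v * v, a + u v * (1 + v)))"
  have "card (F - {0, 1}) \<le> card (triples a b)"
  proof (rule card_inj_on_le[where f = T])
    show "inj_on T (F - {0, 1})"
    proof (rule inj_onI)
      fix v w assume vw: "v \<in> F - {0, 1}" "w \<in> F - {0, 1}" "T v = T w"
      then have e: "u v = u w" "u v * v = u w * w" by (auto simp: T_def)
      have "u v \<noteq> 0" using u[OF vw(1)] c(2) by auto
      then show "v = w" using e by simp
    qed
    show "T ` (F - {0, 1}) \<subseteq> triples a b"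
    proof (rule image_subsetI)
      fix v assume v: "v \<in> F - {0, 1}"
      then have uv: "u v \<in> F" "u v ^ 3 * (v * (1 + v)) = c" using u[of v] by auto
      let ?x = "a + u v" and ?y = "a + u v * v" and ?z = "a + u v * (1 + v)"
      have sum: "?x + ?y + ?z = a"
        by (simp add: algebra_simps)
      have "?x + ?y = u v * (1 + v)" "?y + ?z = u v" "?z + ?x = u v * v"
        by (simp_all add: algebra_simps)
      then have "(?x + ?y) * (?y + ?z) * (?z + ?x) = u v ^ 3 * (v * (1 + v))"
        by (simp only:) (simp add: power3_eq_cube mult_ac)
      then have "a ^ 3 = (?x ^ 3 + ?y ^ 3 + ?z ^ 3) + (a ^ 3 + b)"
        using cube_add_3[of ?x ?y ?z] by (simp only: sum uv(2) c_def)
      then have cubes: "?x ^ 3 + ?y ^ 3 + ?z ^ 3 = b" by (rule add_swap)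
      have "?x \<in> F" "?y \<in> F" "?z \<in> F" using uv(1) v ab(1) one by (simp_all add: add mult)
      then show "T v \<in> triples a b" using sum cubes unfolding T_def triples_def by blast
    qed
  qed (rule finite_triples)
  moreover have "card (F - {0, 1}) = q - 2"
    using zero one finite_F card_F by (subst card_Diff_subset) auto
  ultimately show ?thesis by simp
qed

lemma triples_commute: "(x, y, z) \<in> triples a b \<Longrightarrow> (y, x, z) \<in> triples a b \<and> (z, y, x) \<in> triples a b"
  by (auto simp: triples_def ac_simps)

text \<open>Once one entry d is fixed, \<open>sidon\<close> determines the other two up to order.
  They differ, since otherwise (a, b) would be (d, d^3).\<close>

lemma card_triples_fixed:
  assumes "a ^ 3 + b \<noteq> 0"
  shows "card {p \<in> triples a b. fst p = d} \<le> 2" "card {p \<in> triples a b. fst (snd p) = d} \<le> 2"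
    "card {p \<in> triples a b. snd (snd p) = d} \<le> 2"
proof -
  have two: "z = y' \<and> w = z' \<or> z = z' \<and> w = y'"
    if t: "(d, z, w) \<in> triples a b" "(d, y', z') \<in> triples a b" for z w y' z'
  proof -
    have "z \<noteq> w"
    proof
      assume "z = w"
      then have "a = d" "b = d ^ 3" using t(1) by (auto simp: triples_def add.assoc)
      then show False using assms by simp
    qed
    moreover have "d + (z + w) = d + (y' + z')" "d ^ 3 + (z ^ 3 + w ^ 3) = d ^ 3 + (y' ^ 3 + z' ^ 3)"
      using t by (auto simp: triples_def add.assoc)
    then have "z + w = y' + z'" "z ^ 3 + w ^ 3 = y' ^ 3 + z' ^ 3" by (simp_all only: add_cancel)
    ultimately show ?thesis using sidon by blast
  qed
  have gen: "card {p \<in> triples a b. P p} \<le> 2"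
    if P: "\<And>p. p \<in> triples a b \<Longrightarrow> P p \<Longrightarrow> (d, f p, g p) \<in> triples a b"
      and inj: "\<And>p p'. P p \<Longrightarrow> P p' \<Longrightarrow> f p = f p' \<Longrightarrow> g p = g p' \<Longrightarrow> p = p'" for P f g
  proof (cases "{p \<in> triples a b. P p} = {}")
    case False
    then obtain p0 where p0: "p0 \<in> triples a b" "P p0" by blast
    have "card {p \<in> triples a b. P p} \<le> card {(f p0, g p0), (g p0, f p0)}"
    proof (rule card_inj_on_le[where f = "\<lambda>p. (f p, g p)"])
      show "inj_on (\<lambda>p. (f p, g p)) {p \<in> triples a b. P p}" using inj by (auto intro!: inj_onI)
      show "(\<lambda>p. (f p, g p)) ` {p \<in> triples a b. P p} \<subseteq> {(f p0, g p0), (g p0, f p0)}"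
        using two P p0 by blast
    qed simp
    also have "\<dots> \<le> 2" using card_length[of "[(f p0, g p0), (g p0, f p0)]"] by simp
    finally show ?thesis .
  qed (simp del: Collect_empty_eq)
  show "card {p \<in> triples a b. fst p = d} \<le> 2"
    by (rule gen[where f = "\<lambda>p. fst (snd p)" and g = "\<lambda>p. snd (snd p)"]) auto
  show "card {p \<in> triples a b. fst (snd p) = d} \<le> 2"
    by (rule gen[where f = "\<lambda>p. fst p" and g = "\<lambda>p. snd (snd p)"])
      (auto dest: triples_commute)
  show "card {p \<in> triples a b. snd (snd p) = d} \<le> 2"
    by (rule gen[where f = "\<lambda>p. fst (snd p)" and g = "\<lambda>p. fst p"])
      (auto dest: triples_commute)
qed

lemma card_filter_values:
  assumes "finite S" "finite U" "\<And>d. card {p \<in> S. f p = d} \<le> 2"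
  shows "card {p \<in> S. f p \<in> U} \<le> 2 * card U"
proof -
  have "{p \<in> S. f p \<in> U} = (\<Union>d\<in>U. {p \<in> S. f p = d})" by auto
  then have "card {p \<in> S. f p \<in> U} \<le> (\<Sum>d\<in>U. card {p \<in> S. f p = d})"
    using card_UN_le[OF assms(2)] by simp
  also have "\<dots> \<le> (\<Sum>d\<in>U. 2)" using assms(3) by (intro sum_mono)
  finally show ?thesis by simp
qed

text \<open>Counts the parallelograms v, v + x, v + x + y, v + y. The weak constant 16 makes the
  bound an instance of the one for longer cycles.\<close>

lemma card_cycles_cayley_4: "(q - 16) ^ 2 * q\<^sup>2 \<le> card (cycles 4)"
proof -
  let ?E = "Sigma (F - {0}) (\<lambda>x. F - {0, x})"
  have "card ?E = (\<Sum>x\<in>F - {0}. q - 2)"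
    using finite_F zero card_F by (subst card_SigmaI) (auto intro!: sum.cong simp: card_Diff_subset)
  also have "\<dots> = (q - 1) * (q - 2)" using finite_F zero card_F by simp
  finally have E: "card ?E = (q - 1) * (q - 2)" .
  have "(q - 1) * (q - 2) * card cverts \<le> card (cycles 4)"
  proof (rule card_extend_lists[where E = "\<lambda>_. ?E"
        and g = "\<lambda>v (x, y). [v, shift v x, shift (shift v x) y, shift v y]"])
    fix v p assume v: "v \<in> cverts" "p \<in> ?E"
    obtain x y where p: "p = (x, y)" by (cases p)
    have xy: "x \<in> F" "y \<in> F" "x \<noteq> 0" "y \<noteq> 0" "x \<noteq> y" using v p by auto
    have swap: "shift (shift v x) y = shift (shift v y) x" by (simp add: shift_def add.assoc add.commute)
    have "cadj v (shift v x)" "cadj (shift v x) (shift (shift v x) y)" "cadj (shift v y) v"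
      using v xy by (auto intro: cadj_shift shift_verts adj_sym)
    moreover have "cadj (shift (shift v x) y) (shift v y)"
      unfolding swap using v xy by (auto intro: cadj_shift shift_verts adj_sym)
    moreover have "distinct [v, shift v x, shift (shift v x) y, shift v y]"
      using xy by (auto simp: shift_def prod_eq_iff add.assoc)
    ultimately show "(case p of (x, y) \<Rightarrow> [v, shift v x, shift (shift v x) y, shift v y]) \<in> cycles 4"
      by (simp add: p cycles_def)
  qed (use E finite_F finite_V in \<open>auto intro: finite_cycles\<close>)
  moreover have "(q - 16) ^ 2 * q\<^sup>2 \<le> (q - 1) * (q - 2) * card cverts"
    using card_F by (auto simp: cverts_def card_cartesian_product power2_eq_square intro!: mult_le_mono)
  ultimately show ?thesis by linarith
qed

text \<open>A path with s - 4 edges gets one more vertex in front, chosen such that the ends have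
  nonzero defect (\<open>?G\<close>). Then \<open>card_triples_ge\<close> supplies about q ways to
  close it by three edges, with steps x, y, z, through two new vertices. Every choice leaves at
  least q - 4 s possibilities.\<close>

lemma card_cycles_cayley:
  assumes s: "s \<ge> 5"
  shows "(q - 4 * s) ^ (s - 2) * q\<^sup>2 \<le> card (cycles s)"
proof -
  let ?G = "{vs \<in> paths (s - 3). defect (last vs) (hd vs) \<noteq> 0}"
  let ?Q = "\<lambda>vs. {(x, y, z) \<in> triples (fst (last vs) + fst (hd vs)) (snd (last vs) + snd (hd vs)).
           y \<noteq> 0 \<and> shift (hd vs) x \<notin> set vs \<and> shift (last vs) z \<notin> set vs}"
  have s3: "s - 3 = Suc (s - 4)" using s by simp
  have G: "(q - 4 * s) * card (paths (s - 4)) \<le> card ?G"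
  proof (rule card_extend_lists[where E = "\<lambda>vs. {x \<in> F - {0}. shift (hd vs) x \<notin> set vs \<and> defect (last vs) (shift (hd vs) x) \<noteq> 0}"
        and g = "\<lambda>vs x. shift (hd vs) x # vs"])
    fix vs assume vs: "vs \<in> paths (s - 4)"
    then have len: "length vs = s - 3" and ne: "vs \<noteq> []" and dist: "distinct vs" and sub: "set vs \<subseteq> cverts"
      using s by (auto simp: paths_def walks_def)
    have hd: "hd vs \<in> cverts" using sub ne by auto
    have neq: "last vs \<noteq> hd vs"
    proof -
      obtain x ys where "vs = x # ys" "ys \<noteq> []" using len s by (cases vs; cases "tl vs") auto
      then show ?thesis using dist last_in_set[of ys] by auto
    qed
    let ?A = "{x. shift (hd vs) x \<in> set vs}" and ?B = "{x. defect (last vs) (shift (hd vs) x) = 0}"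
    let ?E = "{x \<in> F - {0}. shift (hd vs) x \<notin> set vs \<and> defect (last vs) (shift (hd vs) x) \<noteq> 0}"
    have A: "finite ?A" "card ?A \<le> s"
    proof -
      have inj: "inj_on (shift (hd vs)) ?A" by (auto simp: inj_on_def)
      show "finite ?A" by (rule inj_on_finite[OF inj, of "set vs"]) auto
      have "card ?A \<le> card (set vs)" by (rule card_inj_on_le[OF inj]) auto
      then show "card ?A \<le> s" using card_length[of vs] len by linarith
    qed
    note B = few_bad_shifts[OF neq]
    have "F \<subseteq> ?E \<union> {0} \<union> ?A \<union> ?B" by auto
    then have "card F \<le> card (?E \<union> {0} \<union> ?A \<union> ?B)"
      using A B finite_F by (intro card_mono) auto
    also have "\<dots> \<le> card ?E + card {0 :: 'a} + card ?A + card ?B"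
      by (intro order.trans[OF card_Un_le] add_mono order_refl)
    finally have "q \<le> card ?E + 1 + s + 2" using A B card_F by simp
    then show "q - 4 * s \<le> card ?E" using s by linarith
    show "finite ?E" using finite_F by auto
    fix x assume x: "x \<in> ?E"
    then have "cadj (hd vs) (shift (hd vs) x)" using hd by (auto intro: cadj_shift)
    then have "cadj (shift (hd vs) x) (hd vs)" by (rule adj_sym)
    then show "shift (hd vs) x # vs \<in> ?G"
      using x vs ne s3 hd adj_V unfolding paths_def walks_def by (auto simp: successively_Cons)
  qed auto
  have C: "(q - 4 * s) * card ?G \<le> card (cycles s)"
  proof (rule card_extend_lists[where E = ?Q
        and g = "\<lambda>vs (x, y, z). shift (last vs) z # shift (hd vs) x # vs"])
    fix vs assume vsG: "vs \<in> ?G"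
    then have vs: "vs \<in> paths (s - 3)" and def: "defect (last vs) (hd vs) \<noteq> 0" by auto
    then have len: "length vs = s - 2" and ne: "vs \<noteq> []" and dist: "distinct vs" and sub: "set vs \<subseteq> cverts"
      and succ: "successively cadj vs"
      using s by (auto simp: paths_def walks_def)
    have hd: "hd vs \<in> cverts" "last vs \<in> cverts" using sub ne by auto
    define a where "a = fst (last vs) + fst (hd vs)"
    define b where "b = snd (last vs) + snd (hd vs)"
    have ab: "a \<in> F" "b \<in> F" "a ^ 3 + b \<noteq> 0"
      using hd def by (auto simp: a_def b_def cverts_def defect_def intro!: add)
    let ?T = "triples a b"
    let ?E = "{(x, y, z) \<in> ?T. y \<noteq> 0 \<and> shift (hd vs) x \<notin> set vs \<and> shift (last vs) z \<notin> set vs}"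
    have U: "finite {x. shift v x \<in> set vs}" "card {x. shift v x \<in> set vs} \<le> s - 2" for v
    proof -
      have inj: "inj_on (shift v) {x. shift v x \<in> set vs}" by (auto simp: inj_on_def)
      show "finite {x. shift v x \<in> set vs}" by (rule inj_on_finite[OF inj, of "set vs"]) auto
      have "card {x. shift v x \<in> set vs} \<le> card (set vs)" by (rule card_inj_on_le[OF inj]) auto
      then show "card {x. shift v x \<in> set vs} \<le> s - 2" using card_length[of vs] len by linarith
    qed
    let ?A = "{p \<in> ?T. fst p \<in> {x. shift (hd vs) x \<in> set vs}}"
    let ?B = "{p \<in> ?T. fst (snd p) \<in> {0}}"
    let ?C = "{p \<in> ?T. snd (snd p) \<in> {z. shift (last vs) z \<in> set vs}}"
    have cA: "card ?A \<le> 2 * card {x. shift (hd vs) x \<in> set vs}"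
      by (rule card_filter_values[OF finite_triples U(1) card_triples_fixed(1)[OF ab(3)]])
    have cB: "card ?B \<le> 2 * card {0 :: 'a}"
      by (rule card_filter_values[OF finite_triples _ card_triples_fixed(2)[OF ab(3)]]) simp
    have cC: "card ?C \<le> 2 * card {z. shift (last vs) z \<in> set vs}"
      by (rule card_filter_values[OF finite_triples U(1) card_triples_fixed(3)[OF ab(3)]])
    have finE: "finite ?E" by (rule finite_subset[OF _ finite_triples[of a b]]) auto
    have "?T \<subseteq> ?E \<union> ?A \<union> ?B \<union> ?C" by auto
    then have "card ?T \<le> card (?E \<union> ?A \<union> ?B \<union> ?C)"
      using finE finite_triples by (intro card_mono) auto
    also have "\<dots> \<le> card ?E + card ?A + card ?B + card ?C"
      by (intro order.trans[OF card_Un_le] add_mono order_refl)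
    \<comment> \<open>Each of the s - 2 vertices of the path rules out two triples through x and two
      through z, and y = 0 rules out two more.\<close>
    finally have "q - 2 \<le> card ?E + 2 * (s - 2) + 2 + 2 * (s - 2)"
      using card_triples_ge[OF ab] cA cB cC U(2)[of "hd vs"] U(2)[of "last vs"] by simp
    then show "q - 4 * s \<le> card (?Q vs)"
      using s unfolding a_def b_def by linarith
    show "finite (?Q vs)"
      using finE unfolding a_def b_def .
    fix p assume "p \<in> ?Q vs"
    then obtain x y z where p: "p = (x, y, z)" and t: "(x, y, z) \<in> ?T" and y: "y \<noteq> 0"
      and out: "shift (hd vs) x \<notin> set vs" "shift (last vs) z \<notin> set vs"
      by (auto simp: a_def b_def)
    have F: "x \<in> F" "y \<in> F" "z \<in> F" and abeq: "a = x + y + z" "b = x ^ 3 + y ^ 3 + z ^ 3"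
      using t by (auto simp: triples_def)
    \<comment> \<open>A step 0 would lead back to an end of the path, so x and z are nonzero once
      the new vertices lie off the path.\<close>
    have "x \<noteq> 0" using out(1) ne by (auto simp: shift_def)
    have "z \<noteq> 0" using out(2) ne by (auto simp: shift_def)
    have "fst (last vs) = fst (hd vs) + (x + y + z)" "snd (last vs) = snd (hd vs) + (x ^ 3 + y ^ 3 + z ^ 3)"
      using abeq by (simp_all add: a_def[symmetric] b_def[symmetric] flip: abeq) (simp_all add: a_def b_def add.left_commute)
    then have eq: "shift (last vs) z = shift (shift (hd vs) x) y"
      by (simp add: shift_def add.assoc)
    have adj1: "cadj (shift (hd vs) x) (hd vs)"
      using hd F \<open>x \<noteq> 0\<close> by (intro adj_sym[OF cadj_shift])
    have adj2: "cadj (shift (last vs) z) (shift (hd vs) x)"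
      unfolding eq using hd F y by (intro adj_sym[OF cadj_shift] shift_verts)
    have adj3: "cadj (last vs) (shift (last vs) z)"
      using hd F \<open>z \<noteq> 0\<close> by (intro cadj_shift)
    have "shift (last vs) z \<noteq> shift (hd vs) x" using adj2 adj_irrefl by metis
    then show "(case p of (x, y, z) \<Rightarrow> shift (last vs) z # shift (hd vs) x # vs) \<in> cycles s"
      using adj1 adj2 adj3 out dist succ len ne s
      by (auto simp: p cycles_def successively_Cons)
  next
    fix vs vs' p p'
    assume *: "vs \<in> ?G" "vs' \<in> ?G"
      "p \<in> ?Q vs"
      "p' \<in> ?Q vs'"
      "(case p of (x, y, z) \<Rightarrow> shift (last vs) z # shift (hd vs) x # vs) =
       (case p' of (x, y, z) \<Rightarrow> shift (last vs') z # shift (hd vs') x # vs')"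
    obtain x y z x' y' z' where p: "p = (x, y, z)" "p' = (x', y', z')" by (cases p; cases p') auto
    have eq: "vs = vs'" "x = x'" "z = z'" using *(5) by (auto simp: p)
    have "x + y + z = x + y' + z" using *(3,4) eq by (auto simp: p triples_def)
    then have "y = y'" by simp
    then show "vs = vs' \<and> p = p'" using eq p by simp
  qed (use finite_cycles s in auto)
  have "(q - 4 * s) ^ (s - 4) * q\<^sup>2 \<le> (q - (s - 4 + 1)) ^ (s - 4) * q\<^sup>2"
    using s by (intro mult_le_mono1 power_mono diff_le_mono2) auto
  also have "\<dots> \<le> card (paths (s - 4))" by (rule card_paths)
  finally have "(q - 4 * s) * ((q - 4 * s) * ((q - 4 * s) ^ (s - 4) * q\<^sup>2)) \<le> (q - 4 * s) * ((q - 4 * s) * card (paths (s - 4)))"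
    by (intro mult_le_mono2)
  also have "\<dots> \<le> (q - 4 * s) * card ?G" using G by (intro mult_le_mono2)
  also have "\<dots> \<le> card (cycles s)" by (rule C)
  finally have "(q - 4 * s) * ((q - 4 * s) * ((q - 4 * s) ^ (s - 4) * q\<^sup>2)) \<le> card (cycles s)" .
  moreover have "s - 2 = Suc (Suc (s - 4))" using s by simp
  ultimately show ?thesis by (simp add: mult.assoc)
qed

end

section \<open>The field with 2^k elements for odd k\<close>

lemma square_char_2:
  fixes x y :: "'a :: comm_ring_1"
  assumes "(2 :: 'a) = 0"
  shows "(x + y) ^ (2 ^ k) = x ^ (2 ^ k) + y ^ (2 ^ k)"
proof (induction k)
  case (Suc k)
  have "(x + y) ^ (2 ^ Suc k) = ((x + y) ^ (2 ^ k))\<^sup>2"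
    by (simp add: power_mult[symmetric] mult.commute)
  also have "\<dots> = (x ^ (2 ^ k) + y ^ (2 ^ k))\<^sup>2" by (simp only: Suc)
  also have "\<dots> = (x ^ (2 ^ k))\<^sup>2 + (y ^ (2 ^ k))\<^sup>2"
    using assms by (simp add: power2_sum)
  also have "\<dots> = x ^ (2 ^ Suc k) + y ^ (2 ^ Suc k)"
    by (simp add: power_mult[symmetric] mult.commute)
  finally show ?case .
qed simp

text \<open>The multiset of roots has size \<open>degree p\<close>, and a repeated root would also
  be a root of the derivative.\<close>

lemma card_roots_separable:
  fixes p :: "'a :: alg_closed_field poly"
  assumes "p \<noteq> 0" "\<And>a. poly p a = 0 \<Longrightarrow> poly (pderiv p) a \<noteq> 0"
  shows "card {x. poly p x = 0} = degree p"
proof -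
  obtain A where A: "size A = degree p" "p = smult (lead_coeff p) (\<Prod>x\<in>#A. [:-x, 1:])"
    using alg_closed_imp_factorization[OF assms(1)] by blast
  have roots: "poly p x = 0 \<longleftrightarrow> x \<in># A" for x
  proof -
    have "poly p x = lead_coeff p * (\<Prod>a\<in>#A. x - a)"
      by (subst A(2)) (simp add: poly_prod_mset image_mset.compositionality comp_def)
    then show ?thesis using assms(1) by (auto simp: prod_mset_zero_iff)
  qed
  have "count A a \<le> 1" for a
  proof (rule ccontr)
    assume "\<not> count A a \<le> 1"
    then have "count A a \<ge> 2" by simp
    then have "{#a, a#} \<subseteq># A" by (auto simp: subseteq_mset_def)
    then obtain B where B: "A = {#a, a#} + B" by (metis subset_mset.add_diff_inverse)
    define g where "g = smult (lead_coeff p) (\<Prod>x\<in>#B. [:-x, 1:])"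
    define l where "l = [:-a, 1:]"
    have l: "poly l a = 0" by (simp add: l_def)
    have p: "p = l * (l * g)"
      by (subst A(2)) (simp add: B g_def l_def mult_smult_right)
    have "poly (pderiv p) a = 0" unfolding p by (simp add: pderiv_mult l)
    moreover have "poly p a = 0" unfolding p by (simp add: l)
    ultimately show False using assms(2) by blast
  qed
  then have "A = mset_set (set_mset A)"
    by (intro multiset_eqI) (metis count_mset_set(1,3) finite_set_mset le_antisym less_one linorder_not_le not_in_iff count_greater_eq_one_iff)
  then have "card (set_mset A) = size A" by (metis size_mset_set)
  moreover have "{x. poly p x = 0} = set_mset A" using roots by auto
  ultimately show ?thesis using A(1) by simp
qed

lemma two_gf2: "(2 :: gf2) = 0"
proof -
  have "(1 :: gf2) + 1 = 0" by transfer simp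
  then show ?thesis by simp
qed

lemma two_alg_closure: "(2 :: gf2 alg_closure) = 0"
  using two_gf2 by (metis to_ac_0 to_ac_numeral)

text \<open>The roots of X^(2^k) - X in the algebraic closure; its derivative is the constant -1, so
  there are 2^k of them. Closure under addition is additivity of the iterated Frobenius map.\<close>

lemma char_2_subfield_gf:
  assumes "odd k"
  shows "char_2_subfield {x :: gf2 alg_closure. x ^ (2 ^ k) = x} (2 ^ k)"
proof
  let ?p = "monom 1 (2 ^ k) - [:0, 1:] :: gf2 alg_closure poly"
  note two = two_alg_closure
  have k: "k > 0" using assms by (cases k) auto
  have "(1 :: nat) < 2 ^ k" using one_less_power[of "2 :: nat" k] k by simp
  then have deg: "degree ?p = 2 ^ k"
    unfolding diff_conv_add_uminus by (subst degree_add_eq_left) (auto simp: degree_monom_eq)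
  have roots: "poly ?p x = 0 \<longleftrightarrow> x ^ (2 ^ k) = x" for x by (simp add: poly_monom)
  have "(of_nat (2 ^ k) :: gf2 alg_closure) = 0" using k by (simp add: two zero_power)
  then have "pderiv ?p = [:-1:]"
    by (simp only: pderiv_diff pderiv_monom) (simp add: pderiv_pCons)
  then have "card {x. poly ?p x = 0} = degree ?p"
    using deg by (intro card_roots_separable) auto
  then show card: "card {x :: gf2 alg_closure. x ^ (2 ^ k) = x} = 2 ^ k" using deg roots by simp
  show "finite {x :: gf2 alg_closure. x ^ (2 ^ k) = x}"
    using card by (intro card_ge_0_finite) simp
  show "(2 :: gf2 alg_closure) = 0" by (rule two)
  show "(0 :: gf2 alg_closure) \<in> {x. x ^ (2 ^ k) = x}" by simp
  show "(1 :: gf2 alg_closure) \<in> {x. x ^ (2 ^ k) = x}" by simp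
  show "x + y \<in> {x. x ^ (2 ^ k) = x}" "x * y \<in> {x. x ^ (2 ^ k) = x}"
    if "x \<in> {x. x ^ (2 ^ k) = x}" "y \<in> {x. x ^ (2 ^ k) = x}" for x y :: "gf2 alg_closure"
    using that square_char_2[OF two, of x y k] by (simp_all add: power_mult_distrib)
  show "inverse x \<in> {x. x ^ (2 ^ k) = x}" if "x \<in> {x. x ^ (2 ^ k) = x}" for x :: "gf2 alg_closure"
    using that by (simp add: power_inverse)
  show "x = 1" if x: "x \<in> {x. x ^ (2 ^ k) = x}" "x ^ 3 = 1" for x :: "gf2 alg_closure"
  proof -
    \<comment> \<open>Here k odd enters: if x^3 = 1, then x = x^(2^k) = x^2.\<close>
    have "\<exists>j. (2 :: nat) ^ k = 3 * j + 2"
    proof -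
      obtain i where i: "k = 2 * i + 1" using assms by (elim oddE)
      have "\<exists>j. (4 :: nat) ^ i = 3 * j + 1"
      proof (induction i)
        case (Suc i)
        then obtain j where "(4 :: nat) ^ i = 3 * j + 1" by blast
        then have "(4 :: nat) ^ Suc i = 3 * (4 * j + 1) + 1" by simp
        then show ?case by blast
      qed auto
      then obtain j where "(4 :: nat) ^ i = 3 * j + 1" by blast
      then have "(2 :: nat) ^ k = 3 * (2 * j) + 2" by (simp add: i power_mult)
      then show ?thesis by blast
    qed
    then obtain j where j: "(2 :: nat) ^ k = 3 * j + 2" by blast
    have "x = x ^ (3 * j + 2)" using x(1) by (simp add: j)
    also have "\<dots> = x\<^sup>2" using x(2) by (simp add: power_add power_mult power2_eq_square)
    finally have "x * 1 = x * x" unfolding power2_eq_square mult_1_right .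
    moreover have "x \<noteq> 0" using x(2) by auto
    ultimately show ?thesis by (metis mult_left_cancel)
  qed
qed

text \<open>As k runs through the odd numbers, q^2 grows by factors 16, so that q^2 <= n < 16 q^2
  can be achieved for every large n.\<close>

lemma lower_bound_C4:
  assumes s: "s \<ge> 4"
  shows "(\<lambda>n. real (ex_rainbow n (cycle_graph s) (cycle_graph 4))) \<in> \<Omega>(\<lambda>n. real n powr (real s / 2))"
proof (rule landau_omega.bigI)
  let ?c = "1 / (real (s ^ s) * 2 ^ (s - 2) * 4 ^ s)"
  show "?c > 0" using s by simp
  show "\<forall>\<^sub>F n in at_top. norm (real (ex_rainbow n (cycle_graph s) (cycle_graph 4))) \<ge> ?c * norm (real n powr (real s / 2))"
    using eventually_ge_at_top[of "(32 * s)\<^sup>2"]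
  proof eventually_elim
    case (elim n)
    have "4 * 1 \<le> (32 * s) * (32 * s)" using s by (intro mult_le_mono) auto
    then have "4 * 1 \<le> n" using elim unfolding power2_eq_square by (rule le_trans)
    then have "n div 4 \<ge> 1" by simp
    then obtain i where i: "16 ^ i \<le> n div 4" "n div 4 < 16 ^ (i + 1)"
      using ex_power_ivl1[of 16 "n div 4"] by auto
    define q :: nat where "q = 2 ^ (2 * i + 1)"
    have q2: "q\<^sup>2 = 4 * 16 ^ i"
      by (simp add: q_def power_mult power_mult_distrib power2_eq_square)
         (simp add: power_mult_distrib[symmetric])
    have le: "q\<^sup>2 \<le> n" using i(1) unfolding q2 by linarith
    have gt: "n < 16 * q\<^sup>2" using i(2) unfolding q2 by simp
    interpret C: char_2_subfield "{x :: gf2 alg_closure. x ^ (2 ^ (2 * i + 1)) = x}" q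
      unfolding q_def by (rule char_2_subfield_gf) simp
    have "card C.cverts \<le> n"
      using le unfolding C.cverts_def card_cartesian_product C.card_F power2_eq_square .
    from ex_rainbow_ge[OF C.coloured_graph_axioms this _ _ C.no_rainbow_C4, of s]
    have upper: "card (C.cycles s) \<le> s ^ s * ex_rainbow n (cycle_graph s) (cycle_graph 4)" using s by simp
    have lower: "(q - 4 * s) ^ (s - 2) * q\<^sup>2 \<le> card (C.cycles s)"
      using C.card_cycles_cayley_4 C.card_cycles_cayley s by (cases "s = 4") auto
    \<comment> \<open>The threshold for n is chosen such that q >= 8 s, whence q - 4 s >= q /
      2.\<close>
    have "(32 * s)\<^sup>2 < (4 * q)\<^sup>2" using elim gt by (simp add: power_mult_distrib)
    then have "32 * s < 4 * q" by (rule power_less_imp_less_base) simp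
    then have q: "8 * s \<le> q" by simp
    have "sqrt (real n) \<le> sqrt (real (16 * q\<^sup>2))" using gt by (intro real_sqrt_le_mono of_nat_mono) simp
    also have "\<dots> = 4 * real q" by (simp add: real_sqrt_mult)
    finally have "sqrt (real n) ^ s \<le> (4 * real q) ^ s" by (intro power_mono) auto
    moreover have "real n powr (real s / 2) = sqrt (real n) ^ s"
    proof -
      have "n > 0" using \<open>4 * 1 \<le> n\<close> by simp
      then have "sqrt (real n) ^ s = (real n powr (1 / 2)) powr real s"
        by (simp add: powr_half_sqrt powr_realpow)
      then show ?thesis by (simp add: powr_powr)
    qed
    ultimately have "real n powr (real s / 2) \<le> 4 ^ s * real q ^ s" by (simp add: power_mult_distrib)
    also have "real q ^ s = real q ^ (s - 2) * real q ^ 2"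
    proof -
      have "s - 2 + 2 = s" using s by simp
      then show ?thesis by (metis power_add)
    qed
    also have "\<dots> \<le> (2 * real (q - 4 * s)) ^ (s - 2) * real q ^ 2"
      using q by (intro mult_right_mono power_mono) auto
    also have "\<dots> = 2 ^ (s - 2) * real ((q - 4 * s) ^ (s - 2) * q\<^sup>2)"
      by (simp add: power_mult_distrib)
    also have "\<dots> \<le> 2 ^ (s - 2) * real (s ^ s * ex_rainbow n (cycle_graph s) (cycle_graph 4))"
      using lower upper by (intro mult_left_mono of_nat_mono) auto
    finally have "real n powr (real s / 2)
      \<le> 4 ^ s * (2 ^ (s - 2) * real (s ^ s * ex_rainbow n (cycle_graph s) (cycle_graph 4)))"
      by simp
    then show ?case using s by (simp add: field_simps)
  qed
qed

theorem theorem1p2: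
  fixes s t :: nat
  assumes "s \<ge> 4" and "t \<ge> 3"
  shows "(t = 4 \<longrightarrow>
        (\<lambda>n. real (ex_rainbow n (cycle_graph s) (cycle_graph t))) \<in> \<Theta>(\<lambda>n. real n powr (real s / 2))) \<and>
     (even s \<and> even t \<and> s \<noteq> t \<longrightarrow>
        (\<lambda>n. real (ex_rainbow n (cycle_graph s) (cycle_graph t))) \<in> \<Theta>(\<lambda>n. real n powr (real s / 2))) \<and>
     (s = t \<and> t \<ge> 6 \<and> even t \<longrightarrow>
        (\<lambda>n. real (ex_rainbow n (cycle_graph s) (cycle_graph t))) \<in> \<Theta>(\<lambda>n. real n powr (real s / 2 - 1))) \<and>
     (t \<ge> 6 \<and> even t \<and> odd s \<longrightarrow>
        (\<lambda>n. real (ex_rainbow n (cycle_graph s) (cycle_graph t))) \<in> \<Theta>(\<lambda>n. real n powr ((real s - 1) / 2))) \<and>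
     (odd s \<and> odd t \<and> s \<le> t \<longrightarrow>
        (\<lambda>n. real (ex_rainbow n (cycle_graph s) (cycle_graph t))) \<in> \<Theta>(\<lambda>n. real n powr (real s - 2))) \<and>
     (odd t \<and> (s > t \<or> even s) \<longrightarrow>
        (\<lambda>n. real (ex_rainbow n (cycle_graph s) (cycle_graph t))) \<in> \<Theta>(\<lambda>n. real n powr (real s)))"
proof -
  let ?f = "\<lambda>n. real (ex_rainbow n (cycle_graph s) (cycle_graph t))"
  have s3: "s \<ge> 3" using assms by simp
  have even_half: "real s / 2 = real (s div 2)" if "even s" using that by (auto elim!: evenE)
  have upper_even: "?f \<in> O(\<lambda>n. real n powr (real s / 2))" if st: "even s" "even t"
  proof -
    have t4: "t \<ge> 4" using st(2) assms(2) by presburger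
    obtain i where "s = 2 * i" using st(1) by (elim evenE)
    then have j: "s = 2 * (i - 2) + 4" using assms(1) by simp
    show ?thesis
      by (rule bigo_of_nat_bound[OF s3 assms(2) coloured_graph.card_even_cycles_even[OF _ _ st(2) t4 j]])
        (use j in auto)
  qed
  have lower_even: "?f \<in> \<Omega>(\<lambda>n. real n powr (real s / 2))" if "even s" "t \<ge> 5" "s \<noteq> t"
    using lower_bound_alternating[of t s] that assms even_half by simp
  have upper_4: "?f \<in> O(\<lambda>n. real n powr (real s / 2))" if t: "t = 4"
  proof (cases "even s")
    case False
    then obtain i where "s = 2 * i + 1" by (elim oddE)
    then have j: "s = 2 * (i - 2) + 5" using assms(1) by simp
    let ?C = "(6 * t)\<^sup>2 * (6 * t) ^ (2 * (i - 2) + 3)"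
    show ?thesis
    proof (rule ex_rainbow_bigo[OF s3 assms(2)])
      fix V adj and col :: "nat \<Rightarrow> nat \<Rightarrow> nat"
      assume cg: "coloured_graph V adj col" and V: "card V \<ge> 1" and free: "coloured_graph.rainbow_cycle_free adj col t"
      let ?N = "card (coloured_graph.cycles adj s)"
      have "?N\<^sup>2 \<le> ?C * card V ^ s"
        by (rule coloured_graph.card_odd_cycles_even_squared[OF cg free _ _ j]) (use t in auto)
      then have "(real ?N)\<^sup>2 \<le> real ?C * real (card V) ^ s"
        using of_nat_mono[of "?N\<^sup>2" "?C * card V ^ s", where 'a = real] by simp
      then have "real ?N \<le> sqrt (real ?C * real (card V) ^ s)" by (rule real_le_rsqrt)
      also have "\<dots> = sqrt (real ?C) * real (card V) powr (real s / 2)"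
      proof -
        have "sqrt (real (card V) ^ s) = (real (card V) powr real s) powr (1 / 2)"
          using V by (simp add: powr_realpow powr_half_sqrt)
        then show ?thesis by (simp add: real_sqrt_mult powr_powr)
      qed
      finally show "real ?N \<le> sqrt (real ?C) * real (card V) powr (real s / 2)" .
    qed
  qed (use upper_even t in auto)
  have lower_4: "?f \<in> \<Omega>(\<lambda>n. real n powr (real s / 2))" if "t = 4"
    using lower_bound_C4[OF assms(1)] that by simp
  have upper_same: "?f \<in> O(\<lambda>n. real n powr (real s / 2 - 1))" if st: "s = t" "t \<ge> 6" "even t"
  proof -
    obtain i where "t = 2 * i" using st(3) by (elim evenE)
    then have j: "t = 2 * (i - 3) + 6" using st(2) by simp
    show ?thesis unfolding st(1)
      by (rule bigo_of_nat_bound[OF assms(2) assms(2) coloured_graph.card_same_cycles_even[OF _ _ j]])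
        (use j in auto)
  qed
  have lower_same: "?f \<in> \<Omega>(\<lambda>n. real n powr (real s / 2 - 1))" if st: "s = t" "t \<ge> 6" "even t"
  proof -
    have "real s / 2 - 1 = real (t div 2 - 1)" using st by (auto elim!: evenE)
    then show ?thesis using lower_bound_same_even[OF st(2,3)] st(1) by simp
  qed
  have upper_odd_even: "?f \<in> O(\<lambda>n. real n powr ((real s - 1) / 2))" if st: "t \<ge> 6" "even t" "odd s"
  proof -
    obtain i where "s = 2 * i + 1" using st(3) by (elim oddE)
    then have j: "s = 2 * (i - 2) + 5" using assms(1) by simp
    show ?thesis
      by (rule bigo_of_nat_bound[OF s3 assms(2) coloured_graph.card_odd_cycles_even[OF _ _ st(2,1) j]])
        (use j in auto)
  qed
  \<comment> \<open>The alternating blow-up serves odd s as well: floor(s / 2) is then (s - 1) / 2,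
    and t differs from s by parity.\<close>
  have lower_odd_even: "?f \<in> \<Omega>(\<lambda>n. real n powr ((real s - 1) / 2))" if st: "t \<ge> 6" "even t" "odd s"
  proof -
    have "(real s - 1) / 2 = real (s div 2)" using st(3) by (auto elim!: oddE)
    moreover have "t \<noteq> s" using st by auto
    ultimately show ?thesis using lower_bound_alternating[of t s] st assms by simp
  qed
  have upper_odd: "?f \<in> O(\<lambda>n. real n powr (real s - 2))" if st: "odd s" "odd t" "s \<le> t"
  proof -
    have s5: "5 \<le> s" using st(1) assms(1) by presburger
    show ?thesis
      by (rule bigo_of_nat_bound[OF s3 assms(2) coloured_graph.card_odd_cycles[OF _ _ st(1,2) s5 st(3)]])
        (use s5 in auto)
  qed
  have lower_odd: "?f \<in> \<Omega>(\<lambda>n. real n powr (real s - 2))" if st: "odd s" "odd t"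
  proof -
    have "5 \<le> s" using st(1) assms(1) by presburger
    then show ?thesis using lower_bound_odd_odd[OF st(2) assms(2)] by simp
  qed
  have upper_all: "?f \<in> O(\<lambda>n. real n powr real s)"
  proof (rule bigo_of_nat_bound[OF s3 assms(2), where C = 1])
    show "card (coloured_graph.cycles adj s) \<le> 1 * card V ^ s"
      if "coloured_graph V adj col" for V adj and col :: "nat \<Rightarrow> nat \<Rightarrow> nat"
      using coloured_graph.card_cycles_le_power[OF that, of s] s3 by simp
  qed simp
  have lower_all: "?f \<in> \<Omega>(\<lambda>n. real n powr real s)" if "odd t" "s > t \<or> even s"
    using lower_bound_odd_t[OF that(1) assms(2,1) that(2)] .
  have t5: "t \<ge> 5" if "even t" "t \<noteq> 4" using that assms(2) by presburger
  show ?thesis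
  proof (intro conjI impI; (elim conjE)?)
    assume "t = 4"
    then show "?f \<in> \<Theta>(\<lambda>n. real n powr (real s / 2))"
      by (intro bigthetaI upper_4 lower_4)
  next
    assume st: "even s" "even t" "s \<noteq> t"
    have "?f \<in> \<Omega>(\<lambda>n. real n powr (real s / 2))"
      using lower_4 lower_even[OF st(1) t5 st(3)] st(2) by (cases "t = 4") auto
    then show "?f \<in> \<Theta>(\<lambda>n. real n powr (real s / 2))"
      by (intro bigthetaI upper_even st)
  next
    assume "s = t" "6 \<le> t" "even t"
    then show "?f \<in> \<Theta>(\<lambda>n. real n powr (real s / 2 - 1))"
      by (intro bigthetaI upper_same lower_same)
  next
    assume "6 \<le> t" "even t" "odd s"
    then show "?f \<in> \<Theta>(\<lambda>n. real n powr ((real s - 1) / 2))"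
      by (intro bigthetaI upper_odd_even lower_odd_even)
  next
    assume "odd s" "odd t" "s \<le> t"
    then show "?f \<in> \<Theta>(\<lambda>n. real n powr (real s - 2))"
      by (intro bigthetaI upper_odd lower_odd)
  next
    assume "odd t" "s > t \<or> even s"
    then show "?f \<in> \<Theta>(\<lambda>n. real n powr (real s))"
      by (intro bigthetaI upper_all lower_all)
  qed
qed

end
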